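(* Let $\Lambda$ be a finite dimensional algebra over an algebraically closed field $k$ with finite strong global dimension $\eta=\mathrm{s.gl.dim}(\Lambda)\geq 1$, and let $r\geq 2$. Say that a functor $F\colon C_{\eta+1}(\mathrm{proj}\Lambda)\to C_{\eta+r}(\mathrm{proj}\Lambda)$ is a translation if it is a composite of $r-1$ functors $C_m(\mathrm{proj}\Lambda)\to C_{m+1}(\mathrm{proj}\Lambda)$, $m=\eta+1,\dots,\eta+r-1$, each of which is $i_{-1}^m$ or $i_0^m$. Then: (i) Up to translation, a morphism between indecomposable complexes is irreducible in $C_{\eta+r}(\mathrm{proj}\Lambda)$ if and only if it is irreducible in $C_{\eta+1}(\mathrm{proj}\Lambda)$. That is: for every irreducible morphism $f\colon X\to Y$ in $C_{\eta+r}(\mathrm{proj}\Lambda)$ with $X,Y$ indecomposable there are a translation $F$ and an irreducible morphism $g$ between indecomposable complexes in $C_{\eta+1}(\mathrm{proj}\Lambda)$ with $F(g)=f$; and for every irreducible morphism $g$ between indecomposable complexes in $C_{\eta+1}(\mathrm{proj}\Lambda)$ there is a translation $F$ such that $F(g)$ is irreducible in $C_{\eta+r}(\mathrm{proj}\Lambda)$. (ii) Up to translation, $\delta\colon X\to Y\to Z$ is an almost split $\mathcal{E}_{\eta+r}$-sequence in $C_{\eta+r}(\mathrm{proj}\Lambda)$ if and only if it is an almost split $\mathcal{E}_{\eta+1}$-sequence in $C_{\eta+1}(\mathrm{proj}\Lambda)$. That is: for every almost split $\mathcal{E}_{\eta+r}$-sequence $\delta$ in $C_{\eta+r}(\mathrm{proj}\Lambda)$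 there are a translation $F$ and an almost split $\mathcal{E}_{\eta+1}$-sequence $\delta'$ in $C_{\eta+1}(\mathrm{proj}\Lambda)$ with $F(\delta')=\delta$; and for every almost split $\mathcal{E}_{\eta+1}$-sequence $\delta'$ in $C_{\eta+1}(\mathrm{proj}\Lambda)$ there is a translation $F$ such that $F(\delta')$ is an almost split $\mathcal{E}_{\eta+r}$-sequence in $C_{\eta+r}(\mathrm{proj}\Lambda)$.
   Context: $\mathrm{proj}\Lambda$ is the category of finitely generated projective right $\Lambda$-modules. For $n\geq 1$, $C_n(\mathrm{proj}\Lambda)$ is the full subcategory of the category of complexes $X=(X^i,d_X^i)_{i\in\mathbb{Z}}$ over $\mathrm{proj}\Lambda$ (with $d_X^i\colon X^i\to X^{i+1}$) with $X^i=0$ for $i\notin\{1,\dots,n\}$. A morphism is irreducible if it is neither a section (split monomorphism) nor a retraction (split epimorphism), and for any factorization $f=hg$, $h$ is a retraction or $g$ is a section. Strong global dimension: each nonzero $X\in K^b(\mathrm{proj}\Lambda)$ has a representative $\bar X$ in $C^b(\mathrm{proj}\Lambda)$, unique up to isomorphism of complexes, without nonzero contractible direct summands (i.e. without indecomposable projective direct summands in $C^b(\mathrm{proj}\Lambda)$); if $\bar X^r\neq 0\neq\bar X^s$ and $\bar X^i=0$ for $i<r$ and $i>s$, then $\ell(X)=s-r$. $\mathrm{s.gl.dim}(\Lambda)=\sup\{\ell(X)\mid X\in K^b(\mathrm{proj}\Lambda)\text{ indecomposable}\}$. $\mathcal{E}_n$ is the class of pairs of composable morphisms $X\to Y\to Z$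 in $C_n(\mathrm{proj}\Lambda)$ such that $0\to X^i\to Y^i\to Z^i\to 0$ is split exact for every $i$. A morphism $g\colon Y\to Z$ is right almost split if it is not a retraction and every $W\to Z$ that is not a retraction factors through $g$; it is right minimal if $gu=g$ with $u\in\mathrm{End}(Y)$ implies $u$ is an automorphism; left almost split and left minimal are dual. An almost split $\mathcal{E}_n$-sequence is a pair $X\xrightarrow{f}Y\xrightarrow{g}Z$ in $\mathcal{E}_n$ with $f$ minimal left almost split and $g$ minimal right almost split in $C_n(\mathrm{proj}\Lambda)$. The functors $i_{-1}^n,i_0^n\colon C_n(\mathrm{proj}\Lambda)\to C_{n+1}(\mathrm{proj}\Lambda)$: $i_{-1}^n(X)^1=0$, $i_{-1}^n(X)^j=X^{j-1}$ for $2\leq j\leq n+1$, with differentials $d^1=0$, $d^j=d_X^{j-1}$ for $2\leq j\leq n$; and $i_0^n(X)^j=X^j$ for $1\leq j\leq n$, $i_0^n(X)^{n+1}=0$, with the differentials of $X$. They act on morphisms componentwise in the corresponding way. *)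

theory Defs
  imports
    "HOL-Computational_Algebra.Polynomial"
    "HOL-Library.Extended_Nat"
    "HOL-Algebra.Group"
begin

definition fin_dim_algebra :: "('k::field \<Rightarrow> 'a::ring_1 \<Rightarrow> 'a) \<Rightarrow> bool" where
  "fin_dim_algebra scale \<longleftrightarrow>
     vector_space scale \<and>
     (\<forall>c a b. scale c (a * b) = scale c a * b \<and> scale c (a * b) = a * scale c b) \<and>
     (\<exists>B. finite B \<and> module.span scale B = UNIV)"

text \<open>
  The elements of all modules are taken from one type \<open>'m\<close>, and \<open>0 :: 'm\<close> is the zero element of
  every module. Operations and homomorphisms take the value \<open>0\<close> outside their domains. Hence
  equality of modules and of homomorphisms is equality in HOL, there is exactly one module with
  one element, and homomorphisms are composed with \<open>(\<circ>)\<close>. If there is an injection of \<open>'a list\<close>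
  into \<open>'m\<close>, every finitely generated projective module has an isomorphic copy with elements in \<open>'m\<close>.
\<close>

record ('a, 'm) rmod =
  mcarrier :: "'m set"
  madd :: "'m \<Rightarrow> 'm \<Rightarrow> 'm"
  mact :: "'m \<Rightarrow> 'a \<Rightarrow> 'm"

definition right_module :: "('a::ring_1, 'm::zero) rmod \<Rightarrow> bool" where
  "right_module M \<longleftrightarrow>
     comm_group \<lparr>carrier = mcarrier M, mult = madd M, one = 0\<rparr> \<and>
     (\<forall>x\<in>mcarrier M. \<forall>a. mact M x a \<in> mcarrier M) \<and>
     (\<forall>x\<in>mcarrier M. \<forall>y\<in>mcarrier M. \<forall>a. mact M (madd M x y) a = madd M (mact M x a) (mact M y a)) \<and>
     (\<forall>x\<in>mcarrier M. \<forall>a b. mact M x (a + b) = madd M (mact M x a) (mact M x b)) \<and>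
     (\<forall>x\<in>mcarrier M. \<forall>a b. mact M x (a * b) = mact M (mact M x a) b) \<and>
     (\<forall>x\<in>mcarrier M. mact M x 1 = x) \<and>
     (\<forall>x y. x \<notin> mcarrier M \<or> y \<notin> mcarrier M \<longrightarrow> madd M x y = 0) \<and>
     (\<forall>x a. x \<notin> mcarrier M \<longrightarrow> mact M x a = 0)"

definition zero_mod :: "('a::ring_1, 'm::zero) rmod" where
  "zero_mod = \<lparr>mcarrier = {0}, madd = (\<lambda>_ _. 0), mact = (\<lambda>_ _. 0)\<rparr>"

definition mod_hom :: "('a::ring_1, 'm::zero) rmod \<Rightarrow> ('a, 'm) rmod \<Rightarrow> ('m \<Rightarrow> 'm) set" where
  "mod_hom M N =
     {f. (\<forall>x\<in>mcarrier M. f x \<in> mcarrier N) \<and>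
         (\<forall>x\<in>mcarrier M. \<forall>y\<in>mcarrier M. f (madd M x y) = madd N (f x) (f y)) \<and>
         (\<forall>x\<in>mcarrier M. \<forall>a. f (mact M x a) = mact N (f x) a) \<and>
         (\<forall>x. x \<notin> mcarrier M \<longrightarrow> f x = 0)}"

definition id_mod :: "('a::ring_1, 'm::zero) rmod \<Rightarrow> 'm \<Rightarrow> 'm" where
  "id_mod M = (\<lambda>x. if x \<in> mcarrier M then x else 0)"

definition submod :: "'m::zero set \<Rightarrow> ('a::ring_1, 'm) rmod \<Rightarrow> bool" where
  "submod N M \<longleftrightarrow> N \<subseteq> mcarrier M \<and> 0 \<in> N \<and>
     (\<forall>x\<in>N. \<forall>y\<in>N. madd M x y \<in> N) \<and> (\<forall>x\<in>N. \<forall>a. mact M x a \<in> N)"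

definition fin_generated :: "('a::ring_1, 'm::zero) rmod \<Rightarrow> bool" where
  "fin_generated M \<longleftrightarrow>
     (\<exists>S. finite S \<and> S \<subseteq> mcarrier M \<and> (\<forall>N. submod N M \<and> S \<subseteq> N \<longrightarrow> N = mcarrier M))"

text \<open>
  The test modules range over the modules with elements in \<open>'m\<close>. For finitely generated \<open>M\<close> this is
  ordinary projectivity as soon as \<open>'m\<close> has room for the free modules of finite rank.
\<close>

definition projective :: "('a::ring_1, 'm::zero) rmod \<Rightarrow> bool" where
  "projective M \<longleftrightarrow>
     (\<forall>N L :: ('a, 'm) rmod. right_module N \<and> right_module L \<longrightarrow>
        (\<forall>g\<in>mod_hom N L. g ` mcarrier N = mcarrier L \<longrightarrow>
           (\<forall>h\<in>mod_hom M L. \<exists>l\<in>mod_hom M N. g \<circ> l = h)))"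

definition fg_proj :: "('a::ring_1, 'm::zero) rmod \<Rightarrow> bool" where
  "fg_proj M \<longleftrightarrow> right_module M \<and> fin_generated M \<and> projective M"

definition split_exact ::
  "('a::ring_1, 'm::zero) rmod \<Rightarrow> ('a, 'm) rmod \<Rightarrow> ('a, 'm) rmod \<Rightarrow> ('m \<Rightarrow> 'm) \<Rightarrow> ('m \<Rightarrow> 'm) \<Rightarrow> bool" where
  "split_exact A B C f g \<longleftrightarrow>
     f \<in> mod_hom A B \<and> g \<in> mod_hom B C \<and>
     inj_on f (mcarrier A) \<and>
     f ` mcarrier A = {y \<in> mcarrier B. g y = 0} \<and>
     g ` mcarrier B = mcarrier C \<and>
     (\<exists>s\<in>mod_hom C B. g \<circ> s = id_mod C)"

record ('a, 'm) cpx =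
  ob :: "int \<Rightarrow> ('a, 'm) rmod"
  diff :: "int \<Rightarrow> 'm \<Rightarrow> 'm"

text \<open>A chain map is given by its components; its source and target are kept separately.\<close>

type_synonym 'm cmap = "int \<Rightarrow> 'm \<Rightarrow> 'm"

definition proj_complex :: "('a::ring_1, 'm::zero) cpx \<Rightarrow> bool" where
  "proj_complex X \<longleftrightarrow>
     (\<forall>i. fg_proj (ob X i) \<and> diff X i \<in> mod_hom (ob X i) (ob X (i + 1)) \<and>
          diff X (i + 1) \<circ> diff X i = (\<lambda>_. 0))"

definition Cn :: "nat \<Rightarrow> ('a::ring_1, 'm::zero) cpx set" where
  "Cn n = {X. proj_complex X \<and> (\<forall>i. i \<notin> {1..int n} \<longrightarrow> ob X i = zero_mod)}"

definition Cb :: "('a::ring_1, 'm::zero) cpx set" where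
  "Cb = {X. proj_complex X \<and> (\<exists>a b. \<forall>i. i \<notin> {a..b} \<longrightarrow> ob X i = zero_mod)}"

definition chain_maps :: "('a::ring_1, 'm::zero) cpx \<Rightarrow> ('a, 'm) cpx \<Rightarrow> 'm cmap set" where
  "chain_maps X Y =
     {f. \<forall>i. f i \<in> mod_hom (ob X i) (ob Y i) \<and> diff Y i \<circ> f i = f (i + 1) \<circ> diff X i}"

definition ccomp :: "'m cmap \<Rightarrow> 'm cmap \<Rightarrow> 'm cmap" (infixl "\<odot>" 70) where
  "g \<odot> f = (\<lambda>i. g i \<circ> f i)"

definition cid :: "('a::ring_1, 'm::zero) cpx \<Rightarrow> 'm cmap" where
  "cid X = (\<lambda>i. id_mod (ob X i))"

definition czero :: "'m::zero cmap" where
  "czero = (\<lambda>_ _. 0)"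

definition cadd :: "('a::ring_1, 'm::zero) cpx \<Rightarrow> 'm cmap \<Rightarrow> 'm cmap \<Rightarrow> 'm cmap" where
  "cadd Y f g = (\<lambda>i x. madd (ob Y i) (f i x) (g i x))"

definition homotopic :: "('a::ring_1, 'm::zero) cpx \<Rightarrow> ('a, 'm) cpx \<Rightarrow> 'm cmap \<Rightarrow> 'm cmap \<Rightarrow> bool" where
  "homotopic X Y f g \<longleftrightarrow>
     (\<exists>h. (\<forall>i. h i \<in> mod_hom (ob X i) (ob Y (i - 1))) \<and>
          f = cadd Y g (\<lambda>i x. madd (ob Y i) (diff Y (i - 1) (h i x)) (h (i + 1) (diff X i x))))"

text \<open>
  The parameter \<open>R\<close> is the relation on parallel chain maps that is read as equality of morphisms:
  \<open>strict\<close> for categories of complexes and \<open>homotopic\<close> for the homotopy category.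
\<close>

type_synonym ('a, 'm) morrel = "('a, 'm) cpx \<Rightarrow> ('a, 'm) cpx \<Rightarrow> 'm cmap \<Rightarrow> 'm cmap \<Rightarrow> bool"

definition strict :: "('a, 'm) morrel" where
  "strict X Y f g \<longleftrightarrow> f = g"

definition null_object :: "('a::ring_1, 'm::zero) morrel \<Rightarrow> ('a, 'm) cpx \<Rightarrow> bool" where
  "null_object R X \<longleftrightarrow> R X X (cid X) czero"

definition isomorphic :: "('a::ring_1, 'm::zero) morrel \<Rightarrow> ('a, 'm) cpx \<Rightarrow> ('a, 'm) cpx \<Rightarrow> bool" where
  "isomorphic R X Y \<longleftrightarrow>
     (\<exists>f\<in>chain_maps X Y. \<exists>g\<in>chain_maps Y X. R X X (g \<odot> f) (cid X) \<and> R Y Y (f \<odot> g) (cid Y))"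

definition direct_sum ::
  "('a::ring_1, 'm::zero) morrel \<Rightarrow> ('a, 'm) cpx \<Rightarrow> ('a, 'm) cpx \<Rightarrow> ('a, 'm) cpx \<Rightarrow> bool" where
  "direct_sum R X A B \<longleftrightarrow>
     (\<exists>iA\<in>chain_maps A X. \<exists>iB\<in>chain_maps B X. \<exists>pA\<in>chain_maps X A. \<exists>pB\<in>chain_maps X B.
        R A A (pA \<odot> iA) (cid A) \<and> R B B (pB \<odot> iB) (cid B) \<and>
        R A B (pB \<odot> iA) czero \<and> R B A (pA \<odot> iB) czero \<and>
        R X X (cadd X (iA \<odot> pA) (iB \<odot> pB)) (cid X))"

definition indecomposable ::
  "('a::ring_1, 'm::zero) morrel \<Rightarrow> ('a, 'm) cpx set \<Rightarrow> ('a, 'm) cpx \<Rightarrow> bool" where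
  "indecomposable R \<C> X \<longleftrightarrow>
     X \<in> \<C> \<and> \<not> null_object R X \<and>
     (\<forall>A\<in>\<C>. \<forall>B\<in>\<C>. direct_sum R X A B \<longrightarrow> null_object R A \<or> null_object R B)"

definition no_contractible_summand :: "('a::ring_1, 'm::zero) cpx \<Rightarrow> bool" where
  "no_contractible_summand X \<longleftrightarrow>
     (\<forall>A\<in>Cb. \<forall>B\<in>Cb. direct_sum strict X A B \<and> null_object homotopic A \<longrightarrow> null_object strict A)"

text \<open>The relation \<open>\<ell>(X) = l\<close>, where \<open>Y\<close> is the representative of \<open>X\<close> without contractible summands.\<close>

definition has_length :: "('a::ring_1, 'm::zero) cpx \<Rightarrow> nat \<Rightarrow> bool" where
  "has_length X l \<longleftrightarrow>
     (\<exists>Y\<in>Cb. isomorphic homotopic X Y \<and> no_contractible_summand Y \<and>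
        (\<exists>r s. ob Y r \<noteq> zero_mod \<and> ob Y s \<noteq> zero_mod \<and>
               (\<forall>i. i < r \<or> s < i \<longrightarrow> ob Y i = zero_mod) \<and> int l = s - r))"

definition strong_gl_dim :: "'a::ring_1 itself \<Rightarrow> 'm::zero itself \<Rightarrow> enat" where
  "strong_gl_dim _ _ =
     Sup {enat l |l. \<exists>X :: ('a, 'm) cpx. indecomposable homotopic Cb X \<and> has_length X l}"

definition is_section :: "('a::ring_1, 'm::zero) cpx \<Rightarrow> ('a, 'm) cpx \<Rightarrow> 'm cmap \<Rightarrow> bool" where
  "is_section X Y f \<longleftrightarrow> (\<exists>g\<in>chain_maps Y X. g \<odot> f = cid X)"

definition is_retraction :: "('a::ring_1, 'm::zero) cpx \<Rightarrow> ('a, 'm) cpx \<Rightarrow> 'm cmap \<Rightarrow> bool" where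
  "is_retraction X Y f \<longleftrightarrow> (\<exists>g\<in>chain_maps Y X. f \<odot> g = cid Y)"

definition is_automorphism :: "('a::ring_1, 'm::zero) cpx \<Rightarrow> 'm cmap \<Rightarrow> bool" where
  "is_automorphism X u \<longleftrightarrow>
     u \<in> chain_maps X X \<and> (\<exists>v\<in>chain_maps X X. v \<odot> u = cid X \<and> u \<odot> v = cid X)"

definition irreducible_mor ::
  "nat \<Rightarrow> ('a::ring_1, 'm::zero) cpx \<Rightarrow> ('a, 'm) cpx \<Rightarrow> 'm cmap \<Rightarrow> bool" where
  "irreducible_mor n X Y f \<longleftrightarrow>
     X \<in> Cn n \<and> Y \<in> Cn n \<and> f \<in> chain_maps X Y \<and>
     \<not> is_section X Y f \<and> \<not> is_retraction X Y f \<and>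
     (\<forall>W\<in>Cn n. \<forall>g\<in>chain_maps X W. \<forall>h\<in>chain_maps W Y.
        f = h \<odot> g \<longrightarrow> is_retraction W Y h \<or> is_section X W g)"

definition right_almost_split ::
  "nat \<Rightarrow> ('a::ring_1, 'm::zero) cpx \<Rightarrow> ('a, 'm) cpx \<Rightarrow> 'm cmap \<Rightarrow> bool" where
  "right_almost_split n Y Z g \<longleftrightarrow>
     Y \<in> Cn n \<and> Z \<in> Cn n \<and> g \<in> chain_maps Y Z \<and> \<not> is_retraction Y Z g \<and>
     (\<forall>W\<in>Cn n. \<forall>w\<in>chain_maps W Z.
        \<not> is_retraction W Z w \<longrightarrow> (\<exists>v\<in>chain_maps W Y. w = g \<odot> v))"

definition right_minimal :: "('a::ring_1, 'm::zero) cpx \<Rightarrow> 'm cmap \<Rightarrow> bool" where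
  "right_minimal Y g \<longleftrightarrow> (\<forall>u\<in>chain_maps Y Y. g \<odot> u = g \<longrightarrow> is_automorphism Y u)"

definition left_almost_split ::
  "nat \<Rightarrow> ('a::ring_1, 'm::zero) cpx \<Rightarrow> ('a, 'm) cpx \<Rightarrow> 'm cmap \<Rightarrow> bool" where
  "left_almost_split n X Y f \<longleftrightarrow>
     X \<in> Cn n \<and> Y \<in> Cn n \<and> f \<in> chain_maps X Y \<and> \<not> is_section X Y f \<and>
     (\<forall>W\<in>Cn n. \<forall>w\<in>chain_maps X W.
        \<not> is_section X W w \<longrightarrow> (\<exists>v\<in>chain_maps Y W. w = v \<odot> f))"

definition left_minimal :: "('a::ring_1, 'm::zero) cpx \<Rightarrow> 'm cmap \<Rightarrow> bool" where
  "left_minimal Y f \<longleftrightarrow> (\<forall>u\<in>chain_maps Y Y. u \<odot> f = f \<longrightarrow> is_automorphism Y u)"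

definition E_pair ::
  "nat \<Rightarrow> ('a::ring_1, 'm::zero) cpx \<Rightarrow> ('a, 'm) cpx \<Rightarrow> ('a, 'm) cpx \<Rightarrow> 'm cmap \<Rightarrow> 'm cmap \<Rightarrow> bool" where
  "E_pair n X Y Z f g \<longleftrightarrow>
     X \<in> Cn n \<and> Y \<in> Cn n \<and> Z \<in> Cn n \<and> f \<in> chain_maps X Y \<and> g \<in> chain_maps Y Z \<and>
     (\<forall>i. split_exact (ob X i) (ob Y i) (ob Z i) (f i) (g i))"

definition almost_split_seq ::
  "nat \<Rightarrow> ('a::ring_1, 'm::zero) cpx \<Rightarrow> ('a, 'm) cpx \<Rightarrow> ('a, 'm) cpx \<Rightarrow> 'm cmap \<Rightarrow> 'm cmap \<Rightarrow> bool" where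
  "almost_split_seq n X Y Z f g \<longleftrightarrow>
     E_pair n X Y Z f g \<and>
     left_almost_split n X Y f \<and> left_minimal Y f \<and>
     right_almost_split n Y Z g \<and> right_minimal Y g"

text \<open>
  Both functors act on a chain map through its components only. A functor is therefore recorded as
  a map on complexes and a map on families of components.
\<close>

record ('a, 'm) cfunctor =
  on_ob :: "('a, 'm) cpx \<Rightarrow> ('a, 'm) cpx"
  on_mor :: "'m cmap \<Rightarrow> 'm cmap"

definition functor_id :: "('a, 'm) cfunctor" where
  "functor_id = \<lparr>on_ob = id, on_mor = id\<rparr>"

definition functor_comp :: "('a, 'm) cfunctor \<Rightarrow> ('a, 'm) cfunctor \<Rightarrow> ('a, 'm) cfunctor" where
  "functor_comp G F = \<lparr>on_ob = on_ob G \<circ> on_ob F, on_mor = on_mor G \<circ> on_mor F\<rparr>"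

definition i_minus :: "nat \<Rightarrow> ('a::ring_1, 'm::zero) cfunctor" where
  "i_minus n =
     \<lparr>on_ob = (\<lambda>X. \<lparr>ob = (\<lambda>j. if j \<in> {2..int n + 1} then ob X (j - 1) else zero_mod),
                     diff = (\<lambda>j. if j \<in> {2..int n} then diff X (j - 1) else (\<lambda>_. 0))\<rparr>),
      on_mor = (\<lambda>f j. if j \<in> {2..int n + 1} then f (j - 1) else (\<lambda>_. 0))\<rparr>"

definition i_zero :: "nat \<Rightarrow> ('a::ring_1, 'm::zero) cfunctor" where
  "i_zero n =
     \<lparr>on_ob = (\<lambda>X. \<lparr>ob = (\<lambda>j. if j \<in> {1..int n} then ob X j else zero_mod),
                     diff = (\<lambda>j. if j \<in> {1..<int n} then diff X j else (\<lambda>_. 0))\<rparr>),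
      on_mor = (\<lambda>f j. if j \<in> {1..int n} then f j else (\<lambda>_. 0))\<rparr>"

inductive translation :: "nat \<Rightarrow> nat \<Rightarrow> ('a::ring_1, 'm::zero) cfunctor \<Rightarrow> bool" for m where
  refl: "translation m m functor_id"
| minus: "translation m n F \<Longrightarrow> translation m (Suc n) (functor_comp (i_minus n) F)"
| zero: "translation m n F \<Longrightarrow> translation m (Suc n) (functor_comp (i_zero n) F)"

end

theory Submission
  imports Defs
begin

text \<open>
  Put \<open>n = \<eta>\<close>. Since indecomposables of the homotopy category have width at most \<open>n\<close>, every bounded
  complex has, for each degree \<open>m\<close>, an idempotent endomorphism that is the identity in degrees up
  to \<open>m\<close> and zero in degrees above \<open>m + n\<close> (band splitting). In particular indecomposable
  complexes have width at most \<open>n\<close>.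

  Consider an irreducible \<open>f : X \<rightarrow> Y\<close> whose joint support is \<open>[p, q]\<close> with \<open>q > p + n\<close>. If \<open>Y\<close>
  starts in degree \<open>p\<close>, then \<open>f\<close> factors through a brutal truncation of \<open>Y\<close>, which is absurd. If
  \<open>X\<close> starts in degree \<open>p\<close>, apply band splitting to the mapping cone of \<open>f\<close>: the resulting
  idempotent yields a factorization of \<open>f\<close> that contradicts irreducibility. Almost split sequences
  are treated alike, with band splitting of the middle term. So everything in the large category
  lives in a window of \<open>n + 1\<close> consecutive degrees.

  Conversely, let \<open>[a, N]\<close> be a window with \<open>N = a + n\<close>. Irreducibility in the window persists in all
  larger intervals \<open>[a, b]\<close> if the target \<open>Y\<close> admits no nonzero map \<open>z : Y\<^sup>N \<rightarrow> P\<close> to a projective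
  with \<open>z d = 0\<close>, and in all \<open>[b, N]\<close> if dually the source \<open>X\<close> admits no nonzero \<open>P \<rightarrow> X\<^sup>a\<close> killed by
  \<open>d\<close>. If \<open>Y\<^sup>a \<noteq> 0\<close>, a nonzero \<open>z\<close> would glue \<open>Y\<close> and \<open>P\<close> to a complex of width \<open>n + 1\<close>, and band
  splitting of it would decompose \<open>Y\<close>. The case in which both conditions could fail is again excluded
  by the cone argument. For almost split sequences \<open>Y\<close> is replaced by the last term.
\<close>

section \<open>Modules\<close>

text \<open>Narrowness is a property of each indecomposable alone, whereas a window has to contain
  two or three complexes at once; this needs the irreducible maps and almost split sequences
  themselves. The two ways of being staggered behave differently. If the target starts lower, its
  part above the lowest degree is a subcomplex through which the map factors. If the source starts
  lower, dropping its lowest term gives no quotient complex, so the factorization has to come from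
  the homotopy category, through the cone.

  Summands are handled as idempotents: complexes and maps are compared by equality, the image of an
  idempotent is again a complex over the same type, and no choice of isomorphism enters. Finite
  dimension enters as finite length, for splitting complexes into indecomposables and for Fitting's
  lemma. The latter shows that a complex indecomposable as a complex is contractible or
  indecomposable up to homotopy, which is the link to strong global dimension. The bound
  \<open>\<eta> \<ge> 1\<close> covers contractible indecomposables, which occupy at most two
  degrees.\<close>

context
  fixes M :: "('a::ring_1, 'm::zero) rmod"
  assumes M: "right_module M"
begin

interpretation G: comm_group "\<lparr>carrier = mcarrier M, mult = madd M, one = 0\<rparr>"
  using M by (simp add: right_module_def)

lemma zero_in_carrier: "0 \<in> mcarrier M"
  using G.one_closed by simp

lemma madd_closed: "x \<in> mcarrier M \<Longrightarrow> y \<in> mcarrier M \<Longrightarrow> madd M x y \<in> mcarrier M"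
  using G.m_closed by simp

lemma madd_assoc:
  "x \<in> mcarrier M \<Longrightarrow> y \<in> mcarrier M \<Longrightarrow> z \<in> mcarrier M \<Longrightarrow>
     madd M (madd M x y) z = madd M x (madd M y z)"
  using G.m_assoc by simp

lemma madd_comm: "x \<in> mcarrier M \<Longrightarrow> y \<in> mcarrier M \<Longrightarrow> madd M x y = madd M y x"
  using G.m_comm by simp

lemma madd_left_comm:
  "x \<in> mcarrier M \<Longrightarrow> y \<in> mcarrier M \<Longrightarrow> z \<in> mcarrier M \<Longrightarrow>
     madd M x (madd M y z) = madd M y (madd M x z)"
  using G.m_lcomm by simp

lemma madd_0_left: "x \<in> mcarrier M \<Longrightarrow> madd M 0 x = x"
  using G.l_one by simp

lemma madd_0_right: "x \<in> mcarrier M \<Longrightarrow> madd M x 0 = x"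
  using G.r_one by simp

lemma madd_left_cancel:
  "x \<in> mcarrier M \<Longrightarrow> y \<in> mcarrier M \<Longrightarrow> z \<in> mcarrier M \<Longrightarrow>
     madd M x y = madd M x z \<longleftrightarrow> y = z"
  using G.Units_l_cancel[of x y z] by simp

lemma mact_closed: "x \<in> mcarrier M \<Longrightarrow> mact M x a \<in> mcarrier M"
  using M by (simp add: right_module_def)

lemma mact_madd:
  "x \<in> mcarrier M \<Longrightarrow> y \<in> mcarrier M \<Longrightarrow>
     mact M (madd M x y) a = madd M (mact M x a) (mact M y a)"
  using M by (simp add: right_module_def)

lemma mact_plus: "x \<in> mcarrier M \<Longrightarrow> mact M x (a + b) = madd M (mact M x a) (mact M x b)"
  using M by (simp add: right_module_def)

lemma mact_times: "x \<in> mcarrier M \<Longrightarrow> mact M x (a * b) = mact M (mact M x a) b"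
  using M by (simp add: right_module_def)

lemma mact_1: "x \<in> mcarrier M \<Longrightarrow> mact M x 1 = x"
  using M by (simp add: right_module_def)

lemma madd_outside: "x \<notin> mcarrier M \<or> y \<notin> mcarrier M \<Longrightarrow> madd M x y = 0"
  using M by (simp add: right_module_def)

lemma mact_outside: "x \<notin> mcarrier M \<Longrightarrow> mact M x a = 0"
  using M by (simp add: right_module_def)

lemma mact_0_right: "x \<in> mcarrier M \<Longrightarrow> mact M x 0 = 0"
  using mact_plus[of x 0 0] madd_left_cancel[of "mact M x 0" "mact M x 0" 0]
    madd_0_right[of "mact M x 0"] mact_closed[of x 0] zero_in_carrier by simp

lemma mact_0_left: "mact M 0 a = 0"
  using mact_madd[of 0 0 a] madd_left_cancel[of "mact M 0 a" "mact M 0 a" 0]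
    madd_0_right mact_closed[of 0 a] zero_in_carrier by simp

text \<open>Negatives are written as the action of \<open>- 1\<close>. The records have no inverse
  operation, and in this form every homomorphism respects negatives by
  \<open>hom_mact\<close>.\<close>

lemma madd_neg: "x \<in> mcarrier M \<Longrightarrow> madd M x (mact M x (- 1)) = 0"
  using mact_plus[of x 1 "- 1"] mact_1[of x] mact_0_right[of x] by simp

lemma madd_neg_left: "x \<in> mcarrier M \<Longrightarrow> madd M (mact M x (- 1)) x = 0"
  using madd_neg[of x] madd_comm[of x "mact M x (- 1)"] mact_closed[of x] by simp

lemma mact_neg_neg: "x \<in> mcarrier M \<Longrightarrow> mact M (mact M x (- 1)) (- 1) = x"
  using mact_times[of x "- 1" "- 1"] mact_1[of x] by simp

lemma madd_neg_cancel:
  "x \<in> mcarrier M \<Longrightarrow> y \<in> mcarrier M \<Longrightarrow> madd M x (madd M (mact M x (- 1)) y) = y"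
  "x \<in> mcarrier M \<Longrightarrow> y \<in> mcarrier M \<Longrightarrow> madd M (mact M x (- 1)) (madd M x y) = y"
  by (simp_all add: madd_assoc[symmetric] mact_closed madd_neg madd_neg_left madd_0_left)

lemma madd_eq_0_iff:
  "x \<in> mcarrier M \<Longrightarrow> y \<in> mcarrier M \<Longrightarrow> madd M x y = 0 \<longleftrightarrow> y = mact M x (- 1)"
  using madd_left_cancel[of x y "mact M x (- 1)"] by (simp add: madd_neg mact_closed)

end

lemmas madd_ac = madd_assoc madd_comm madd_left_comm

lemmas rmod_simps = zero_in_carrier madd_closed mact_closed madd_0_left madd_0_right
  mact_madd mact_0_left madd_neg madd_neg_left mact_neg_neg madd_neg_cancel

lemma right_moduleI:
  fixes M :: "('a::ring_1, 'm::zero) rmod"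
  assumes "0 \<in> mcarrier M"
    and "\<And>x y. x \<in> mcarrier M \<Longrightarrow> y \<in> mcarrier M \<Longrightarrow> madd M x y \<in> mcarrier M"
    and "\<And>x a. x \<in> mcarrier M \<Longrightarrow> mact M x a \<in> mcarrier M"
    and "\<And>x y z. x \<in> mcarrier M \<Longrightarrow> y \<in> mcarrier M \<Longrightarrow> z \<in> mcarrier M \<Longrightarrow>
           madd M (madd M x y) z = madd M x (madd M y z)"
    and "\<And>x y. x \<in> mcarrier M \<Longrightarrow> y \<in> mcarrier M \<Longrightarrow> madd M x y = madd M y x"
    and "\<And>x. x \<in> mcarrier M \<Longrightarrow> madd M 0 x = x"
    and "\<And>x. x \<in> mcarrier M \<Longrightarrow> madd M (mact M x (- 1)) x = 0"
    and "\<And>x y a. x \<in> mcarrier M \<Longrightarrow> y \<in> mcarrier M \<Longrightarrow>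
           mact M (madd M x y) a = madd M (mact M x a) (mact M y a)"
    and "\<And>x a b. x \<in> mcarrier M \<Longrightarrow> mact M x (a + b) = madd M (mact M x a) (mact M x b)"
    and "\<And>x a b. x \<in> mcarrier M \<Longrightarrow> mact M x (a * b) = mact M (mact M x a) b"
    and "\<And>x. x \<in> mcarrier M \<Longrightarrow> mact M x 1 = x"
    and "\<And>x y. x \<notin> mcarrier M \<or> y \<notin> mcarrier M \<Longrightarrow> madd M x y = 0"
    and "\<And>x a. x \<notin> mcarrier M \<Longrightarrow> mact M x a = 0"
  shows "right_module M"
proof -
  have "comm_group \<lparr>carrier = mcarrier M, mult = madd M, one = 0\<rparr>"
  proof (rule comm_groupI, goal_cases)
    case (6 x)
    then show ?case
      using assms(3,7) by (intro bexI[of _ "mact M x (- 1)"]) simp_all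
  next
    case (4 x y)
    then show ?case using assms(5)[of x y] by simp
  qed (simp_all add: assms(1,2,4,6))
  then show ?thesis
    unfolding right_module_def by (intro conjI allI ballI impI) (simp_all add: assms(3,8-13))
qed

lemma right_module_zero_mod: "right_module (zero_mod :: ('a::ring_1, 'm::zero) rmod)"
  by (rule right_moduleI) (auto simp: zero_mod_def)

lemma zero_mod_iff:
  fixes M :: "('a::ring_1, 'm::zero) rmod"
  assumes "right_module M"
  shows "M = zero_mod \<longleftrightarrow> mcarrier M = {0}"
proof
  assume "mcarrier M = {0}"
  then have "madd M = (\<lambda>_ _. 0)" "mact M = (\<lambda>_ _. 0)"
    using madd_outside[OF assms] mact_outside[OF assms] madd_0_left[OF assms] mact_0_left[OF assms]
    by (metis singletonD zero_in_carrier[OF assms])+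
  with \<open>mcarrier M = {0}\<close> show "M = zero_mod"
    by (simp add: zero_mod_def)
qed (simp add: zero_mod_def)

lemma mcarrier_zero_mod: "mcarrier zero_mod = {0}"
  by (simp add: zero_mod_def)

section \<open>Homomorphisms of modules\<close>

lemma mod_homI:
  assumes "\<And>x. x \<in> mcarrier M \<Longrightarrow> f x \<in> mcarrier N"
    and "\<And>x y. x \<in> mcarrier M \<Longrightarrow> y \<in> mcarrier M \<Longrightarrow> f (madd M x y) = madd N (f x) (f y)"
    and "\<And>x a. x \<in> mcarrier M \<Longrightarrow> f (mact M x a) = mact N (f x) a"
    and "\<And>x. x \<notin> mcarrier M \<Longrightarrow> f x = 0"
  shows "f \<in> mod_hom M N"
  using assms by (auto simp: mod_hom_def)

lemma hom_madd:
  "f \<in> mod_hom M N \<Longrightarrow> x \<in> mcarrier M \<Longrightarrow> y \<in> mcarrier M \<Longrightarrow> f (madd M x y) = madd N (f x) (f y)"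
  by (auto simp: mod_hom_def)

lemma hom_mact: "f \<in> mod_hom M N \<Longrightarrow> x \<in> mcarrier M \<Longrightarrow> f (mact M x a) = mact N (f x) a"
  by (auto simp: mod_hom_def)

lemma hom_in: "f \<in> mod_hom M N \<Longrightarrow> x \<in> mcarrier M \<Longrightarrow> f x \<in> mcarrier N"
  by (auto simp: mod_hom_def)

lemma hom_outside: "f \<in> mod_hom M N \<Longrightarrow> x \<notin> mcarrier M \<Longrightarrow> f x = 0"
  by (auto simp: mod_hom_def)

lemma hom_0:
  assumes "f \<in> mod_hom M N" "right_module M" "right_module N"
  shows "f 0 = 0"
  using hom_mact[OF assms(1) zero_in_carrier[OF assms(2)], of 0]
    mact_0_left[OF assms(2)] mact_0_right[OF assms(3) hom_in[OF assms(1) zero_in_carrier[OF assms(2)]]]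
  by simp

lemma hom_closed:
  assumes "f \<in> mod_hom M N" "right_module N"
  shows "f x \<in> mcarrier N"
  using hom_in[OF assms(1)] hom_outside[OF assms(1)] zero_in_carrier[OF assms(2)]
  by (cases "x \<in> mcarrier M") auto

lemma hom_ext:
  assumes "f \<in> mod_hom M N" "g \<in> mod_hom M N'" "\<And>x. x \<in> mcarrier M \<Longrightarrow> f x = g x"
  shows "f = g"
  using assms hom_outside by (metis ext)

lemma hom_comp:
  assumes "f \<in> mod_hom M N" "g \<in> mod_hom N L" "right_module N" "right_module L"
  shows "g \<circ> f \<in> mod_hom M L"
  by (rule mod_homI)
    (simp_all add: hom_in[OF assms(1)] hom_in[OF assms(2)] hom_madd[OF assms(1)] hom_madd[OF assms(2)]
      hom_mact[OF assms(1)] hom_mact[OF assms(2)] hom_outside[OF assms(1)] hom_0[OF assms(2-4)])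

lemma id_mod_hom: "right_module M \<Longrightarrow> id_mod M \<in> mod_hom M M"
  by (auto intro!: mod_homI simp: id_mod_def madd_closed mact_closed)

lemma zero_hom:
  assumes "right_module N"
  shows "(\<lambda>_. 0) \<in> mod_hom M N"
  using rmod_simps[OF assms] by (auto intro!: mod_homI)

lemma hom_id_right: "f \<in> mod_hom M N \<Longrightarrow> f \<circ> id_mod M = f"
  if "right_module M" "right_module N"
  using that by (auto simp: fun_eq_iff id_mod_def hom_outside hom_0)

lemma hom_id_left: "f \<in> mod_hom M N \<Longrightarrow> id_mod N \<circ> f = f"
  if "right_module N"
  using that by (auto simp: fun_eq_iff id_mod_def hom_closed)

lemma hom_zero_right: "f \<in> mod_hom M N \<Longrightarrow> right_module M \<Longrightarrow> right_module N \<Longrightarrow> f \<circ> (\<lambda>_. 0) = (\<lambda>_. 0)"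
  by (auto simp: fun_eq_iff hom_0)

lemma hom_add_in:
  assumes "f \<in> mod_hom M N" "g \<in> mod_hom M N" "right_module N"
  shows "(\<lambda>x. madd N (f x) (g x)) \<in> mod_hom M N"
  by (rule mod_homI)
    (simp_all add: hom_in[OF assms(1)] hom_in[OF assms(2)] hom_madd[OF assms(1)] hom_madd[OF assms(2)]
      hom_mact[OF assms(1)] hom_mact[OF assms(2)] hom_outside[OF assms(1)] hom_outside[OF assms(2)]
      rmod_simps[OF assms(3)] madd_ac[OF assms(3)])

lemma hom_neg_in:
  assumes "f \<in> mod_hom M N" "right_module N"
  shows "(\<lambda>x. mact N (f x) (- 1)) \<in> mod_hom M N"
proof (rule mod_homI)
  fix x a assume "x \<in> mcarrier M"
  then show "mact N (f (mact M x a)) (- 1) = mact N (mact N (f x) (- 1)) a"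
    using assms mact_times[OF assms(2) hom_in[OF assms(1)], of x a "- 1"]
      mact_times[OF assms(2) hom_in[OF assms(1)], of x "- 1" a]
    by (simp add: hom_mact[OF assms(1)])
qed (simp_all add: hom_in[OF assms(1)] hom_madd[OF assms(1)] hom_outside[OF assms(1)]
      rmod_simps[OF assms(2)])

lemma hom_into_zero: "f \<in> mod_hom M zero_mod \<Longrightarrow> f = (\<lambda>_. 0)"
  using hom_in[of f M zero_mod] hom_outside[of f M zero_mod]
  by (fastforce simp: mcarrier_zero_mod fun_eq_iff)

lemma hom_from_zero:
  "f \<in> mod_hom zero_mod N \<Longrightarrow> right_module N \<Longrightarrow> f = (\<lambda>_. 0)"
  using hom_0[OF _ right_module_zero_mod, of f N] hom_outside[of f zero_mod N]
  by (metis ext mcarrier_zero_mod singletonD)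

lemma id_mod_zero_iff:
  assumes "right_module M"
  shows "id_mod M = (\<lambda>_. 0) \<longleftrightarrow> M = zero_mod"
  using zero_in_carrier[OF assms] unfolding zero_mod_iff[OF assms]
  by (auto simp: id_mod_def fun_eq_iff split: if_splits)

section \<open>Finitely generated projective modules\<close>

lemma fg_proj_right_module: "fg_proj M \<Longrightarrow> right_module M"
  by (simp add: fg_proj_def)

lemma fg_projI:
  assumes "right_module M" "finite S" "S \<subseteq> mcarrier M"
    and "\<And>N. submod N M \<Longrightarrow> S \<subseteq> N \<Longrightarrow> mcarrier M \<subseteq> N"
    and "projective M"
  shows "fg_proj M"
proof -
  have "N = mcarrier M" if "submod N M" "S \<subseteq> N" for N
    using assms(4)[OF that] that(1) by (simp add: submod_def)
  with assms(1-3,5) show ?thesis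
    unfolding fg_proj_def fin_generated_def by (intro conjI exI[of _ S]) auto
qed

lemma fin_generatedE:
  assumes "fg_proj M"
  obtains S where "finite S" "S \<subseteq> mcarrier M" "\<And>N. submod N M \<Longrightarrow> S \<subseteq> N \<Longrightarrow> N = mcarrier M"
proof -
  from assms obtain S where "finite S \<and> S \<subseteq> mcarrier M \<and> (\<forall>N. submod N M \<and> S \<subseteq> N \<longrightarrow> N = mcarrier M)"
    unfolding fg_proj_def fin_generated_def by (elim conjE exE) auto
  then show ?thesis
    by (intro that[of S]) simp_all
qed

lemma fg_proj_zero_mod: "fg_proj (zero_mod :: ('a::ring_1, 'm::zero) rmod)"
proof (rule fg_projI[of _ "{}"])
  show "projective (zero_mod :: ('a, 'm) rmod)"
    unfolding projective_def
  proof (intro allI impI ballI)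
    fix N L :: "('a, 'm) rmod" and g h
    assume a: "right_module N \<and> right_module L" "g \<in> mod_hom N L" "h \<in> mod_hom zero_mod L"
    then have "g \<circ> (\<lambda>_. 0) = h"
      using hom_from_zero[of h L] hom_zero_right[of g N L] by simp
    then show "\<exists>l\<in>mod_hom zero_mod N. g \<circ> l = h"
      using a(1) zero_hom by blast
  qed
qed (auto simp: right_module_zero_mod submod_def mcarrier_zero_mod)

subsection \<open>Images of idempotents\<close>

text \<open>The image is realised inside \<open>M\<close>, with the operations cut off to
  \<open>0\<close> outside it as the convention on modules demands. Hence a summand never leaves the
  type \<open>'m\<close>, and the function \<open>e\<close> itself serves as the projection onto
  it.\<close>

definition im_mod :: "('m \<Rightarrow> 'm) \<Rightarrow> ('a::ring_1, 'm::zero) rmod \<Rightarrow> ('a, 'm) rmod" where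
  "im_mod e M = \<lparr>mcarrier = e ` mcarrier M,
     madd = (\<lambda>x y. if x \<in> e ` mcarrier M \<and> y \<in> e ` mcarrier M then madd M x y else 0),
     mact = (\<lambda>x a. if x \<in> e ` mcarrier M then mact M x a else 0)\<rparr>"

definition im_incl :: "('m \<Rightarrow> 'm) \<Rightarrow> ('a::ring_1, 'm::zero) rmod \<Rightarrow> 'm \<Rightarrow> 'm" where
  "im_incl e M = (\<lambda>x. if x \<in> e ` mcarrier M then x else 0)"

context
  fixes M :: "('a::ring_1, 'm::zero) rmod" and e
  assumes M: "right_module M" and e: "e \<in> mod_hom M M" and idem: "e \<circ> e = e"
begin

lemma im_mod_carrier: "x \<in> mcarrier (im_mod e M) \<longleftrightarrow> x \<in> mcarrier M \<and> e x = x"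
proof -
  have "e (e x) = e x" for x
    using idem by (metis comp_apply)
  then show ?thesis
    using hom_in[OF e] by (force simp: im_mod_def)
qed

lemma im_mod_carrier': "x \<in> e ` mcarrier M \<longleftrightarrow> x \<in> mcarrier M \<and> e x = x"
  using im_mod_carrier by (simp add: im_mod_def)

lemma im_mod_madd:
  "x \<in> mcarrier (im_mod e M) \<Longrightarrow> y \<in> mcarrier (im_mod e M) \<Longrightarrow> madd (im_mod e M) x y = madd M x y"
  by (simp add: im_mod_def)

lemma im_mod_mact: "x \<in> mcarrier (im_mod e M) \<Longrightarrow> mact (im_mod e M) x a = mact M x a"
  by (simp add: im_mod_def)

lemma right_module_im_mod: "right_module (im_mod e M)"
proof (rule right_moduleI, goal_cases)
  case (12 x y) then show ?case by (auto simp: im_mod_def)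
next
  case (13 x a) then show ?case by (auto simp: im_mod_def)
qed (simp_all add: im_mod_madd im_mod_mact im_mod_carrier hom_madd[OF e] hom_mact[OF e]
        hom_0[OF e M M] rmod_simps[OF M] madd_ac[OF M] mact_plus[OF M] mact_times[OF M]
        mact_1[OF M])

lemma im_incl_hom: "im_incl e M \<in> mod_hom (im_mod e M) M"
  by (rule mod_homI)
    (auto simp: im_incl_def im_mod_carrier' im_mod_madd im_mod_mact im_mod_carrier
      hom_madd[OF e] hom_mact[OF e] rmod_simps[OF M])

lemma im_proj_hom: "e \<in> mod_hom M (im_mod e M)"
  by (rule mod_homI)
    (use idem[unfolded fun_eq_iff comp_def] in
      \<open>simp_all add: im_mod_madd im_mod_mact im_mod_carrier hom_in[OF e]
         hom_madd[OF e] hom_mact[OF e] hom_outside[OF e]\<close>)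

lemma im_proj_incl: "e \<circ> im_incl e M = id_mod (im_mod e M)"
  using hom_0[OF e M M] by (auto simp: fun_eq_iff im_incl_def id_mod_def im_mod_carrier im_mod_carrier')

lemma im_incl_proj: "im_incl e M \<circ> e = e"
  using hom_outside[OF e] by (auto simp: fun_eq_iff im_incl_def)

text \<open>A retract of a projective: extend a map along \<open>e\<close>, lift it, and restrict
  the lift. For generation, the preimage under \<open>e\<close> of a submodule containing the images
  of the generators is all of \<open>M\<close>.\<close>

lemma fg_proj_im_mod:
  assumes "fg_proj M"
  shows "fg_proj (im_mod e M)"
proof -
  from assms obtain S where S: "finite S" "S \<subseteq> mcarrier M"
    and gen: "\<And>N. submod N M \<Longrightarrow> S \<subseteq> N \<Longrightarrow> N = mcarrier M"
    by (rule fin_generatedE) simp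
  show ?thesis
  proof (rule fg_projI[of _ "e ` S"])
    fix N assume N: "submod N (im_mod e M)" "e ` S \<subseteq> N"
    have sub: "N \<subseteq> mcarrier (im_mod e M)"
      using N(1) by (simp add: submod_def)
    have cl: "madd M x y \<in> N" "mact M x a \<in> N" if "x \<in> N" "y \<in> N" for x y a
      using N(1) that sub im_mod_madd[of x y] im_mod_mact[of x a] unfolding submod_def by (metis subsetD)+
    have "0 \<in> N"
      using N(1) by (simp add: submod_def)
    with cl have *: "submod {x \<in> mcarrier M. e x \<in> N} M"
      unfolding submod_def
      by (auto simp: rmod_simps[OF M] hom_0[OF e M M] hom_madd[OF e] hom_mact[OF e])
    have "{x \<in> mcarrier M. e x \<in> N} = mcarrier M"
      using gen[OF *] N(2) S(2) by blast
    then show "mcarrier (im_mod e M) \<subseteq> N"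
      by (auto simp: im_mod_def)
  next
    show "projective (im_mod e M)"
      unfolding projective_def
    proof (intro allI impI ballI)
      fix N L :: "('a, 'm) rmod" and g h
      assume NL: "right_module N \<and> right_module L" and g: "g \<in> mod_hom N L"
        and surj: "g ` mcarrier N = mcarrier L" and h: "h \<in> mod_hom (im_mod e M) L"
      have "h \<circ> e \<in> mod_hom M L"
        using hom_comp[OF im_proj_hom h right_module_im_mod] NL by simp
      then obtain l where l: "l \<in> mod_hom M N" "g \<circ> l = h \<circ> e"
        using assms NL g surj unfolding fg_proj_def projective_def by meson
      have "g \<circ> (l \<circ> im_incl e M) = h \<circ> (e \<circ> im_incl e M)"
        using l(2) by (simp add: comp_assoc[symmetric])
      also have "\<dots> = h"
        unfolding im_proj_incl using hom_id_right[OF right_module_im_mod _ h] NL by simp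
      finally show "\<exists>l\<in>mod_hom (im_mod e M) N. g \<circ> l = h"
        using hom_comp[OF im_incl_hom l(1) M] NL by blast
    qed
  next
    show "e ` S \<subseteq> mcarrier (im_mod e M)"
      using S by (auto simp: im_mod_def)
  qed (use S right_module_im_mod in auto)
qed

end

subsection \<open>Direct sums\<close>

text \<open>An infinite type has as many elements as its square. The normalisation at
  \<open>0\<close> makes \<open>0\<close> the zero element of every direct sum and turns a sum of
  zero modules into \<open>zero_mod\<close>.\<close>

lemma pairing_exists:
  assumes "infinite (UNIV :: 'm::zero set)"
  obtains pr :: "'m::zero \<Rightarrow> 'm \<Rightarrow> 'm" and p1 p2
  where "\<And>x y. p1 (pr x y) = x" "\<And>x y. p2 (pr x y) = y" "pr 0 0 = 0"
proof -
  obtain b :: "'m \<times> 'm \<Rightarrow> 'm" where "bij_betw b (UNIV \<times> UNIV) UNIV"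
    using card_of_Times_same_infinite[OF assms] card_of_ordIso by blast
  then have b: "bij b" by simp
  \<comment> \<open>\<open>b'\<close> exchanges the values \<open>0\<close> and
    \<open>b (0, 0)\<close> of \<open>b\<close>.\<close>
  define b' where "b' z = (if z = (0, 0) then 0 else if b z = 0 then b (0, 0) else b z)" for z
  have b': "inj b'"
  proof (rule injI)
    fix z w assume "b' z = b' w"
    then show "z = w"
      using inj_eq[OF bij_is_inj[OF b], of z w] inj_eq[OF bij_is_inj[OF b], of z "(0, 0)"]
        inj_eq[OF bij_is_inj[OF b], of w "(0, 0)"]
      unfolding b'_def by presburger
  qed
  show ?thesis
  proof (rule that[of "\<lambda>x. fst (inv_into UNIV b' x)" "\<lambda>x y. b' (x, y)" "\<lambda>x. snd (inv_into UNIV b' x)"])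
    show "fst (inv_into UNIV b' (b' (x, y))) = x" "snd (inv_into UNIV b' (b' (x, y))) = y" for x y
      using inv_f_f[OF b'] by simp_all
  qed (simp add: b'_def)
qed

locale pairing =
  fixes pr :: "'m::zero \<Rightarrow> 'm \<Rightarrow> 'm" and p1 p2 :: "'m \<Rightarrow> 'm"
  assumes p1_pr [simp]: "p1 (pr x y) = x" and p2_pr [simp]: "p2 (pr x y) = y"
    and pr_0 [simp]: "pr 0 0 = 0"
begin

lemma p_0 [simp]: "p1 0 = 0" "p2 0 = 0"
  using p1_pr[of 0 0] p2_pr[of 0 0] by simp_all

lemma pr_eq_iff [simp]: "pr x y = pr x' y' \<longleftrightarrow> x = x' \<and> y = y'"
  by (metis p1_pr p2_pr)

definition dsum :: "('a::ring_1, 'm) rmod \<Rightarrow> ('a, 'm) rmod \<Rightarrow> ('a, 'm) rmod" where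
  "dsum A B = (let C = {pr a b |a b. a \<in> mcarrier A \<and> b \<in> mcarrier B} in
     \<lparr>mcarrier = C,
      madd = (\<lambda>x y. if x \<in> C \<and> y \<in> C then pr (madd A (p1 x) (p1 y)) (madd B (p2 x) (p2 y)) else 0),
      mact = (\<lambda>x a. if x \<in> C then pr (mact A (p1 x) a) (mact B (p2 x) a) else 0)\<rparr>)"

lemma dsum_carrier: "mcarrier (dsum A B) = {pr a b |a b. a \<in> mcarrier A \<and> b \<in> mcarrier B}"
  by (simp add: dsum_def Let_def)

lemma pr_in_dsum [simp]: "pr a b \<in> mcarrier (dsum A B) \<longleftrightarrow> a \<in> mcarrier A \<and> b \<in> mcarrier B"
  by (auto simp: dsum_carrier)

lemma dsum_cases:
  assumes "x \<in> mcarrier (dsum A B)"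
  obtains a b where "x = pr a b" "a \<in> mcarrier A" "b \<in> mcarrier B"
  using assms by (auto simp: dsum_carrier)

lemma madd_dsum [simp]:
  assumes "a \<in> mcarrier A" "b \<in> mcarrier B" "a' \<in> mcarrier A" "b' \<in> mcarrier B"
  shows "madd (dsum A B) (pr a b) (pr a' b') = pr (madd A a a') (madd B b b')"
  using assms by (auto simp: dsum_def Let_def)

lemma mact_dsum [simp]:
  assumes "a \<in> mcarrier A" "b \<in> mcarrier B"
  shows "mact (dsum A B) (pr a b) c = pr (mact A a c) (mact B b c)"
  using assms by (auto simp: dsum_def Let_def)

lemma right_module_dsum:
  assumes A: "right_module A" and B: "right_module B"
  shows "right_module (dsum A B)"
proof (rule right_moduleI, goal_cases)
  case 1
  then show ?case using pr_in_dsum[of 0 0 A B] zero_in_carrier[OF A] zero_in_carrier[OF B] by simp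
next
  case (6 x)
  then show ?case
    using madd_dsum[of 0 A 0 B] by (auto elim!: dsum_cases simp: rmod_simps[OF A] rmod_simps[OF B])
next
  case (12 x y)
  then show ?case by (auto simp: dsum_def Let_def)
next
  case (13 x a)
  then show ?case by (auto simp: dsum_def Let_def)
qed (auto elim!: dsum_cases simp: rmod_simps[OF A] rmod_simps[OF B] madd_ac[OF A] madd_ac[OF B]
       mact_plus[OF A] mact_plus[OF B] mact_times[OF A] mact_times[OF B]
       mact_1[OF A] mact_1[OF B])

definition dlift :: "('a::ring_1, 'm) rmod \<Rightarrow> ('a, 'm) rmod \<Rightarrow> ('m \<Rightarrow> 'm \<Rightarrow> 'm) \<Rightarrow> 'm \<Rightarrow> 'm" where
  "dlift A B f = (\<lambda>x. if x \<in> mcarrier (dsum A B) then f (p1 x) (p2 x) else 0)"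

lemma dlift_pr [simp]:
  "a \<in> mcarrier A \<Longrightarrow> b \<in> mcarrier B \<Longrightarrow> dlift A B f (pr a b) = f a b"
  by (simp add: dlift_def)

lemma dlift_hom:
  assumes "\<And>a b. a \<in> mcarrier A \<Longrightarrow> b \<in> mcarrier B \<Longrightarrow> f a b \<in> mcarrier N"
    and "\<And>a b a' b'. a \<in> mcarrier A \<Longrightarrow> b \<in> mcarrier B \<Longrightarrow> a' \<in> mcarrier A \<Longrightarrow> b' \<in> mcarrier B \<Longrightarrow>
      f (madd A a a') (madd B b b') = madd N (f a b) (f a' b')"
    and "\<And>a b c. a \<in> mcarrier A \<Longrightarrow> b \<in> mcarrier B \<Longrightarrow> f (mact A a c) (mact B b c) = mact N (f a b) c"
    and A: "right_module A" and B: "right_module B"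
  shows "dlift A B f \<in> mod_hom (dsum A B) N"
  by (rule mod_homI)
    (auto elim!: dsum_cases simp: assms(1-3) rmod_simps[OF A] rmod_simps[OF B], simp add: dlift_def)

lemma inj1_hom:
  assumes "right_module A" "right_module B"
  shows "(\<lambda>a. pr a 0) \<circ> id_mod A \<in> mod_hom A (dsum A B)"
  by (rule mod_homI) (auto simp: id_mod_def rmod_simps[OF assms(1)] rmod_simps[OF assms(2)])

lemma inj2_hom:
  assumes "right_module A" "right_module B"
  shows "(\<lambda>b. pr 0 b) \<circ> id_mod B \<in> mod_hom B (dsum A B)"
  by (rule mod_homI) (auto simp: id_mod_def rmod_simps[OF assms(1)] rmod_simps[OF assms(2)])

lemma fg_proj_dsum:
  fixes A B :: "('a::ring_1, 'm) rmod"
  assumes A: "fg_proj A" and B: "fg_proj B"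
  shows "fg_proj (dsum A B)"
proof -
  note rA = fg_proj_right_module[OF A] and rB = fg_proj_right_module[OF B]
  note r = rmod_simps[OF rA] rmod_simps[OF rB]
  from A obtain S where S: "finite S" "S \<subseteq> mcarrier A"
    and genA: "\<And>N. submod N A \<Longrightarrow> S \<subseteq> N \<Longrightarrow> N = mcarrier A"
    by (rule fin_generatedE) simp
  from B obtain T where T: "finite T" "T \<subseteq> mcarrier B"
    and genB: "\<And>N. submod N B \<Longrightarrow> T \<subseteq> N \<Longrightarrow> N = mcarrier B"
    by (rule fin_generatedE) simp
  show ?thesis
  proof (rule fg_projI[of _ "(\<lambda>a. pr a 0) ` S \<union> pr 0 ` T"])
    fix N assume N: "submod N (dsum A B)" "(\<lambda>a. pr a 0) ` S \<union> pr 0 ` T \<subseteq> N"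
    have cl: "\<And>x y. x \<in> N \<Longrightarrow> y \<in> N \<Longrightarrow> madd (dsum A B) x y \<in> N"
      "\<And>x c. x \<in> N \<Longrightarrow> mact (dsum A B) x c \<in> N" "0 \<in> N"
      using N(1) by (auto simp: submod_def)
    have "submod {a \<in> mcarrier A. pr a 0 \<in> N} A"
    proof -
      have "pr (madd A x y) 0 \<in> N" "pr (mact A x c) 0 \<in> N"
        if "x \<in> mcarrier A" "y \<in> mcarrier A" "pr x 0 \<in> N" "pr y 0 \<in> N" for x y c
        using cl(1)[OF that(3,4)] cl(2)[OF that(3), of c] that(1,2) by (simp_all add: r)
      then show ?thesis
        unfolding submod_def using cl(3) by (auto simp: r)
    qed
    from genA[OF this] have 1: "pr a 0 \<in> N" if "a \<in> mcarrier A" for a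
      using N(2) S(2) that by blast
    have "submod {b \<in> mcarrier B. pr 0 b \<in> N} B"
    proof -
      have "pr 0 (madd B x y) \<in> N" "pr 0 (mact B x c) \<in> N"
        if "x \<in> mcarrier B" "y \<in> mcarrier B" "pr 0 x \<in> N" "pr 0 y \<in> N" for x y c
        using cl(1)[OF that(3,4)] cl(2)[OF that(3), of c] that(1,2) by (simp_all add: r)
      then show ?thesis
        unfolding submod_def using cl(3) by (auto simp: r)
    qed
    from genB[OF this] have 2: "pr 0 b \<in> N" if "b \<in> mcarrier B" for b
      using N(2) T(2) that by blast
    show "mcarrier (dsum A B) \<subseteq> N"
    proof
      fix x assume "x \<in> mcarrier (dsum A B)"
      then obtain a b where x: "x = pr a b" "a \<in> mcarrier A" "b \<in> mcarrier B"
        by (rule dsum_cases)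
      then show "x \<in> N"
        using cl(1)[OF 1[OF x(2)] 2[OF x(3)]] by (simp add: r)
    qed
  next
    show "projective (dsum A B)"
      unfolding projective_def
    proof (intro allI impI ballI)
      fix N L :: "('a, 'm) rmod" and g h
      assume NL: "right_module N \<and> right_module L" and g: "g \<in> mod_hom N L"
        and surj: "g ` mcarrier N = mcarrier L" and h: "h \<in> mod_hom (dsum A B) L"
      then have rN: "right_module N" and rL: "right_module L" by auto
      have "h \<circ> ((\<lambda>a. pr a 0) \<circ> id_mod A) \<in> mod_hom A L"
        by (rule hom_comp[OF inj1_hom[OF rA rB] h right_module_dsum[OF rA rB] rL])
      then obtain l1 where l1: "l1 \<in> mod_hom A N" "g \<circ> l1 = h \<circ> ((\<lambda>a. pr a 0) \<circ> id_mod A)"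
        using A NL g surj unfolding fg_proj_def projective_def by meson
      have "h \<circ> (pr 0 \<circ> id_mod B) \<in> mod_hom B L"
        by (rule hom_comp[OF inj2_hom[OF rA rB] h right_module_dsum[OF rA rB] rL])
      then obtain l2 where l2: "l2 \<in> mod_hom B N" "g \<circ> l2 = h \<circ> (pr 0 \<circ> id_mod B)"
        using B NL g surj unfolding fg_proj_def projective_def by meson
      have e1: "g (l1 a) = h (pr a 0)" if "a \<in> mcarrier A" for a
        using fun_cong[OF l1(2), of a] that by (simp add: id_mod_def)
      have e2: "g (l2 b) = h (pr 0 b)" if "b \<in> mcarrier B" for b
        using fun_cong[OF l2(2), of b] that by (simp add: id_mod_def)
      define l where "l = dlift A B (\<lambda>a b. madd N (l1 a) (l2 b))"
      have l: "l \<in> mod_hom (dsum A B) N"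
        unfolding l_def
        by (rule dlift_hom)
          (simp_all add: rA rB hom_in[OF l1(1)] hom_in[OF l2(1)] hom_madd[OF l1(1)] hom_madd[OF l2(1)]
            hom_mact[OF l1(1)] hom_mact[OF l2(1)] rmod_simps[OF rN] madd_ac[OF rN])
      have "g \<circ> l = h"
      proof (rule hom_ext[OF hom_comp[OF l g rN rL] h])
        fix x assume "x \<in> mcarrier (dsum A B)"
        then obtain a b where x: "x = pr a b" "a \<in> mcarrier A" "b \<in> mcarrier B"
          by (rule dsum_cases)
        then show "(g \<circ> l) x = h x"
          using hom_madd[OF h, of "pr a 0" "pr 0 b"]
          by (simp add: l_def hom_madd[OF g] hom_in[OF l1(1)] hom_in[OF l2(1)] e1 e2 r)
      qed
      with l show "\<exists>l\<in>mod_hom (dsum A B) N. g \<circ> l = h" by blast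
    qed
  qed (use S T in \<open>auto simp: right_module_dsum rA rB r\<close>)
qed

end

subsection \<open>Finite length\<close>

lemma submod_D:
  assumes "submod N M"
  shows "N \<subseteq> mcarrier M" "0 \<in> N" "x \<in> N \<Longrightarrow> y \<in> N \<Longrightarrow> madd M x y \<in> N" "x \<in> N \<Longrightarrow> mact M x a \<in> N"
  using assms by (auto simp: submod_def)

lemma fin_dim_algebra_basis:
  assumes "fin_dim_algebra scale"
  obtains B where "finite_dimensional_vector_space scale B"
proof -
  from assms interpret vector_space scale
    by (simp add: fin_dim_algebra_def)
  from assms obtain S where S: "finite S" "span S = UNIV"
    by (auto simp: fin_dim_algebra_def)
  obtain B where B: "B \<subseteq> S" "independent B" "S \<subseteq> span B"
    using maximal_independent_subset[of S] by blast
  have "span B = UNIV"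
    using span_mono[OF B(3)] S(2) by (simp add: span_span top.extremum_unique)
  with B S(1) have "finite_dimensional_vector_space scale B"
    by unfold_locales (auto intro: finite_subset)
  then show ?thesis by (rule that)
qed

text \<open>The part of a submodule \<open>N\<close> outside \<open>K\<close> is measured by the
  right ideal \<open>I N\<close> of all \<open>a\<close> with \<open>s a\<close> in
  \<open>N + K\<close>. This replaces the quotient by \<open>K\<close>, and its dimension over the
  field is a length. Together with the length of \<open>N \<inter> K\<close> it detects proper
  inclusions, by the argument of the modular law.\<close>

lemma finite_length_adjoin:
  fixes scale :: "'k::field \<Rightarrow> 'a::ring_1 \<Rightarrow> 'a" and M :: "('a, 'm::zero) rmod"
  assumes alg: "fin_dim_algebra scale" and M: "right_module M"
    and K: "submod K M" and s: "s \<in> mcarrier M"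
    and mu: "\<And>N N'. submod N M \<Longrightarrow> submod N' M \<Longrightarrow> N \<subset> N' \<Longrightarrow> N' \<subseteq> K \<Longrightarrow> (mu N :: nat) < mu N'"
  shows "\<exists>K' mu'. submod K' M \<and> K \<subseteq> K' \<and> s \<in> K' \<and>
    (\<forall>N N'. submod N M \<longrightarrow> submod N' M \<longrightarrow> N \<subset> N' \<longrightarrow> N' \<subseteq> K' \<longrightarrow> (mu' N :: nat) < mu' N')"
proof -
  note r = rmod_simps[OF M]
  note KD = submod_D[OF K]
  have KM: "y \<in> mcarrier M" if "y \<in> K" for y using KD(1) that by blast
  obtain B where "finite_dimensional_vector_space scale B"
    using fin_dim_algebra_basis[OF alg] .
  then interpret finite_dimensional_vector_space scale B .
  define K' where "K' = {madd M y (mact M s a) |y a. y \<in> K}"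
  define I where "I N = {a. \<exists>y\<in>K. madd M y (mact M s a) \<in> N}" for N
  define mu' where "mu' N = mu (N \<inter> K) + dim (I N)" for N
  have K'D: "K' \<subseteq> mcarrier M"
    using KM s by (auto simp: K'_def r)
  have add: "madd M (madd M y (mact M s a)) (madd M y' (mact M s a')) = madd M (madd M y y') (mact M s (a + a'))"
    if "y \<in> K" "y' \<in> K" for y y' a a'
    using KM[OF that(1)] KM[OF that(2)] s by (simp add: r mact_plus[OF M] madd_ac[OF M])
  have act: "mact M (madd M y (mact M s a)) b = madd M (mact M y b) (mact M s (a * b))"
    if "y \<in> K" for y a b
    using KM[OF that] s by (simp add: r mact_times[OF M])
  have sub': "submod K' M"
    unfolding submod_def
  proof (intro conjI ballI allI)
    show "0 \<in> K'"
      using KD(2) s mact_0_right[OF M s] by (force simp: K'_def r)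
  next
    fix x y assume "x \<in> K'" "y \<in> K'"
    then show "madd M x y \<in> K'"
      using add KD(3) by (force simp: K'_def)
  next
    fix x b assume "x \<in> K'"
    then show "mact M x b \<in> K'"
      using act KD(4) by (force simp: K'_def)
  qed (rule K'D)
  have "K \<subseteq> K'"
  proof
    fix y assume "y \<in> K"
    then have "y = madd M y (mact M s 0)"
      using KM mact_0_right[OF M s] by (simp add: r)
    with \<open>y \<in> K\<close> show "y \<in> K'" unfolding K'_def by blast
  qed
  moreover have "s \<in> K'"
  proof -
    have "s = madd M 0 (mact M s 1)"
      using s by (simp add: r mact_1[OF M])
    with KD(2) show ?thesis unfolding K'_def by blast
  qed
  moreover have subI: "subspace (I N)" if N: "submod N M" for N
  proof (rule subspaceI)
    note ND = submod_D[OF N]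
    show "0 \<in> I N"
      unfolding I_def using KD(2) ND(2) mact_0_right[OF M s] by (auto intro!: bexI[of _ 0] simp: r)
    show "x + y \<in> I N" if "x \<in> I N" "y \<in> I N" for x y
      using that unfolding I_def using add KD(3) ND(3) by (smt (verit) mem_Collect_eq)
    show "scale c x \<in> I N" if "x \<in> I N" for c x
    proof -
      \<comment> \<open>Scalars act through right multiplication by \<open>scale c 1\<close>, so a
        right ideal is a subspace.\<close>
      have "scale c x = x * scale c 1"
        using alg by (simp add: fin_dim_algebra_def) (metis mult.right_neutral)
      with that show ?thesis
        unfolding I_def using act KD(4) ND(4) by (smt (verit) mem_Collect_eq)
    qed
  qed
  have "mu' N < mu' N'" if N: "submod N M" "submod N' M" "N \<subset> N'" "N' \<subseteq> K'" for N N'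
  proof -
    note ND = submod_D[OF N(1)] and ND' = submod_D[OF N(2)]
    have subK: "submod (L \<inter> K) M" if "submod L M" for L
      using submod_D[OF that] KD unfolding submod_def by auto
    have II: "I N \<subseteq> I N'"
      using N(3) by (auto simp: I_def)
    have lt: "mu (N \<inter> K) < mu (N' \<inter> K)" if "N \<inter> K \<noteq> N' \<inter> K"
      by (rule mu[OF subK[OF N(1)] subK[OF N(2)]]) (use that N(3) in blast)+
    then have le1: "mu (N \<inter> K) \<le> mu (N' \<inter> K)"
      by (cases "N \<inter> K = N' \<inter> K") (auto intro: less_imp_le)
    have le2: "dim (I N) \<le> dim (I N')"
      using dim_subset[OF II] .
    have "\<not> (mu (N \<inter> K) = mu (N' \<inter> K) \<and> dim (I N) = dim (I N'))"
    proof
      assume eq: "mu (N \<inter> K) = mu (N' \<inter> K) \<and> dim (I N) = dim (I N')"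
      have NK: "N \<inter> K = N' \<inter> K"
        using lt eq by auto
      have IN: "I N = I N'"
        using subspace_dim_equal[OF subI[OF N(1)] subI[OF N(2)] II] eq by simp
      have "N' \<subseteq> N"
      proof
        fix x assume x: "x \<in> N'"
        with N(4) obtain y a where y: "x = madd M y (mact M s a)" "y \<in> K"
          by (auto simp: K'_def)
        with x have "a \<in> I N'" by (auto simp: I_def)
        with IN obtain y' where y': "y' \<in> K" "madd M y' (mact M s a) \<in> N"
          by (auto simp: I_def)
        define w where "w = madd M y' (mact M s a)"
        define z where "z = madd M x (mact M w (- 1))"
        have c: "x \<in> mcarrier M" "w \<in> mcarrier M" "y \<in> mcarrier M" "y' \<in> mcarrier M"
          using x y' ND'(1) ND(1) KM[OF y(2)] KM[OF y'(1)] by (auto simp: w_def)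
        have "z \<in> N'"
          using x y'(2) N(3) ND'(3,4) unfolding z_def w_def by blast
        \<comment> \<open>\<open>x\<close> and \<open>w\<close> have the same coefficient
          \<open>a\<close> at \<open>s\<close>, so their difference falls into \<open>K\<close>,
          where \<open>N\<close> and \<open>N'\<close> agree.\<close>
        moreover have "z = madd M y (mact M y' (- 1))"
        proof -
          have a: "mact M s a \<in> mcarrier M" using s by (simp add: r)
          have "z = madd M (madd M y (mact M s a)) (madd M (mact M y' (-1)) (mact M (mact M s a) (- 1)))"
            unfolding z_def w_def y(1) using c a by (simp add: r)
          also have "\<dots> = madd M (madd M y (mact M y' (- 1))) (madd M (mact M s a) (mact M (mact M s a) (- 1)))"
            using c a mact_closed[OF M a] mact_closed[OF M c(4)] madd_closed[OF M]
            by (simp add: madd_ac[OF M] del: rmod_simps)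
          also have "\<dots> = madd M y (mact M y' (- 1))"
            using c a by (simp add: r)
          finally show ?thesis .
        qed
        then have "z \<in> K" using KD(3,4) y(2) y'(1) by simp
        ultimately have "z \<in> N" using NK by blast
        then have "madd M w z \<in> N"
          using y'(2) ND(3) by (simp add: w_def)
        moreover have "madd M w z = x"
          unfolding z_def using c by (simp add: madd_comm[OF M, of x] r)
        ultimately show "x \<in> N" by simp
      qed
      with N(3) show False by blast
    qed
    with le1 le2 show ?thesis
      unfolding mu'_def by linarith
  qed
  ultimately show ?thesis
    using sub' by (intro exI[of _ K'] exI[of _ mu']) blast
qed

text \<open>A strictly monotone natural number on submodules serves as composition length. It is
  built by adjoining the finitely many generators one at a time.\<close>

lemma finite_length:
  fixes scale :: "'k::field \<Rightarrow> 'a::ring_1 \<Rightarrow> 'a" and M :: "('a, 'm::zero) rmod"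
  assumes alg: "fin_dim_algebra scale" and M: "fg_proj M"
  obtains mu :: "'m set \<Rightarrow> nat" where
    "\<And>N N'. submod N M \<Longrightarrow> submod N' M \<Longrightarrow> N \<subset> N' \<Longrightarrow> mu N < mu N'"
proof -
  have rM: "right_module M" using M by (rule fg_proj_right_module)
  from M obtain S where S: "finite S" "S \<subseteq> mcarrier M"
    and gen: "\<And>N. submod N M \<Longrightarrow> S \<subseteq> N \<Longrightarrow> N = mcarrier M"
    by (rule fin_generatedE) simp
  have "\<exists>K (mu :: 'm set \<Rightarrow> nat). submod K M \<and> S \<subseteq> K \<and>
      (\<forall>N N'. submod N M \<longrightarrow> submod N' M \<longrightarrow> N \<subset> N' \<longrightarrow> N' \<subseteq> K \<longrightarrow> mu N < mu N')"
    using S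
  proof (induction rule: finite_induct)
    case empty
    show ?case
      by (intro exI[of _ "{0}"]) (auto simp: submod_def rmod_simps[OF rM])
  next
    case (insert s S)
    then obtain K and mu :: "'m set \<Rightarrow> nat" where K: "submod K M" "S \<subseteq> K"
      and mu: "\<And>N N'. submod N M \<Longrightarrow> submod N' M \<Longrightarrow> N \<subset> N' \<Longrightarrow> N' \<subseteq> K \<Longrightarrow> mu N < mu N'"
      by blast
    have s: "s \<in> mcarrier M" using insert.prems by simp
    obtain K' and mu' :: "'m set \<Rightarrow> nat" where K': "submod K' M" "K \<subseteq> K'" "s \<in> K'"
      "\<forall>N N'. submod N M \<longrightarrow> submod N' M \<longrightarrow> N \<subset> N' \<longrightarrow> N' \<subseteq> K' \<longrightarrow> mu' N < mu' N'"
      by (atomize_elim, rule finite_length_adjoin[OF alg rM K(1) s, of mu]) (use mu in simp)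
    with K(2) show ?case by (intro exI[of _ K'] exI[of _ mu']) blast
  qed
  then obtain K and mu :: "'m set \<Rightarrow> nat" where K: "submod K M" "S \<subseteq> K"
    and mu: "\<And>N N'. submod N M \<Longrightarrow> submod N' M \<Longrightarrow> N \<subset> N' \<Longrightarrow> N' \<subseteq> K \<Longrightarrow> mu N < mu N'"
    by blast
  have "K = mcarrier M" using gen K by blast
  with mu show ?thesis
    by (intro that[of mu]) (auto dest: submod_D(1))
qed

lemma submod_image:
  assumes "f \<in> mod_hom M N" "right_module M" "right_module N"
  shows "submod (f ` mcarrier M) N"
  unfolding submod_def
proof (intro conjI ballI allI)
  show "0 \<in> f ` mcarrier M"
    using hom_0[OF assms] zero_in_carrier[OF assms(2)] by (metis imageI)
next
  fix x y assume "x \<in> f ` mcarrier M" "y \<in> f ` mcarrier M"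
  then show "madd N x y \<in> f ` mcarrier M"
    using hom_madd[OF assms(1)] madd_closed[OF assms(2)] by (auto simp: image_iff) metis
next
  fix x a assume "x \<in> f ` mcarrier M"
  then show "mact N x a \<in> f ` mcarrier M"
    using hom_mact[OF assms(1)] mact_closed[OF assms(2)] by (auto simp: image_iff) metis
qed (use hom_in[OF assms(1)] in auto)

lemma submod_kernel:
  assumes "f \<in> mod_hom M N" "right_module M" "right_module N"
  shows "submod {x \<in> mcarrier M. f x = 0} M"
  unfolding submod_def
  by (auto simp: hom_0[OF assms] hom_madd[OF assms(1)] hom_mact[OF assms(1)]
      rmod_simps[OF assms(2)] rmod_simps[OF assms(3)])

section \<open>Complexes\<close>

text \<open>The bounds are arbitrary integers because windows are extended downwards as well as
  upwards before they are shifted back to start in degree 1.\<close>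

definition CI :: "int \<Rightarrow> int \<Rightarrow> ('a::ring_1, 'm::zero) cpx set" where
  "CI lo hi = {X. proj_complex X \<and> (\<forall>i. i \<notin> {lo..hi} \<longrightarrow> ob X i = zero_mod)}"

lemma Cn_eq_CI: "Cn n = CI 1 (int n)"
  by (simp add: Cn_def CI_def)

lemma CI_proj_complex: "X \<in> CI lo hi \<Longrightarrow> proj_complex X"
  by (simp add: CI_def)

lemma CI_zero: "X \<in> CI lo hi \<Longrightarrow> i < lo \<or> hi < i \<Longrightarrow> ob X i = zero_mod"
  by (auto simp: CI_def)

lemma CI_Cb: "X \<in> CI lo hi \<Longrightarrow> X \<in> Cb"
  by (auto simp: CI_def Cb_def)

lemma Cb_CI:
  assumes "X \<in> Cb"
  obtains lo hi where "X \<in> CI lo hi"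
  using assms by (auto simp: CI_def Cb_def)

lemma CI_mono: "X \<in> CI lo hi \<Longrightarrow> lo' \<le> lo \<Longrightarrow> hi \<le> hi' \<Longrightarrow> X \<in> CI lo' hi'"
  by (auto simp: CI_def)

lemma cpx_fg: "proj_complex X \<Longrightarrow> fg_proj (ob X i)"
  by (simp add: proj_complex_def)

lemma cpx_mod: "proj_complex X \<Longrightarrow> right_module (ob X i)"
  by (simp add: cpx_fg fg_proj_right_module)

lemma cpx_diff: "proj_complex X \<Longrightarrow> diff X i \<in> mod_hom (ob X i) (ob X (i + 1))"
  by (simp add: proj_complex_def)

lemma cpx_dd: "proj_complex X \<Longrightarrow> diff X (i + 1) (diff X i x) = 0"
  by (simp add: proj_complex_def fun_eq_iff)

lemma cpx_dd': "proj_complex X \<Longrightarrow> diff X i (diff X (i - 1) x) = 0"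
  using cpx_dd[of X "i - 1" x] by simp

lemma proj_complexI:
  assumes "\<And>i. fg_proj (ob X i)" "\<And>i. diff X i \<in> mod_hom (ob X i) (ob X (i + 1))"
    and "\<And>i x. x \<in> mcarrier (ob X i) \<Longrightarrow> diff X (i + 1) (diff X i x) = 0"
  shows "proj_complex X"
proof -
  have "diff X (i + 1) (diff X i x) = 0" for i x
    using assms(3)[of x i] hom_outside[OF assms(2), of x i]
      hom_0[OF assms(2) fg_proj_right_module[OF assms(1)] fg_proj_right_module[OF assms(1)]] by metis
  with assms show ?thesis by (auto simp: proj_complex_def)
qed

definition gmaps :: "('a::ring_1, 'm::zero) cpx \<Rightarrow> ('a, 'm) cpx \<Rightarrow> 'm cmap set" where
  "gmaps X Y = {f. \<forall>i. f i \<in> mod_hom (ob X i) (ob Y i)}"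

lemma gmaps_hom: "f \<in> gmaps X Y \<Longrightarrow> f i \<in> mod_hom (ob X i) (ob Y i)"
  by (simp add: gmaps_def)

lemma chain_gmaps: "f \<in> chain_maps X Y \<Longrightarrow> f \<in> gmaps X Y"
  by (simp add: gmaps_def chain_maps_def)

lemma chain_hom: "f \<in> chain_maps X Y \<Longrightarrow> f i \<in> mod_hom (ob X i) (ob Y i)"
  by (simp add: chain_maps_def)

lemma chain_comm: "f \<in> chain_maps X Y \<Longrightarrow> diff Y i (f i x) = f (i + 1) (diff X i x)"
  by (simp add: chain_maps_def fun_eq_iff)

lemma chain_comm': "f \<in> chain_maps X Y \<Longrightarrow> diff Y (i - 1) (f (i - 1) x) = f i (diff X (i - 1) x)"
  using chain_comm[of f X Y "i - 1" x] by simp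

lemma chain_mapsI:
  assumes X: "proj_complex X" and Y: "proj_complex Y"
    and f: "\<And>i. f i \<in> mod_hom (ob X i) (ob Y i)"
    and c: "\<And>i x. x \<in> mcarrier (ob X i) \<Longrightarrow> diff Y i (f i x) = f (i + 1) (diff X i x)"
  shows "f \<in> chain_maps X Y"
proof -
  have "diff Y i \<circ> f i = f (i + 1) \<circ> diff X i" for i
    by (rule hom_ext[OF hom_comp[OF f cpx_diff[OF Y]] hom_comp[OF cpx_diff[OF X] f]])
      (simp_all add: cpx_mod X Y c)
  with f show ?thesis by (simp add: chain_maps_def)
qed

lemma gmaps_ext:
  assumes "f \<in> gmaps X Y" "g \<in> gmaps X Y'" "\<And>i x. x \<in> mcarrier (ob X i) \<Longrightarrow> f i x = g i x"
  shows "f = g"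
proof
  fix i show "f i = g i"
    by (rule hom_ext[OF gmaps_hom[OF assms(1)] gmaps_hom[OF assms(2)] assms(3)])
qed

lemma gmaps_in: "f \<in> gmaps X Y \<Longrightarrow> x \<in> mcarrier (ob X i) \<Longrightarrow> f i x \<in> mcarrier (ob Y i)"
  by (rule hom_in[OF gmaps_hom])

section \<open>Arithmetic of degreewise homomorphisms and chain maps\<close>

lemma ccomp_apply [simp]: "(g \<odot> f) i x = g i (f i x)"
  by (simp add: ccomp_def)

lemma ccomp_assoc: "(h \<odot> g) \<odot> f = h \<odot> (g \<odot> f)"
  by (simp add: fun_eq_iff)

lemma czero_apply [simp]: "czero i x = 0"
  by (simp add: czero_def)

lemma cid_apply [simp]: "x \<in> mcarrier (ob X i) \<Longrightarrow> cid X i x = x"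
  by (simp add: cid_def id_mod_def)

definition cneg :: "('a::ring_1, 'm::zero) cpx \<Rightarrow> 'm cmap \<Rightarrow> 'm cmap" where
  "cneg Y f = (\<lambda>i x. mact (ob Y i) (f i x) (- 1))"

definition csub :: "('a::ring_1, 'm::zero) cpx \<Rightarrow> 'm cmap \<Rightarrow> 'm cmap \<Rightarrow> 'm cmap" where
  "csub Y f g = cadd Y f (cneg Y g)"

lemma cadd_apply [simp]: "cadd Y f g i x = madd (ob Y i) (f i x) (g i x)"
  by (simp add: cadd_def)

lemma cneg_apply [simp]: "cneg Y f i x = mact (ob Y i) (f i x) (- 1)"
  by (simp add: cneg_def)

lemma csub_apply [simp]: "csub Y f g i x = madd (ob Y i) (f i x) (mact (ob Y i) (g i x) (- 1))"
  by (simp add: csub_def)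

lemma cid_gmaps: "proj_complex X \<Longrightarrow> cid X \<in> gmaps X X"
  unfolding gmaps_def cid_def by (simp add: id_mod_hom cpx_mod)

lemma chain_id: "proj_complex X \<Longrightarrow> cid X \<in> chain_maps X X"
  by (rule chain_mapsI) (simp_all add: gmaps_hom cid_gmaps hom_in[OF cpx_diff])

context
  fixes X Y :: "('a::ring_1, 'm::zero) cpx"
  assumes X: "proj_complex X" and Y: "proj_complex Y"
begin

lemma gmaps_0: "f \<in> gmaps X Y \<Longrightarrow> f i 0 = 0"
  using hom_0[OF gmaps_hom cpx_mod[OF X] cpx_mod[OF Y]] .

lemma gmaps_closed: "f \<in> gmaps X Y \<Longrightarrow> f i x \<in> mcarrier (ob Y i)"
  using hom_closed[OF gmaps_hom cpx_mod[OF Y]] .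

lemma gmaps_comp:
  assumes "f \<in> gmaps X Y" "proj_complex Z" "g \<in> gmaps Y Z"
  shows "g \<odot> f \<in> gmaps X Z"
  unfolding gmaps_def ccomp_def
  using hom_comp[OF gmaps_hom[OF assms(1)] gmaps_hom[OF assms(3)] cpx_mod[OF Y] cpx_mod[OF assms(2)]] by simp

lemma gmaps_zero: "czero \<in> gmaps X Y"
  unfolding gmaps_def czero_def using zero_hom[OF cpx_mod[OF Y]] by simp

lemma gmaps_add: "f \<in> gmaps X Y \<Longrightarrow> g \<in> gmaps X Y \<Longrightarrow> cadd Y f g \<in> gmaps X Y"
  unfolding gmaps_def cadd_def using hom_add_in cpx_mod[OF Y] by blast

lemma gmaps_neg: "f \<in> gmaps X Y \<Longrightarrow> cneg Y f \<in> gmaps X Y"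
  unfolding gmaps_def cneg_def using hom_neg_in cpx_mod[OF Y] by blast

lemma gmaps_sub: "f \<in> gmaps X Y \<Longrightarrow> g \<in> gmaps X Y \<Longrightarrow> csub Y f g \<in> gmaps X Y"
  by (simp add: csub_def gmaps_add gmaps_neg)

lemma gmaps_id_right: "f \<in> gmaps X Y \<Longrightarrow> f \<odot> cid X = f"
  unfolding ccomp_def cid_def by (rule ext) (rule hom_id_right[OF cpx_mod[OF X] cpx_mod[OF Y] gmaps_hom])

lemma gmaps_id_left: "f \<in> gmaps X Y \<Longrightarrow> cid Y \<odot> f = f"
  unfolding ccomp_def cid_def by (rule ext) (rule hom_id_left[OF cpx_mod[OF Y] gmaps_hom])

lemma gmaps_zero_right: "f \<in> gmaps X Y \<Longrightarrow> f \<odot> czero = czero"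
  by (simp add: fun_eq_iff gmaps_0)

lemma chain_comp:
  assumes "f \<in> chain_maps X Y" "proj_complex Z" "g \<in> chain_maps Y Z"
  shows "g \<odot> f \<in> chain_maps X Z"
  by (rule chain_mapsI[OF X assms(2)])
    (use gmaps_hom[OF gmaps_comp[OF chain_gmaps[OF assms(1)] assms(2) chain_gmaps[OF assms(3)]]] in
      \<open>simp_all add: chain_comm[OF assms(1)] chain_comm[OF assms(3)]\<close>)

lemma chain_zero: "czero \<in> chain_maps X Y"
  by (rule chain_mapsI[OF X Y gmaps_hom[OF gmaps_zero]])
    (simp add: hom_0[OF cpx_diff[OF Y] cpx_mod[OF Y] cpx_mod[OF Y]])

lemma chain_add:
  assumes "f \<in> chain_maps X Y" "g \<in> chain_maps X Y"
  shows "cadd Y f g \<in> chain_maps X Y"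
  by (rule chain_mapsI[OF X Y gmaps_hom[OF gmaps_add[OF assms[THEN chain_gmaps]]]])
    (simp add: hom_madd[OF cpx_diff[OF Y]] gmaps_in[OF chain_gmaps[OF assms(1)]] gmaps_in[OF chain_gmaps[OF assms(2)]]
      chain_comm[OF assms(1)] chain_comm[OF assms(2)])

lemma chain_neg:
  assumes "f \<in> chain_maps X Y"
  shows "cneg Y f \<in> chain_maps X Y"
  by (rule chain_mapsI[OF X Y gmaps_hom[OF gmaps_neg[OF assms[THEN chain_gmaps]]]])
    (simp add: hom_mact[OF cpx_diff[OF Y]] gmaps_in[OF chain_gmaps[OF assms(1)]] chain_comm[OF assms(1)])

lemma chain_sub:
  "f \<in> chain_maps X Y \<Longrightarrow> g \<in> chain_maps X Y \<Longrightarrow> csub Y f g \<in> chain_maps X Y"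
  by (simp add: csub_def chain_add chain_neg)

lemma csub_self: "f \<in> gmaps X Y \<Longrightarrow> csub Y f f = czero"
  by (simp add: fun_eq_iff rmod_simps[OF cpx_mod[OF Y]] gmaps_closed)

lemma csub_zero: "f \<in> gmaps X Y \<Longrightarrow> csub Y f czero = f"
  by (simp add: fun_eq_iff rmod_simps[OF cpx_mod[OF Y]] gmaps_closed)

lemma cadd_zero_left: "f \<in> gmaps X Y \<Longrightarrow> cadd Y czero f = f"
  by (simp add: fun_eq_iff rmod_simps[OF cpx_mod[OF Y]] gmaps_closed)

lemma cadd_zero_right: "f \<in> gmaps X Y \<Longrightarrow> cadd Y f czero = f"
  by (simp add: fun_eq_iff rmod_simps[OF cpx_mod[OF Y]] gmaps_closed)

lemma cadd_assoc: "f \<in> gmaps X Y \<Longrightarrow> g \<in> gmaps X Y \<Longrightarrow> h \<in> gmaps X Y \<Longrightarrow>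
    cadd Y (cadd Y f g) h = cadd Y f (cadd Y g h)"
  by (simp add: fun_eq_iff madd_assoc[OF cpx_mod[OF Y]] gmaps_closed)

lemma cadd_neg: "f \<in> gmaps X Y \<Longrightarrow> cadd Y f (cneg Y f) = czero"
  by (simp add: fun_eq_iff rmod_simps[OF cpx_mod[OF Y]] gmaps_closed)

lemma cadd_csub: "f \<in> gmaps X Y \<Longrightarrow> g \<in> gmaps X Y \<Longrightarrow> cadd Y g (csub Y f g) = f"
  by (simp add: fun_eq_iff rmod_simps[OF cpx_mod[OF Y]] gmaps_closed madd_comm[OF cpx_mod[OF Y], of "f _ _"])

lemma csub_eq_zero: "f \<in> gmaps X Y \<Longrightarrow> g \<in> gmaps X Y \<Longrightarrow> csub Y f g = czero \<Longrightarrow> f = g"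
  using cadd_csub[of f g] cadd_zero_right[of g] by simp

lemma csub_eq_left: "f \<in> gmaps X Y \<Longrightarrow> g \<in> gmaps X Y \<Longrightarrow> csub Y f g = f \<Longrightarrow> g = czero"
  by (simp add: fun_eq_iff) (metis cpx_mod[OF Y] gmaps_closed madd_0_right madd_left_cancel
      mact_closed mact_neg_neg mact_0_left zero_in_carrier)

lemma comp_cadd:
  assumes "f \<in> gmaps X Y" "g \<in> gmaps X Y" "h \<in> gmaps Y Z"
  shows "h \<odot> cadd Y f g = cadd Z (h \<odot> f) (h \<odot> g)"
  by (simp add: fun_eq_iff hom_madd[OF gmaps_hom[OF assms(3)]] gmaps_closed[OF assms(1)] gmaps_closed[OF assms(2)])

lemma comp_cneg:
  assumes "g \<in> gmaps X Y" "h \<in> gmaps Y Z"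
  shows "h \<odot> cneg Y g = cneg Z (h \<odot> g)"
  by (simp add: fun_eq_iff hom_mact[OF gmaps_hom[OF assms(2)]] gmaps_closed[OF assms(1)])

lemma comp_csub:
  assumes "f \<in> gmaps X Y" "g \<in> gmaps X Y" "h \<in> gmaps Y Z"
  shows "h \<odot> csub Y f g = csub Z (h \<odot> f) (h \<odot> g)"
  unfolding csub_def
  using comp_cadd[OF assms(1) gmaps_neg[OF assms(2)] assms(3)] comp_cneg[OF assms(2,3)] by simp

end

lemma cadd_comp: "cadd Y f g \<odot> h = cadd Y (f \<odot> h) (g \<odot> h)"
  by (simp add: fun_eq_iff)

lemma csub_comp: "csub Y f g \<odot> h = csub Y (f \<odot> h) (g \<odot> h)"
  by (simp add: fun_eq_iff)

lemma zero_comp: "czero \<odot> f = czero"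
  by (simp add: fun_eq_iff)

lemma null_strict_iff: "proj_complex X \<Longrightarrow> null_object strict X \<longleftrightarrow> (\<forall>i. ob X i = zero_mod)"
  by (simp add: null_object_def strict_def cid_def czero_def fun_eq_iff[of "\<lambda>i. id_mod (ob X i)"]
      id_mod_zero_iff cpx_mod)

lemma gmaps_from_zero: "f \<in> gmaps X Y \<Longrightarrow> proj_complex Y \<Longrightarrow> ob X i = zero_mod \<Longrightarrow> f i x = 0"
  using hom_from_zero[of "f i" "ob Y i"] gmaps_hom[of f X Y i] cpx_mod[of Y i] by simp

lemma gmaps_into_zero: "f \<in> gmaps X Y \<Longrightarrow> ob Y i = zero_mod \<Longrightarrow> f i x = 0"
  using hom_into_zero[of "f i" "ob X i"] gmaps_hom[of f X Y i] by simp

subsection \<open>Splitting idempotents\<close>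

definition im_cpx :: "'m cmap \<Rightarrow> ('a::ring_1, 'm::zero) cpx \<Rightarrow> ('a, 'm) cpx" where
  "im_cpx e X = \<lparr>ob = (\<lambda>i. im_mod (e i) (ob X i)),
     diff = (\<lambda>i. e (i + 1) \<circ> (diff X i \<circ> im_incl (e i) (ob X i)))\<rparr>"

definition cincl :: "'m cmap \<Rightarrow> ('a::ring_1, 'm::zero) cpx \<Rightarrow> 'm cmap" where
  "cincl e X = (\<lambda>i. im_incl (e i) (ob X i))"

context
  fixes X :: "('a::ring_1, 'm::zero) cpx" and e
  assumes X: "proj_complex X" and e: "e \<in> chain_maps X X" and idem: "e \<odot> e = e"
begin

lemma idem_apply: "e i (e i x) = e i x"
  using idem by (metis ccomp_apply)

lemma idem_deg: "e i \<circ> e i = e i"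
  using idem_apply by (simp add: fun_eq_iff)

lemmas im_facts = cpx_mod[OF X] chain_hom[OF e] idem_deg

lemma im_cpx_proj_complex: "proj_complex (im_cpx e X)"
proof (rule proj_complexI)
  show "fg_proj (ob (im_cpx e X) i)" for i
    by (simp add: im_cpx_def fg_proj_im_mod[OF im_facts cpx_fg[OF X]])
  show "diff (im_cpx e X) i \<in> mod_hom (ob (im_cpx e X) i) (ob (im_cpx e X) (i + 1))" for i
    by (simp add: im_cpx_def)
      (intro hom_comp[OF hom_comp[OF im_incl_hom[OF im_facts] cpx_diff[OF X]] im_proj_hom[OF im_facts]]
        cpx_mod[OF X] right_module_im_mod[OF im_facts])
  show "diff (im_cpx e X) (i + 1) (diff (im_cpx e X) i x) = 0"
    if "x \<in> mcarrier (ob (im_cpx e X) i)" for i x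
    using that im_mod_carrier[OF im_facts] im_mod_carrier'[OF im_facts]
    by (simp add: im_cpx_def im_incl_def hom_in[OF chain_hom[OF e]] hom_in[OF cpx_diff[OF X]] idem_apply
        chain_comm[OF e, symmetric] cpx_dd[OF X] hom_0[OF cpx_diff[OF X] cpx_mod[OF X] cpx_mod[OF X]]
        hom_0[OF chain_hom[OF e] cpx_mod[OF X] cpx_mod[OF X]])
qed

lemma cincl_chain: "cincl e X \<in> chain_maps (im_cpx e X) X"
proof (rule chain_mapsI[OF im_cpx_proj_complex X])
  show "cincl e X i \<in> mod_hom (ob (im_cpx e X) i) (ob X i)" for i
    by (simp add: im_cpx_def cincl_def im_incl_hom[OF im_facts])
  show "diff X i (cincl e X i x) = cincl e X (i + 1) (diff (im_cpx e X) i x)"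
    if "x \<in> mcarrier (ob (im_cpx e X) i)" for i x
    using that im_mod_carrier[OF im_facts] im_mod_carrier'[OF im_facts] chain_comm[OF e, of i x]
    by (simp add: im_cpx_def cincl_def im_incl_def hom_in[OF chain_hom[OF e]] hom_in[OF cpx_diff[OF X]] idem_apply)
qed

lemma cproj_chain: "e \<in> chain_maps X (im_cpx e X)"
proof (rule chain_mapsI[OF X im_cpx_proj_complex])
  show "e i \<in> mod_hom (ob X i) (ob (im_cpx e X) i)" for i
    by (simp add: im_cpx_def im_proj_hom[OF im_facts])
  show "diff (im_cpx e X) i (e i x) = e (i + 1) (diff X i x)" if "x \<in> mcarrier (ob X i)" for i x
    using that by (simp add: im_cpx_def im_incl_def chain_comm[OF e] idem_apply)
qed

lemma cproj_cincl: "e \<odot> cincl e X = cid (im_cpx e X)"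
  by (simp add: ccomp_def cincl_def cid_def im_cpx_def im_proj_incl[OF im_facts])

lemma cincl_cproj: "cincl e X \<odot> e = e"
  by (simp add: ccomp_def cincl_def im_incl_proj[OF im_facts])

lemma im_cpx_zero: "ob X i = zero_mod \<Longrightarrow> ob (im_cpx e X) i = zero_mod"
  using im_mod_carrier[OF im_facts, of _ i] zero_mod_iff[OF right_module_im_mod[OF im_facts], of i]
    zero_in_carrier[OF right_module_im_mod[OF im_facts], of i]
  by (auto simp: im_cpx_def mcarrier_zero_mod)

lemma im_cpx_CI: "X \<in> CI lo hi \<Longrightarrow> im_cpx e X \<in> CI lo hi"
  using im_cpx_proj_complex im_cpx_zero by (auto simp: CI_def)

end

section \<open>Indecomposability in terms of idempotents\<close>

definition triv_idem :: "('a::ring_1, 'm::zero) cpx \<Rightarrow> bool" where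
  "triv_idem X \<longleftrightarrow> (\<forall>e\<in>chain_maps X X. e \<odot> e = e \<longrightarrow> e = czero \<or> e = cid X)"

lemma triv_idemD:
  "triv_idem X \<Longrightarrow> e \<in> chain_maps X X \<Longrightarrow> e \<odot> e = e \<Longrightarrow> e = czero \<or> e = cid X"
  by (simp add: triv_idem_def)

lemma cmap_neq_czero:
  assumes "proj_complex X" "e p = id_mod (ob X p)" "ob X p \<noteq> zero_mod"
  shows "e \<noteq> czero"
proof
  assume "e = czero"
  with assms(2) have "id_mod (ob X p) = (\<lambda>_. 0)" by (simp add: czero_def)
  with assms(3) id_mod_zero_iff[OF cpx_mod[OF assms(1)]] show False by blast
qed

lemma idem_complement:
  assumes "proj_complex X" "e \<in> gmaps X X" "e \<odot> e = e"
  shows "csub X (cid X) e \<odot> csub X (cid X) e = csub X (cid X) e"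
    "e \<odot> csub X (cid X) e = czero" "csub X (cid X) e \<odot> e = czero"
proof -
  note X = assms(1) and id = cid_gmaps[OF assms(1)]
  show 1: "e \<odot> csub X (cid X) e = czero"
    by (simp add: comp_csub[OF X X id assms(2) assms(2)] gmaps_id_right[OF X X assms(2)]
        assms(3) csub_self[OF X X assms(2)])
  show "csub X (cid X) e \<odot> e = czero"
    by (simp add: csub_comp gmaps_id_left[OF X X assms(2)] assms(3) csub_self[OF X X assms(2)])
  have e': "csub X (cid X) e \<in> gmaps X X"
    by (rule gmaps_sub[OF X X id assms(2)])
  show "csub X (cid X) e \<odot> csub X (cid X) e = csub X (cid X) e"
    by (subst csub_comp) (simp add: 1 gmaps_id_left[OF X X e'] csub_zero[OF X X e'])
qed

text \<open>A map is a bare function extended by \<open>0\<close>, so the inclusion of the image and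
  the identity of the image are the same function; only the intended target differs.\<close>

lemma cincl_eq_cid: "cincl e X = cid (im_cpx e X)"
  by (simp add: cincl_def cid_def im_cpx_def im_incl_def id_mod_def im_mod_def)

lemma indecomposable_triv_idem:
  assumes "indecomposable strict (CI lo hi) X"
  shows "triv_idem X"
  unfolding triv_idem_def
proof (intro ballI impI)
  fix e assume e: "e \<in> chain_maps X X" and idem: "e \<odot> e = e"
  have XC: "X \<in> CI lo hi" and dec: "\<And>A B. A \<in> CI lo hi \<Longrightarrow> B \<in> CI lo hi \<Longrightarrow> direct_sum strict X A B \<Longrightarrow>
      null_object strict A \<or> null_object strict B"
    using assms by (auto simp: indecomposable_def)
  have X: "proj_complex X" using XC by (rule CI_proj_complex)
  define e' where "e' = csub X (cid X) e"
  note eg = chain_gmaps[OF e]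
  have e': "e' \<in> chain_maps X X"
    unfolding e'_def by (rule chain_sub[OF X X chain_id[OF X] e])
  have idem': "e' \<odot> e' = e'" and ee': "e \<odot> e' = czero" and e'e: "e' \<odot> e = czero"
    using idem_complement[OF X eg idem] by (simp_all add: e'_def)
  have add: "cadd X e e' = cid X"
    unfolding e'_def by (rule cadd_csub[OF X X cid_gmaps[OF X] eg])
  let ?A = "im_cpx e X" and ?B = "im_cpx e' X"
  have A: "?A \<in> CI lo hi" and B: "?B \<in> CI lo hi"
    using im_cpx_CI[OF X e idem XC] im_cpx_CI[OF X e' idem' XC] .
  \<comment> \<open>The inclusion of the image of \<open>e\<close> is fixed by \<open>e\<close>, so
    \<open>e\<close> may be inserted.\<close>
  have "e' \<odot> cincl e X = (e' \<odot> e) \<odot> cincl e X"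
    using cproj_cincl[OF X e idem] by (simp only: ccomp_assoc cincl_eq_cid)
  then have z1: "e' \<odot> cincl e X = czero"
    by (simp add: e'e zero_comp)
  have "e \<odot> cincl e' X = (e \<odot> e') \<odot> cincl e' X"
    using cproj_cincl[OF X e' idem'] by (simp only: ccomp_assoc cincl_eq_cid)
  then have z2: "e \<odot> cincl e' X = czero"
    by (simp add: ee' zero_comp)
  have "direct_sum strict X ?A ?B"
    unfolding direct_sum_def strict_def
    by (intro bexI[OF _ cincl_chain[OF X e idem]] bexI[OF _ cincl_chain[OF X e' idem']]
        bexI[OF _ cproj_chain[OF X e idem]] bexI[OF _ cproj_chain[OF X e' idem']])
      (simp add: z1 z2 cproj_cincl[OF X e idem] cproj_cincl[OF X e' idem']
        cincl_cproj[OF X e idem] cincl_cproj[OF X e' idem'] add)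
  from dec[OF A B this] show "e = czero \<or> e = cid X"
  proof
    assume "null_object strict ?A"
    then have "cincl e X = czero"
      by (simp add: null_object_def strict_def cincl_eq_cid)
    with cincl_cproj[OF X e idem] show ?thesis by (simp add: zero_comp)
  next
    assume "null_object strict ?B"
    then have "cincl e' X = czero"
      by (simp add: null_object_def strict_def cincl_eq_cid)
    with cincl_cproj[OF X e' idem'] have "e' = czero" by (simp add: zero_comp)
    then have "e = cid X"
      using csub_eq_zero[OF X X cid_gmaps[OF X] eg] by (simp add: e'_def)
    then show ?thesis by simp
  qed
qed

lemma triv_idem_direct_sum:
  assumes X: "proj_complex X" and A: "proj_complex A" and B: "proj_complex B"
    and t: "triv_idem X" and ds: "direct_sum strict X A B"
  shows "null_object strict A \<or> null_object strict B"
proof -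
  obtain iA iB pA pB where m: "iA \<in> chain_maps A X" "iB \<in> chain_maps B X" "pA \<in> chain_maps X A" "pB \<in> chain_maps X B"
    and eq: "pA \<odot> iA = cid A" "pB \<odot> iB = cid B" "pB \<odot> iA = czero" "pA \<odot> iB = czero"
      "cadd X (iA \<odot> pA) (iB \<odot> pB) = cid X"
    using ds unfolding direct_sum_def strict_def by blast
  have e: "iA \<odot> pA \<in> chain_maps X X"
    by (rule chain_comp[OF X A m(3) X m(1)])
  have A1: "cid A \<odot> pA = pA"
    by (rule gmaps_id_left[OF X A chain_gmaps[OF m(3)]])
  have "(iA \<odot> pA) \<odot> (iA \<odot> pA) = iA \<odot> ((pA \<odot> iA) \<odot> pA)"
    by (simp add: ccomp_assoc)
  then have "(iA \<odot> pA) \<odot> (iA \<odot> pA) = iA \<odot> pA"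
    by (simp add: eq A1)
  from triv_idemD[OF t e this] show ?thesis
  proof
    assume z: "iA \<odot> pA = czero"
    have "cid A = pA \<odot> ((iA \<odot> pA) \<odot> iA)"
      by (simp add: ccomp_assoc[symmetric] eq) (simp add: ccomp_assoc eq gmaps_id_left[OF A A cid_gmaps[OF A]])
    then have "cid A = czero"
      by (simp add: z zero_comp gmaps_zero_right[OF X A chain_gmaps[OF m(3)]])
    then show ?thesis by (simp add: null_object_def strict_def)
  next
    assume z: "iA \<odot> pA = cid X"
    have "iB = (iA \<odot> pA) \<odot> iB"
      by (simp add: z gmaps_id_left[OF B X chain_gmaps[OF m(2)]])
    also have "\<dots> = czero"
      by (simp add: ccomp_assoc eq gmaps_zero_right[OF A X chain_gmaps[OF m(1)]])
    finally have "cid B = czero"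
      using eq(2) gmaps_zero_right[OF X B chain_gmaps[OF m(4)]] by simp
    then show ?thesis by (simp add: null_object_def strict_def)
  qed
qed

text \<open>\<open>triv_idem\<close> does not mention the interval, so indecomposability passes from
  one window to another.\<close>

lemma indecomposable_strict_iff:
  "indecomposable strict (CI lo hi) X \<longleftrightarrow>
     X \<in> CI lo hi \<and> \<not> null_object strict X \<and> triv_idem X"
  using indecomposable_triv_idem triv_idem_direct_sum CI_proj_complex
  unfolding indecomposable_def by metis

text \<open>The idempotent projects onto the contractible summand generated by degree \<open>p\<close>, which \<open>f\<close> kills
  as soon as it kills degree \<open>p\<close>.\<close>

lemma split_mono_idem:
  fixes X :: "('a::ring_1, 'm::zero) cpx"
  assumes X: "proj_complex X" and mu: "mu \<in> mod_hom (ob X (p + 1)) (ob X p)"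
    and split: "mu \<circ> diff X p = id_mod (ob X p)"
  shows "\<exists>e\<in>chain_maps X X. e \<odot> e = e \<and> e p = id_mod (ob X p) \<and> (\<forall>i. i \<noteq> p \<and> i \<noteq> p + 1 \<longrightarrow> e i = (\<lambda>_. 0)) \<and>
    (\<forall>Y :: ('a, 'm) cpx. proj_complex Y \<longrightarrow> (\<forall>f\<in>chain_maps X Y. f p = (\<lambda>_. 0) \<longrightarrow> f \<odot> e = czero))"
proof -
  have split: "mu (diff X p x) = x" if "x \<in> mcarrier (ob X p)" for x
    using fun_cong[OF split, of x] that by (simp add: id_mod_def)
  define e where "e i = (if i = p then id_mod (ob X p) else if i = p + 1 then diff X p \<circ> mu else (\<lambda>_. 0))" for i
  note rX = cpx_mod[OF X]
  have e: "e \<in> chain_maps X X"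
  proof (rule chain_mapsI[OF X X])
    show "e i \<in> mod_hom (ob X i) (ob X i)" for i
      using hom_comp[OF mu cpx_diff[OF X, of p]] by (simp add: e_def id_mod_hom zero_hom rX)
    show "diff X i (e i x) = e (i + 1) (diff X i x)" if x: "x \<in> mcarrier (ob X i)" for i x
    proof -
      consider "i = p" | "i = p + 1" | "i = p - 1" | "i \<noteq> p" "i \<noteq> p + 1" "i \<noteq> p - 1" by blast
      then show ?thesis
      proof cases
        case 1 with x split show ?thesis by (simp add: e_def id_mod_def)
      next
        case 2
        then show ?thesis by (simp add: e_def cpx_dd[OF X])
      next
        case 3
        \<comment> \<open>A left inverse of the differential in degree \<open>p\<close> forces the
          incoming differential to vanish.\<close>
        have "diff X (p - 1) x = 0"
        proof -
          have "diff X (p - 1) x \<in> mcarrier (ob X p)"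
            using hom_in[OF cpx_diff[OF X] x] 3 by simp
          from split[OF this] show ?thesis
            using cpx_dd'[OF X, of p x] hom_0[OF mu rX rX] by simp
        qed
        with 3 show ?thesis
          using hom_0[OF cpx_diff[OF X] rX rX] by (simp add: e_def id_mod_def)
      next
        case 4
        then show ?thesis
          using hom_0[OF cpx_diff[OF X] rX rX] by (simp add: e_def)
      qed
    qed
  qed
  moreover have "e \<odot> e = e"
  proof (rule gmaps_ext[OF gmaps_comp[OF X X chain_gmaps[OF e] X chain_gmaps[OF e]] chain_gmaps[OF e]])
    show "(e \<odot> e) i x = e i x" if "x \<in> mcarrier (ob X i)" for i x
      using that split[OF hom_in[OF mu]] by (auto simp: e_def id_mod_def)
  qed
  moreover have "f \<odot> e = czero" if Y: "proj_complex Y" and f: "f \<in> chain_maps X Y" and fp: "f p = (\<lambda>_. 0)"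
    for Y :: "('a, 'm) cpx" and f
  proof -
    have "f i (e i x) = 0" for i x
      using fp chain_comm[OF f, of p "mu x"] gmaps_0[OF X Y chain_gmaps[OF f]]
        hom_0[OF cpx_diff[OF Y] cpx_mod[OF Y] cpx_mod[OF Y]]
      by (auto simp: e_def)
    then show ?thesis by (simp add: fun_eq_iff)
  qed
  ultimately show ?thesis
    by (intro bexI[of _ e]) (simp_all add: e_def)
qed

subsection \<open>Fitting's lemma\<close>

primrec cpow :: "('a::ring_1, 'm::zero) cpx \<Rightarrow> 'm cmap \<Rightarrow> nat \<Rightarrow> 'm cmap" where
  "cpow X u 0 = cid X"
| "cpow X u (Suc n) = u \<odot> cpow X u n"

context
  fixes X :: "('a::ring_1, 'm::zero) cpx" and u
  assumes X: "proj_complex X" and u: "u \<in> chain_maps X X"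
begin

lemma cpow_chain: "cpow X u n \<in> chain_maps X X"
  by (induction n) (simp_all only: cpow.simps chain_id[OF X] chain_comp[OF X X _ X u])

lemma cpow_add: "cpow X u (m + n) = cpow X u m \<odot> cpow X u n"
  by (induction m) (simp_all add: ccomp_assoc gmaps_id_left[OF X X chain_gmaps[OF cpow_chain]])

lemma cpow_1: "cpow X u (Suc 0) = u"
  by (simp add: gmaps_id_right[OF X X chain_gmaps[OF u]])

lemma cpow_Suc_right: "cpow X u (Suc n) = cpow X u n \<odot> u"
  using cpow_add[of n "Suc 0"] cpow_1 by simp

lemma bij_automorphism:
  assumes "\<And>i. inj_on (u i) (mcarrier (ob X i))" "\<And>i. u i ` mcarrier (ob X i) = mcarrier (ob X i)"
  shows "is_automorphism X u"
proof -
  note uh = chain_hom[OF u] and r = rmod_simps[OF cpx_mod[OF X]]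
  define v where "v i y = (if y \<in> mcarrier (ob X i) then inv_into (mcarrier (ob X i)) (u i) y else 0)" for i y
  have v: "v i y \<in> mcarrier (ob X i)" "u i (v i y) = y" if "y \<in> mcarrier (ob X i)" for i y
    using that assms(2)[of i] inv_into_into[of y "u i" "mcarrier (ob X i)"] f_inv_into_f[of y "u i" "mcarrier (ob X i)"]
    by (simp_all add: v_def)
  have vu: "v i (u i x) = x" if "x \<in> mcarrier (ob X i)" for i x
    using that assms(1) hom_in[OF uh] by (simp add: v_def)
  have inj: "x = y" if "u i x = u i y" "x \<in> mcarrier (ob X i)" "y \<in> mcarrier (ob X i)" for i x y
    using inj_onD[OF assms(1) that] .
  have vc: "v \<in> chain_maps X X"
  proof (rule chain_mapsI[OF X X])
    show "v i \<in> mod_hom (ob X i) (ob X i)" for i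
    proof (rule mod_homI)
      show "v i x = 0" if "x \<notin> mcarrier (ob X i)" for x using that by (simp add: v_def)
    next
      fix x y a assume xy: "x \<in> mcarrier (ob X i)" "y \<in> mcarrier (ob X i)"
      then show "v i (madd (ob X i) x y) = madd (ob X i) (v i x) (v i y)"
        by - (rule inj[of i "v i (madd (ob X i) x y)"], simp_all add: v r hom_madd[OF uh])
    next
      fix x a assume "x \<in> mcarrier (ob X i)"
      then show "v i (mact (ob X i) x a) = mact (ob X i) (v i x) a"
        by - (rule inj[of i "v i (mact (ob X i) x a)"], simp_all add: v r hom_mact[OF uh])
    qed (simp add: v)
    show "diff X i (v i x) = v (i + 1) (diff X i x)" if "x \<in> mcarrier (ob X i)" for i x
      using that
      by - (rule inj[of "i + 1" "diff X i (v i x)"], simp_all add: v hom_in[OF cpx_diff[OF X]] chain_comm[OF u, symmetric])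
  qed
  have "v \<odot> u = cid X"
    by (rule gmaps_ext[OF gmaps_comp[OF X X chain_gmaps[OF u] X chain_gmaps[OF vc]] cid_gmaps[OF X]]) (simp add: vu)
  moreover have "u \<odot> v = cid X"
    by (rule gmaps_ext[OF gmaps_comp[OF X X chain_gmaps[OF vc] X chain_gmaps[OF u]] cid_gmaps[OF X]]) (simp add: v)
  ultimately show ?thesis
    using u vc by (auto simp: is_automorphism_def)
qed

end

text \<open>Image and kernel of \<open>v\<close> no longer change under squaring, so
  \<open>X\<close> is their direct sum. The projection onto the image is an idempotent chain map; as
  it is trivial, \<open>v\<close> either vanishes or is bijective in every degree.\<close>

lemma fitting_stable:
  fixes X :: "('a::ring_1, 'm::zero) cpx"
  assumes X: "proj_complex X" and v: "v \<in> chain_maps X X" and t: "triv_idem X"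
    and im: "\<And>i. v i ` mcarrier (ob X i) \<subseteq> (v \<odot> v) i ` mcarrier (ob X i)"
    and ker: "\<And>i x. x \<in> mcarrier (ob X i) \<Longrightarrow> v i (v i x) = 0 \<Longrightarrow> v i x = 0"
  shows "v = czero \<or> (\<forall>i. inj_on (v i) (mcarrier (ob X i)) \<and> v i ` mcarrier (ob X i) = mcarrier (ob X i))"
proof -
  note vh = chain_hom[OF v] and r = rmod_simps[OF cpx_mod[OF X]] and dh = cpx_diff[OF X]
  let ?M = "\<lambda>i. mcarrier (ob X i)"
  have inj: "y = y'" if "y \<in> v i ` ?M i" "y' \<in> v i ` ?M i" "v i y = v i y'" for i y y'
  proof -
    from that(1,2) obtain x x' where x: "y = v i x" "x \<in> ?M i" "y' = v i x'" "x' \<in> ?M i" by auto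
    let ?z = "madd (ob X i) x (mact (ob X i) x' (- 1))"
    have "v i (v i ?z) = madd (ob X i) (v i y) (mact (ob X i) (v i y') (- 1))"
      using x by (simp add: hom_madd[OF vh] hom_mact[OF vh] r hom_in[OF vh])
    also have "\<dots> = 0"
      using that(3) x by (simp add: r hom_in[OF vh])
    finally have "v i ?z = 0" using x by - (rule ker, simp_all add: r)
    then have "madd (ob X i) y (mact (ob X i) y' (- 1)) = 0"
      using x by (simp add: hom_madd[OF vh] hom_mact[OF vh] r)
    then have "mact (ob X i) y' (- 1) = mact (ob X i) y (- 1)"
      using x by (simp add: madd_eq_0_iff[OF cpx_mod[OF X]] r hom_in[OF vh])
    then have "mact (ob X i) (mact (ob X i) y' (- 1)) (- 1) = mact (ob X i) (mact (ob X i) y (- 1)) (- 1)"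
      by simp
    then show ?thesis
      using x by (simp add: r hom_in[OF vh])
  qed
  have "\<exists>y. y \<in> v i ` ?M i \<and> v i y = v i x" if "x \<in> ?M i" for i x
  proof -
    have "v i x \<in> (v \<odot> v) i ` ?M i" using im that by blast
    then show ?thesis by auto
  qed
  note ex = this
  \<comment> \<open>The image component of \<open>x\<close> is the unique \<open>y\<close> in the
    image of \<open>v\<close> with \<open>v y = v x\<close>, since then \<open>x - y\<close> lies in
    the kernel.\<close>
  define E where "E i x = (SOME y. y \<in> v i ` ?M i \<and> v i y = v i x)" for i x
  have E: "E i x \<in> v i ` ?M i \<and> v i (E i x) = v i x" if "x \<in> ?M i" for i x
    unfolding E_def by (rule someI_ex[OF ex[OF that]])
  define e where "e i x = (if x \<in> ?M i then E i x else 0)" for i x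
  have eE: "e i x \<in> v i ` ?M i" "v i (e i x) = v i x" if "x \<in> ?M i" for i x
    using E that by (simp_all add: e_def)
  have eM: "e i x \<in> ?M i" if "x \<in> ?M i" for i x
    using eE(1)[OF that] hom_in[OF vh] by auto
  have sub: "submod (v i ` ?M i) (ob X i)" for i
    by (rule submod_image[OF vh cpx_mod[OF X] cpx_mod[OF X]])
  have e: "e \<in> chain_maps X X"
  proof (rule chain_mapsI[OF X X])
    show "e i \<in> mod_hom (ob X i) (ob X i)" for i
    proof (rule mod_homI)
      show "e i x = 0" if "x \<notin> ?M i" for x using that by (simp add: e_def)
      show "e i (madd (ob X i) x y) = madd (ob X i) (e i x) (e i y)" if "x \<in> ?M i" "y \<in> ?M i" for x y
        using that by - (rule inj[of _ i], simp_all add: eE eM r hom_madd[OF vh] submod_D(3)[OF sub])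
      show "e i (mact (ob X i) x a) = mact (ob X i) (e i x) a" if "x \<in> ?M i" for x a
        using that by - (rule inj[of _ i], simp_all add: eE eM r hom_mact[OF vh] submod_D(4)[OF sub])
    qed (rule eM)
    show "diff X i (e i x) = e (i + 1) (diff X i x)" if x: "x \<in> ?M i" for i x
    proof (rule inj[of _ "i + 1"])
      obtain z where "e i x = v i z" "z \<in> ?M i" using eE(1)[OF x] by auto
      then show "diff X i (e i x) \<in> v (i + 1) ` ?M (i + 1)"
        using chain_comm[OF v, of i z] hom_in[OF dh, of z i] by auto
      show "v (i + 1) (diff X i (e i x)) = v (i + 1) (e (i + 1) (diff X i x))"
        using x by (simp add: eE hom_in[OF dh] chain_comm[OF v, symmetric])
    qed (simp add: x eE hom_in[OF dh])
  qed
  have "e \<odot> e = e"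
  proof (rule gmaps_ext[OF gmaps_comp[OF X X chain_gmaps[OF e] X chain_gmaps[OF e]] chain_gmaps[OF e]])
    show "(e \<odot> e) i x = e i x" if "x \<in> ?M i" for i x
      using that by - (rule inj[of _ i], simp_all add: eE eM)
  qed
  from triv_idemD[OF t e this] show ?thesis
  proof
    assume z: "e = czero"
    have "v = czero"
    proof (rule gmaps_ext[OF chain_gmaps[OF v] gmaps_zero[OF X X]])
      show "v i x = czero i x" if "x \<in> ?M i" for i x
        using eE(2)[OF that] hom_0[OF vh cpx_mod[OF X] cpx_mod[OF X]] by (simp add: z)
    qed
    then show ?thesis ..
  next
    assume o: "e = cid X"
    have "?M i \<subseteq> v i ` ?M i" for i
      using eE(1)[of _ i] by (auto simp: o)
    then have surj: "v i ` ?M i = ?M i" for i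
      using hom_in[OF vh] by blast
    then have "inj_on (v i) (?M i)" for i
      by (intro inj_onI) (simp add: inj[of _ i])
    with surj show ?thesis by blast
  qed
qed

lemma nat_decreasing_stable:
  fixes a :: "nat \<Rightarrow> nat"
  assumes "\<And>n. a (Suc n) \<le> a n"
  shows "\<exists>N. \<forall>n\<ge>N. a n = a N"
proof -
  obtain N where N: "\<And>n. a N \<le> a n"
    using ex_has_least_nat[of "\<lambda>_. True" 0 a] by auto
  have "a n \<le> a N" if "n \<ge> N" for n
    using lift_Suc_antimono_le[of a, OF assms that] .
  with N show ?thesis by (meson le_antisym)
qed

lemma chain_of_submods_stable:
  fixes mu :: "'m::zero set \<Rightarrow> nat"
  assumes mu: "\<And>N N'. submod N M \<Longrightarrow> submod N' M \<Longrightarrow> N \<subset> N' \<Longrightarrow> mu N < mu N'"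
    and S: "\<And>n. submod (S n) M" and mono: "\<And>n. S (Suc n) \<subseteq> S n"
  shows "\<exists>N. \<forall>n\<ge>N. S n = S N"
proof -
  have "mu (S (Suc n)) \<le> mu (S n)" for n
    using mu[OF S S, of "Suc n" n] mono[of n] by (metis less_imp_le order_refl psubsetI)
  then obtain N where N: "\<forall>n\<ge>N. mu (S n) = mu (S N)"
    using nat_decreasing_stable[of "\<lambda>n. mu (S n)"] by blast
  have "S n = S N" if "n \<ge> N" for n
  proof -
    have "S n \<subseteq> S N" using lift_Suc_antimono_le[of S, OF mono that] .
    then show ?thesis using mu[OF S S, of n N] N that by (metis less_irrefl psubsetI)
  qed
  then show ?thesis by blast
qed

lemma increasing_chain_of_submods_stable:
  fixes mu :: "'m::zero set \<Rightarrow> nat"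
  assumes mu: "\<And>N N'. submod N M \<Longrightarrow> submod N' M \<Longrightarrow> N \<subset> N' \<Longrightarrow> mu N < mu N'" and M: "submod (mcarrier M) M"
    and S: "\<And>n. submod (S n) M" and mono: "\<And>n. S n \<subseteq> S (Suc n)"
  shows "\<exists>N. \<forall>n\<ge>N. S n = S N"
proof -
  have le: "mu (S n) \<le> mu (mcarrier M)" for n
    using mu[OF S M, of n] submod_D(1)[OF S, of n] by (metis less_imp_le order_refl psubsetI)
  have le2: "mu (S n) \<le> mu (S (Suc n))" for n
    using mu[OF S S, of n "Suc n"] mono[of n] by (metis less_imp_le order_refl psubsetI)
  obtain N where N: "\<forall>n\<ge>N. mu (mcarrier M) - mu (S n) = mu (mcarrier M) - mu (S N)"
    using nat_decreasing_stable[of "\<lambda>n. mu (mcarrier M) - mu (S n)"] le2 diff_le_mono2 by blast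
  have "S n = S N" if "n \<ge> N" for n
  proof -
    have "S N \<subseteq> S n" using lift_Suc_mono_le[of S, OF mono that] .
    moreover have "mu (S n) = mu (S N)" using N that le[of n] le[of N] by (metis diff_diff_cancel)
    ultimately show ?thesis using mu[OF S S, of N n] by (metis less_irrefl psubsetI)
  qed
  then show ?thesis by blast
qed

text \<open>A high power of \<open>u\<close> has stable image and kernel by finite length. One
  exponent serves all degrees because the complex is bounded.\<close>

lemma fitting:
  fixes scale :: "'k::field \<Rightarrow> 'a::ring_1 \<Rightarrow> 'a" and X :: "('a, 'm::zero) cpx"
  assumes alg: "fin_dim_algebra scale" and XC: "X \<in> CI lo hi" and t: "triv_idem X"
    and u: "u \<in> chain_maps X X"
  shows "is_automorphism X u \<or> (\<exists>n. cpow X u (Suc n) = czero)"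
proof -
  have X: "proj_complex X" using XC by (rule CI_proj_complex)
  note ph = chain_hom[OF cpow_chain[OF X u]] and rX = cpx_mod[OF X]
  let ?M = "\<lambda>i. mcarrier (ob X i)"
  define Im where "Im i n = cpow X u n i ` ?M i" for i n
  define Ker where "Ker i n = {x \<in> ?M i. cpow X u n i x = 0}" for i n
  have "\<exists>N. \<forall>n\<ge>N. Im i n = Im i N \<and> Ker i n = Ker i N" for i
  proof -
    obtain mu :: "'m set \<Rightarrow> nat" where mu: "\<And>N N'. submod N (ob X i) \<Longrightarrow> submod N' (ob X i) \<Longrightarrow> N \<subset> N' \<Longrightarrow> mu N < mu N'"
      using finite_length[OF alg cpx_fg[OF X]] by blast
    have M: "submod (?M i) (ob X i)"
      by (simp add: submod_def rmod_simps[OF rX])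
    have 1: "submod (Im i n) (ob X i)" for n
      unfolding Im_def by (rule submod_image[OF ph rX rX])
    have 2: "submod (Ker i n) (ob X i)" for n
      unfolding Ker_def by (rule submod_kernel[OF ph rX rX])
    have 3: "Im i (Suc n) \<subseteq> Im i n" for n
      unfolding Im_def using hom_in[OF chain_hom[OF u]] by (auto simp: cpow_Suc_right[OF X u] simp del: cpow.simps)
    have 4: "Ker i n \<subseteq> Ker i (Suc n)" for n
      unfolding Ker_def using hom_0[OF chain_hom[OF u] rX rX] by auto
    obtain N1 where N1: "\<forall>n\<ge>N1. Im i n = Im i N1"
      using chain_of_submods_stable[of "ob X i" mu "Im i", OF mu 1 3] by blast
    obtain N2 where N2: "\<forall>n\<ge>N2. Ker i n = Ker i N2"
      using increasing_chain_of_submods_stable[of "ob X i" mu "Ker i", OF mu M 2 4] by blast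
    show ?thesis
      using N1 N2 by (intro exI[of _ "max N1 N2"]) (metis max.cobounded1 max.cobounded2 order_trans)
  qed
  then obtain N where "\<forall>i. \<forall>n\<ge>N i. Im i n = Im i (N i) \<and> Ker i n = Ker i (N i)"
    using choice[of "\<lambda>i N. \<forall>n\<ge>N. Im i n = Im i N \<and> Ker i n = Ker i N"] by blast
  then have N: "Im i n = Im i (N i) \<and> Ker i n = Ker i (N i)" if "n \<ge> N i" for i n
    using that by blast
  \<comment> \<open>\<open>{0}\<close> covers an empty interval; \<open>Suc\<close> makes
    \<open>m\<close> positive, so that a factor \<open>u\<close> can be split off the power on
    either side.\<close>
  define m where "m = Suc (Max (N ` {lo..hi} \<union> {0}))"
  have mN: "m \<ge> N i" if "i \<in> {lo..hi}" for i
  proof -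
    have "N i \<le> Max (N ` {lo..hi} \<union> {0})" using that by (intro Max_ge) auto
    then show ?thesis by (simp add: m_def)
  qed
  define v where "v = cpow X u m"
  have v: "v \<in> chain_maps X X" unfolding v_def by (rule cpow_chain[OF X u])
  have vv: "cpow X u (m + m) = v \<odot> v" unfolding v_def by (rule cpow_add[OF X u])
  have "v = czero \<or> (\<forall>i. inj_on (v i) (?M i) \<and> v i ` ?M i = ?M i)"
  proof (rule fitting_stable[OF X v t])
    fix i
    have triv: "?M i = {0}" if "i \<notin> {lo..hi}"
      using that CI_zero[OF XC, of i] by (auto simp: mcarrier_zero_mod)
    have v0: "v i 0 = 0" by (rule gmaps_0[OF X X chain_gmaps[OF v]])
    show "v i ` ?M i \<subseteq> (v \<odot> v) i ` ?M i"
    proof (cases "i \<in> {lo..hi}")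
      case True
      then show ?thesis
        using N[of i m] N[of i "m + m"] mN[of i] by (simp add: Im_def vv flip: v_def)
    qed (simp add: triv v0)
    show "v i x = 0" if "x \<in> ?M i" "v i (v i x) = 0" for x
    proof (cases "i \<in> {lo..hi}")
      case True
      then have "Ker i (m + m) = Ker i m"
        using N[of i m] N[of i "m + m"] mN[of i] by simp
      moreover have "x \<in> Ker i (m + m)" using that by (simp add: Ker_def vv)
      ultimately show ?thesis by (simp add: Ker_def v_def)
    next
      case False
      with that triv v0 show ?thesis by simp
    qed
  qed
  then show ?thesis
  proof
    assume "v = czero"
    then show ?thesis by (auto simp: v_def m_def)
  next
    assume b: "\<forall>i. inj_on (v i) (?M i) \<and> v i ` ?M i = ?M i"
    let ?w = "cpow X u (m - 1)"
    have v1: "v = u \<odot> ?w" "v = ?w \<odot> u"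
      using cpow_Suc_right[OF X u, of "m - 1"] by (simp_all add: v_def m_def)
    have "is_automorphism X u"
    proof (rule bij_automorphism[OF X u])
      fix i
      show "inj_on (u i) (?M i)"
      proof (rule inj_onI)
        fix x y assume xy: "x \<in> ?M i" "y \<in> ?M i" "u i x = u i y"
        then have "v i x = v i y" by (simp add: v1(2))
        with b xy show "x = y" by (metis inj_onD)
      qed
      have "?M i \<subseteq> u i ` ?M i"
      proof
        fix y assume "y \<in> ?M i"
        with b obtain x where "x \<in> ?M i" "y = v i x" by blast
        then show "y \<in> u i ` ?M i"
          using hom_in[OF ph, of x i "m - 1"] by (simp add: v1(1))
      qed
      then show "u i ` ?M i = ?M i"
        using hom_in[OF chain_hom[OF u]] by blast
    qed
    then show ?thesis ..
  qed
qed

subsection \<open>Homotopies\<close>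

definition hmaps :: "('a::ring_1, 'm::zero) cpx \<Rightarrow> ('a, 'm) cpx \<Rightarrow> 'm cmap set" where
  "hmaps X Y = {h. \<forall>i. h i \<in> mod_hom (ob X i) (ob Y (i - 1))}"

definition hbd :: "('a::ring_1, 'm::zero) cpx \<Rightarrow> ('a, 'm) cpx \<Rightarrow> 'm cmap \<Rightarrow> 'm cmap" where
  "hbd X Y h = (\<lambda>i x. madd (ob Y i) (diff Y (i - 1) (h i x)) (h (i + 1) (diff X i x)))"

lemma homotopic_iff: "homotopic X Y f g \<longleftrightarrow> (\<exists>h\<in>hmaps X Y. f = cadd Y g (hbd X Y h))"
  by (auto simp: homotopic_def hmaps_def hbd_def)

lemma hmaps_hom: "h \<in> hmaps X Y \<Longrightarrow> h i \<in> mod_hom (ob X i) (ob Y (i - 1))"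
  by (simp add: hmaps_def)

lemma hmaps_hom': "h \<in> hmaps X Y \<Longrightarrow> h (i + 1) \<in> mod_hom (ob X (i + 1)) (ob Y i)"
  using hmaps_hom[of h X Y "i + 1"] by simp

lemma cpx_diff': "proj_complex X \<Longrightarrow> diff X (i - 1) \<in> mod_hom (ob X (i - 1)) (ob X i)"
  using cpx_diff[of X "i - 1"] by simp

context
  fixes X Y :: "('a::ring_1, 'm::zero) cpx"
  assumes X: "proj_complex X" and Y: "proj_complex Y"
begin

lemma hmaps_closed: "h \<in> hmaps X Y \<Longrightarrow> h i x \<in> mcarrier (ob Y (i - 1))"
  using hom_closed[OF hmaps_hom cpx_mod[OF Y]] .

lemma hmaps_closed': "h \<in> hmaps X Y \<Longrightarrow> h (i + 1) x \<in> mcarrier (ob Y i)"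
  using hom_closed[OF hmaps_hom' cpx_mod[OF Y]] .

lemma hmaps_d: "h \<in> hmaps X Y \<Longrightarrow> diff Y (i - 1) (h i x) \<in> mcarrier (ob Y i)"
  using hom_in[OF cpx_diff'[OF Y] hmaps_closed] .

lemma hbd_gmaps:
  assumes h: "h \<in> hmaps X Y"
  shows "hbd X Y h \<in> gmaps X Y"
  using hom_add_in[OF hom_comp[OF hmaps_hom[OF h] cpx_diff'[OF Y] cpx_mod[OF Y] cpx_mod[OF Y]]
      hom_comp[OF cpx_diff[OF X] hmaps_hom'[OF h] cpx_mod[OF X] cpx_mod[OF Y]] cpx_mod[OF Y]]
  by (simp add: gmaps_def hbd_def comp_def)

lemma hmaps_add:
  assumes "h \<in> hmaps X Y" "h' \<in> hmaps X Y"
  shows "(\<lambda>i x. madd (ob Y (i - 1)) (h i x) (h' i x)) \<in> hmaps X Y"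
  using assms hom_add_in cpx_mod[OF Y] unfolding hmaps_def by blast

lemma hmaps_neg:
  assumes "h \<in> hmaps X Y"
  shows "(\<lambda>i x. mact (ob Y (i - 1)) (h i x) (- 1)) \<in> hmaps X Y"
  using assms hom_neg_in cpx_mod[OF Y] unfolding hmaps_def by blast

lemma hbd_add:
  assumes "h \<in> hmaps X Y" "h' \<in> hmaps X Y"
  shows "hbd X Y (\<lambda>i x. madd (ob Y (i - 1)) (h i x) (h' i x)) = cadd Y (hbd X Y h) (hbd X Y h')"
  using assms
  by (simp add: fun_eq_iff hbd_def hom_madd[OF cpx_diff'[OF Y]] hmaps_closed hmaps_closed' hmaps_d
      madd_closed[OF cpx_mod[OF Y]] madd_ac[OF cpx_mod[OF Y]])

lemma hbd_neg:
  assumes "h \<in> hmaps X Y"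
  shows "hbd X Y (\<lambda>i x. mact (ob Y (i - 1)) (h i x) (- 1)) = cneg Y (hbd X Y h)"
  using assms
  by (simp add: fun_eq_iff hbd_def hom_mact[OF cpx_diff'[OF Y]] hmaps_closed hmaps_closed' hmaps_d
      mact_madd[OF cpx_mod[OF Y]])

lemma homotopic_refl:
  assumes f: "f \<in> gmaps X Y"
  shows "homotopic X Y f f"
proof -
  have "(\<lambda>_ _. 0) \<in> hmaps X Y"
    using zero_hom[OF cpx_mod[OF Y]] by (simp add: hmaps_def)
  moreover have "cadd Y f (hbd X Y (\<lambda>_ _. 0)) = f"
    by (simp add: fun_eq_iff hbd_def hom_0[OF cpx_diff'[OF Y] cpx_mod[OF Y] cpx_mod[OF Y]]
        rmod_simps[OF cpx_mod[OF Y]] gmaps_closed[OF X Y f])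
  ultimately show ?thesis unfolding homotopic_iff by (intro bexI[of _ "\<lambda>_ _. 0"]) (simp_all only:)
qed

lemma homotopic_sym:
  assumes g: "g \<in> gmaps X Y" and h: "homotopic X Y f g"
  shows "homotopic X Y g f"
proof -
  obtain h where h: "h \<in> hmaps X Y" "f = cadd Y g (hbd X Y h)"
    using h unfolding homotopic_iff by blast
  note b = hbd_gmaps[OF h(1)]
  have "g = cadd Y f (cneg Y (hbd X Y h))"
    unfolding h(2) using g b
    by (simp add: cadd_assoc[OF X Y] gmaps_neg[OF X Y] cadd_neg[OF X Y] cadd_zero_right[OF X Y])
  then show ?thesis
    unfolding homotopic_iff by (intro bexI[OF _ hmaps_neg[OF h(1)]]) (simp only: hbd_neg[OF h(1)])
qed

lemma homotopic_trans:
  assumes k: "k \<in> gmaps X Y" and 1: "homotopic X Y f g" and 2: "homotopic X Y g k"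
  shows "homotopic X Y f k"
proof -
  obtain h where h: "h \<in> hmaps X Y" "f = cadd Y g (hbd X Y h)"
    using 1 unfolding homotopic_iff by blast
  obtain h' where h': "h' \<in> hmaps X Y" "g = cadd Y k (hbd X Y h')"
    using 2 unfolding homotopic_iff by blast
  have "f = cadd Y k (cadd Y (hbd X Y h') (hbd X Y h))"
    unfolding h(2) h'(2) by (rule cadd_assoc[OF X Y k hbd_gmaps[OF h'(1)] hbd_gmaps[OF h(1)]])
  then show ?thesis
    unfolding homotopic_iff
    by (intro bexI[OF _ hmaps_add[OF h'(1) h(1)]]) (simp only: hbd_add[OF h'(1) h(1)])
qed

lemma homotopic_comp_left:
  assumes Z: "proj_complex Z" and k: "k \<in> chain_maps Y Z" and g: "g \<in> gmaps X Y" and h: "homotopic X Y f g"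
  shows "homotopic X Z (k \<odot> f) (k \<odot> g)"
proof -
  obtain h where h: "h \<in> hmaps X Y" "f = cadd Y g (hbd X Y h)"
    using h unfolding homotopic_iff by blast
  have "k \<odot> hbd X Y h = hbd X Z (\<lambda>i. k (i - 1) \<circ> h i)"
    using h(1)
    by (simp add: fun_eq_iff hbd_def hom_madd[OF chain_hom[OF k]] hmaps_closed' hmaps_d chain_comm'[OF k])
  then have "k \<odot> f = cadd Z (k \<odot> g) (hbd X Z (\<lambda>i. k (i - 1) \<circ> h i))"
    unfolding h(2) by (simp add: comp_cadd[OF X Y g hbd_gmaps[OF h(1)] chain_gmaps[OF k]])
  moreover have "(\<lambda>i. k (i - 1) \<circ> h i) \<in> hmaps X Z"
    unfolding hmaps_def using hom_comp[OF hmaps_hom[OF h(1)] chain_hom[OF k] cpx_mod[OF Y] cpx_mod[OF Z]] by blast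
  ultimately show ?thesis unfolding homotopic_iff by blast
qed

lemma homotopic_comp_right:
  assumes W: "proj_complex W" and k: "k \<in> chain_maps W X" and h: "homotopic X Y f g"
  shows "homotopic W Y (f \<odot> k) (g \<odot> k)"
proof -
  obtain h where h: "h \<in> hmaps X Y" "f = cadd Y g (hbd X Y h)"
    using h unfolding homotopic_iff by blast
  have "hbd X Y h \<odot> k = hbd W Y (\<lambda>i. h i \<circ> k i)"
    by (simp add: fun_eq_iff hbd_def chain_comm[OF k])
  then have "f \<odot> k = cadd Y (g \<odot> k) (hbd W Y (\<lambda>i. h i \<circ> k i))"
    unfolding h(2) by (simp add: cadd_comp)
  moreover have "(\<lambda>i. h i \<circ> k i) \<in> hmaps W Y"
    unfolding hmaps_def using hom_comp[OF chain_hom[OF k] hmaps_hom[OF h(1)] cpx_mod[OF X] cpx_mod[OF Y]] by blast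
  ultimately show ?thesis unfolding homotopic_iff by blast
qed

end

text \<open>The composite \<open>iA \<odot> pA\<close> is idempotent only up to homotopy. Instead of
  lifting it to a strict idempotent, Fitting's lemma is applied to the composite itself: if it is
  invertible, \<open>pB\<close> factors through \<open>pB \<odot> iA\<close> and \<open>B\<close> is
  contractible; if it is nilpotent, the identity of \<open>A\<close> is homotopic to
  \<open>0\<close>.\<close>

lemma triv_idem_homotopic_summand:
  fixes scale :: "'k::field \<Rightarrow> 'a::ring_1 \<Rightarrow> 'a" and X :: "('a, 'm::zero) cpx"
  assumes alg: "fin_dim_algebra scale" and XC: "X \<in> CI lo hi" and t: "triv_idem X"
    and A: "proj_complex A" and B: "proj_complex B" and ds: "direct_sum homotopic X A B"
  shows "null_object homotopic A \<or> null_object homotopic B"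
proof -
  have X: "proj_complex X" using XC by (rule CI_proj_complex)
  obtain iA iB pA pB where iA: "iA \<in> chain_maps A X" and iB: "iB \<in> chain_maps B X"
    and pA: "pA \<in> chain_maps X A" and pB: "pB \<in> chain_maps X B"
    and 1: "homotopic A A (pA \<odot> iA) (cid A)" and 2: "homotopic B B (pB \<odot> iB) (cid B)"
    and 3: "homotopic A B (pB \<odot> iA) czero"
    using ds unfolding direct_sum_def by blast
  define e where "e = iA \<odot> pA"
  have e: "e \<in> chain_maps X X"
    unfolding e_def by (rule chain_comp[OF X A pA X iA])
  note cA = gmaps_zero[OF A A] cid_gmaps[OF A]
  from fitting[OF alg XC t e] show ?thesis
  proof (elim disjE exE)
    assume "is_automorphism X e"
    then obtain v where v: "v \<in> chain_maps X X" "e \<odot> v = cid X"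
      by (auto simp: is_automorphism_def)
    have pv: "pA \<odot> v \<in> chain_maps X A" by (rule chain_comp[OF X X v(1) A pA])
    have "pB = pB \<odot> (e \<odot> v)"
      unfolding v(2) by (rule gmaps_id_right[OF X B chain_gmaps[OF pB], symmetric])
    then have "pB = (pB \<odot> iA) \<odot> (pA \<odot> v)" by (simp add: e_def ccomp_assoc)
    then have "homotopic X B pB czero"
      using homotopic_comp_right[OF A B X pv 3] by (simp add: zero_comp)
    from homotopic_comp_right[OF X B B iB this]
    have "homotopic B B (pB \<odot> iB) czero" by (simp add: zero_comp)
    moreover have "homotopic B B (cid B) (pB \<odot> iB)"
      by (rule homotopic_sym[OF B B cid_gmaps[OF B] 2])
    ultimately have "homotopic B B (cid B) czero"
      using homotopic_trans[OF B B gmaps_zero[OF B B]] by blast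
    then show ?thesis by (simp add: null_object_def)
  next
    fix n assume n: "cpow X e (Suc n) = czero"
    \<comment> \<open>The composite is the power of \<open>pA \<odot> iA\<close> with exponent
      \<open>m + 1\<close>.\<close>
    have "homotopic A A (pA \<odot> (cpow X e m \<odot> iA)) (cid A)" for m
    proof (induction m)
      case 0
      with 1 show ?case by (simp only: cpow.simps gmaps_id_left[OF A X chain_gmaps[OF iA]])
    next
      case (Suc m)
      have w: "pA \<odot> iA \<in> chain_maps A A" by (rule chain_comp[OF A X iA A pA])
      have "homotopic A A ((pA \<odot> iA) \<odot> (pA \<odot> (cpow X e m \<odot> iA))) ((pA \<odot> iA) \<odot> cid A)"
        by (rule homotopic_comp_left[OF A A A w cid_gmaps[OF A] Suc])
      then have "homotopic A A (pA \<odot> (cpow X e (Suc m) \<odot> iA)) (pA \<odot> iA)"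
        using gmaps_id_right[OF A A chain_gmaps[OF w]] by (simp add: e_def ccomp_assoc del: cpow.simps(1))
      then show ?case
        using homotopic_trans[OF A A cA(2) _ 1] by blast
    qed
    from this[of "Suc n"] have "homotopic A A czero (cid A)"
      by (simp only: n zero_comp gmaps_zero_right[OF X A chain_gmaps[OF pA]])
    then show ?thesis
      using homotopic_sym[OF A A cA(2)] by (simp add: null_object_def)
  qed
qed

text \<open>In degree \<open>p\<close> the contraction has no term that passes through degree
  \<open>p - 1\<close>, so the remaining term is a left inverse of the differential.\<close>

lemma contractible_split_mono:
  fixes X :: "('a::ring_1, 'm::zero) cpx"
  assumes X: "proj_complex X" and c: "null_object homotopic X" and z: "ob X (p - 1) = zero_mod"
  obtains mu where "mu \<in> mod_hom (ob X (p + 1)) (ob X p)" "mu \<circ> diff X p = id_mod (ob X p)"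
proof -
  obtain h where h: "h \<in> hmaps X X" "cid X = cadd X czero (hbd X X h)"
    using c unfolding null_object_def homotopic_iff by blast
  have hp: "h p x = 0" for x
    using hom_into_zero[of "h p" "ob X p"] hmaps_hom[OF h(1), of p] z by simp
  have "h (p + 1) (diff X p x) = x" if x: "x \<in> mcarrier (ob X p)" for x
    using fun_cong[OF fun_cong[OF h(2)], of p x] x hmaps_closed'[OF X X h(1), of p "diff X p x"]
    by (simp add: hbd_def hp hom_0[OF cpx_diff'[OF X] cpx_mod[OF X] cpx_mod[OF X]] rmod_simps[OF cpx_mod[OF X]])
  moreover have "h (p + 1) (diff X p x) = 0" if "x \<notin> mcarrier (ob X p)" for x
    using that by (simp add: hom_outside[OF cpx_diff[OF X]] hom_0[OF hmaps_hom'[OF h(1)] cpx_mod[OF X] cpx_mod[OF X]])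
  ultimately have "h (p + 1) \<circ> diff X p = id_mod (ob X p)"
    by (auto simp: fun_eq_iff id_mod_def)
  then show ?thesis using that hmaps_hom'[OF h(1)] by blast
qed

subsection \<open>Widths\<close>

text \<open>A complex that is not contractible is its own representative without contractible
  summands, so its width is a length bounded by \<open>n\<close>. A contractible one occupies at
  most two degrees. The conclusion is a dichotomy at \<open>m\<close> because
  \<open>band_splitting\<close> sorts summands by it.\<close>

lemma triv_idem_width:
  fixes scale :: "'k::field \<Rightarrow> 'a::ring_1 \<Rightarrow> 'a" and X :: "('a, 'm::zero) cpx"
  assumes alg: "fin_dim_algebra scale" and sgl: "strong_gl_dim TYPE('a) TYPE('m) = enat n"
    and n: "n \<ge> 1" and XC: "X \<in> CI lo hi" and t: "triv_idem X"
  shows "(\<forall>i\<le>m. ob X i = zero_mod) \<or> (\<forall>i>m + int n. ob X i = zero_mod)"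
proof (cases "null_object strict X")
  case True
  then show ?thesis using null_strict_iff[OF CI_proj_complex[OF XC]] by simp
next
  case False
  have X: "proj_complex X" using XC by (rule CI_proj_complex)
  define I where "I = {i. ob X i \<noteq> zero_mod}"
  have "I \<subseteq> {lo..hi}" using XC by (auto simp: I_def CI_def)
  then have fin: "finite I" using finite_subset by blast
  have ne: "I \<noteq> {}" using False null_strict_iff[OF X] by (auto simp: I_def)
  define p where "p = Min I"
  define s where "s = Max I"
  have ps: "ob X p \<noteq> zero_mod" "ob X s \<noteq> zero_mod"
    using Min_in[OF fin ne] Max_in[OF fin ne] by (simp_all add: p_def s_def I_def)
  have out: "ob X i = zero_mod" if "i < p \<or> s < i" for i
  proof (rule ccontr)
    assume "ob X i \<noteq> zero_mod"
    then have "i \<in> I" by (simp add: I_def)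
    with that show False
      using Min_le[OF fin, of i] Max_ge[OF fin, of i] by (simp add: p_def s_def)
  qed
  have "p \<le> s" unfolding p_def s_def using Min_le[OF fin Max_in[OF fin ne]] .
  have "s - p \<le> int n"
  proof (cases "null_object homotopic X")
    case True
    obtain mu where mu: "mu \<in> mod_hom (ob X (p + 1)) (ob X p)" "mu \<circ> diff X p = id_mod (ob X p)"
      using contractible_split_mono[OF X True] out[of "p - 1"] by auto
    obtain e where e: "e \<in> chain_maps X X" "e \<odot> e = e" "e p = id_mod (ob X p)"
      "\<And>i. i \<noteq> p \<Longrightarrow> i \<noteq> p + 1 \<Longrightarrow> e i = (\<lambda>_. 0)"
      using split_mono_idem[OF X mu] by blast
    have "e \<noteq> czero" by (rule cmap_neq_czero[of X e p, OF X e(3) ps(1)])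
    then have "e = cid X" using triv_idemD[OF t e(1,2)] by blast
    \<comment> \<open>The idempotent lives in degrees \<open>p\<close> and \<open>p + 1\<close>
      only, so the width is at most 1; this is where \<open>n \<ge> 1\<close> enters.\<close>
    then have "s = p \<or> s = p + 1"
      using e(4)[of s] ps(2) id_mod_zero_iff[OF cpx_mod[OF X], of s] by (force simp: cid_def)
    with n show ?thesis by auto
  next
    case nc: False
    have "indecomposable homotopic Cb X"
      unfolding indecomposable_def
      using triv_idem_homotopic_summand[OF alg XC t] CI_Cb[OF XC] nc
      by (auto simp: Cb_def)
    moreover have "has_length X (nat (s - p))"
      unfolding has_length_def
    proof (intro bexI[of _ X] conjI exI)
      have "cid X \<odot> cid X = cid X" by (rule gmaps_id_left[OF X X cid_gmaps[OF X]])
      then show "isomorphic homotopic X X"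
        unfolding isomorphic_def
        using chain_id[OF X] homotopic_refl[OF X X cid_gmaps[OF X]] by metis
      show "no_contractible_summand X"
        unfolding no_contractible_summand_def
      proof (intro ballI impI)
        fix A B :: "('a, 'm) cpx"
        assume "A \<in> Cb" "B \<in> Cb" and AB: "direct_sum strict X A B \<and> null_object homotopic A"
        then have A: "proj_complex A" and B: "proj_complex B" by (auto simp: Cb_def)
        show "null_object strict A"
        proof (rule ccontr)
          assume "\<not> null_object strict A"
          then have nB: "null_object strict B"
            using triv_idem_direct_sum[OF X A B t] AB by blast
          obtain iA iB pA pB where m: "iA \<in> chain_maps A X" "iB \<in> chain_maps B X" "pA \<in> chain_maps X A" "pB \<in> chain_maps X B"
            and eq: "cadd X (iA \<odot> pA) (iB \<odot> pB) = cid X"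
            using AB unfolding direct_sum_def strict_def by blast
          \<comment> \<open>As \<open>B\<close> is zero, the identity of \<open>X\<close> factors
            through the contractible \<open>A\<close>.\<close>
          have "pB = czero"
            using gmaps_id_left[OF X B chain_gmaps[OF m(4)]] nB by (simp add: null_object_def strict_def zero_comp)
          then have "cid X = iA \<odot> (cid A \<odot> pA)"
            using eq gmaps_id_left[OF X A chain_gmaps[OF m(3)]]
              cadd_zero_right[OF X X gmaps_comp[OF X A chain_gmaps[OF m(3)] X chain_gmaps[OF m(1)]]]
            by (simp add: gmaps_zero_right[OF B X chain_gmaps[OF m(2)]])
          moreover have "homotopic X X (iA \<odot> (cid A \<odot> pA)) (iA \<odot> (czero \<odot> pA))"
            using AB
            by (intro homotopic_comp_left[OF X A X m(1)] homotopic_comp_right[OF A A X m(3)])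
              (simp_all add: null_object_def zero_comp gmaps_zero[OF X A])
          ultimately have "null_object homotopic X"
            by (simp add: null_object_def zero_comp gmaps_zero_right[OF A X chain_gmaps[OF m(1)]])
          with nc show False ..
        qed
      qed
      show "int (nat (s - p)) = s - p" using \<open>p \<le> s\<close> by simp
    qed (use ps out CI_Cb[OF XC] in auto)
    ultimately have "enat (nat (s - p)) \<le> strong_gl_dim TYPE('a) TYPE('m)"
      unfolding strong_gl_dim_def by (intro Sup_upper) blast
    then show ?thesis by (simp add: sgl)
  qed
  then show ?thesis
    using out by (cases "m < p") auto
qed

text \<open>The decomposition of a bounded complex into one that vanishes above degree \<open>m + n\<close> and one that
  vanishes up to degree \<open>m\<close> is recorded by the idempotent onto the first.\<close>

definition band_splitting :: "('a::ring_1, 'm::zero) cpx itself \<Rightarrow> nat \<Rightarrow> bool" where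
  "band_splitting _ n \<longleftrightarrow> (\<forall>X::('a, 'm) cpx. X \<in> Cb \<longrightarrow> (\<forall>m. \<exists>e\<in>chain_maps X X. e \<odot> e = e \<and>
     (\<forall>i\<le>m. e i = id_mod (ob X i)) \<and> (\<forall>i>m + int n. \<forall>x. e i x = 0)))"

text \<open>In a decomposition into indecomposables each summand vanishes up to degree
  \<open>m\<close> or vanishes above \<open>m + n\<close>; the wanted idempotent collects summands
  of the second kind. Summands are represented by idempotents of \<open>X\<close>, and the induction
  runs over the total length of their images.\<close>

lemma band_splitting:
  fixes scale :: "'k::field \<Rightarrow> 'a::ring_1 \<Rightarrow> 'a"
  assumes alg: "fin_dim_algebra scale" and sgl: "strong_gl_dim TYPE('a) TYPE('m::zero) = enat n"
    and n: "n \<ge> 1"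
  shows "band_splitting TYPE(('a, 'm) cpx) n"
  unfolding band_splitting_def
proof (intro allI impI)
  fix X :: "('a, 'm) cpx" and m
  assume "X \<in> Cb"
  then obtain lo hi where XC: "X \<in> CI lo hi" by (rule Cb_CI)
  then have X: "proj_complex X" by (rule CI_proj_complex)
  note dg = chain_gmaps
  have "\<exists>mu :: 'm set \<Rightarrow> nat. \<forall>N N'. submod N (ob X i) \<longrightarrow> submod N' (ob X i) \<longrightarrow> N \<subset> N' \<longrightarrow> mu N < mu N'" for i
    by (rule finite_length[OF alg cpx_fg[OF X, of i]]) blast
  then obtain mu :: "int \<Rightarrow> 'm set \<Rightarrow> nat" where
    "\<forall>i N N'. submod N (ob X i) \<longrightarrow> submod N' (ob X i) \<longrightarrow> N \<subset> N' \<longrightarrow> mu i N < mu i N'"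
    using choice[of "\<lambda>i mu. \<forall>N N'. submod N (ob X i) \<longrightarrow> submod N' (ob X i) \<longrightarrow> N \<subset> N' \<longrightarrow> (mu N :: nat) < mu N'"] by blast
  then have mu: "mu i N < mu i N'" if "submod N (ob X i)" "submod N' (ob X i)" "N \<subset> N'" for i N N'
    using that by blast
  define Im where "Im e i = e i ` mcarrier (ob X i)" for e :: "'m cmap" and i
  define L where "L e = (\<Sum>i\<in>{lo..hi}. mu i (Im e i))" for e
  have sub: "submod (Im e i) (ob X i)" if "e \<in> chain_maps X X" for e i
    unfolding Im_def by (rule submod_image[OF chain_hom[OF that] cpx_mod[OF X] cpx_mod[OF X]])
  have L_less: "L a < L e"
    if a: "a \<in> chain_maps X X" and e: "e \<in> chain_maps X X"
      and ea: "e \<odot> a = a" and ae: "a \<odot> e = a" and aa: "a \<odot> a = a" and ne: "a \<noteq> e" for a e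
  proof -
    have le: "Im a i \<subseteq> Im e i" for i
    proof
      fix y assume "y \<in> Im a i"
      then obtain x where x: "x \<in> mcarrier (ob X i)" "y = a i x" by (auto simp: Im_def)
      then have "y = e i (a i x)" using ea by (metis ccomp_apply)
      then show "y \<in> Im e i" using x gmaps_in[OF dg[OF a]] by (auto simp: Im_def)
    qed
    have "\<exists>i. Im a i \<noteq> Im e i"
    proof (rule ccontr)
      assume "\<nexists>i. Im a i \<noteq> Im e i"
      then have eq: "Im e i = Im a i" for i by simp
      have "e = a"
      proof (rule gmaps_ext[OF dg[OF e] dg[OF a]])
        fix i x assume "x \<in> mcarrier (ob X i)"
        then have "e i x \<in> Im a i" using eq by (auto simp: Im_def)
        then obtain y where "e i x = a i y" by (auto simp: Im_def)
        then have "e i x = a i (e i x)" using aa by (metis ccomp_apply)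
        also have "\<dots> = a i x" using ae by (metis ccomp_apply)
        finally show "e i x = a i x" .
      qed
      with ne show False by simp
    qed
    then obtain i where i: "Im a i \<noteq> Im e i" by blast
    have "i \<in> {lo..hi}"
    proof (rule ccontr)
      assume "i \<notin> {lo..hi}"
      then have "mcarrier (ob X i) = {0}"
        using XC by (simp add: CI_def mcarrier_zero_mod)
      with i show False
        using gmaps_0[OF X X dg[OF a]] gmaps_0[OF X X dg[OF e]] by (simp add: Im_def)
    qed
    moreover have "mu j (Im a j) \<le> mu j (Im e j)" for j
      using mu[OF sub[OF a] sub[OF e], of j] le[of j] by (metis less_imp_le order_refl psubsetI)
    moreover have "mu i (Im a i) < mu i (Im e i)"
      using mu[OF sub[OF a] sub[OF e], of i] le[of i] i by (metis psubsetI)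
    ultimately show ?thesis
      unfolding L_def by (intro sum_strict_mono_ex1) auto
  qed
  \<comment> \<open>The claim is strengthened from the identity to an arbitrary idempotent
    \<open>e\<close>; the two equations with \<open>e\<close> keep the outcome \<open>a\<close>
    below \<open>e\<close>.\<close>
  have "\<exists>a\<in>chain_maps X X. a \<odot> a = a \<and> e \<odot> a = a \<and> a \<odot> e = a \<and>
      (\<forall>i\<le>m. \<forall>x. a i x = e i x) \<and> (\<forall>i>m + int n. \<forall>x. a i x = 0)"
    if "e \<in> chain_maps X X" "e \<odot> e = e" for e
    using that
  proof (induction "L e" arbitrary: e rule: less_induct)
    case less
    note IH = less.hyps
    note e = less.prems
    let ?V = "im_cpx e X"
    note V = im_cpx_proj_complex[OF X e] and VC = im_cpx_CI[OF X e XC]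
    note io = cincl_chain[OF X e] and pr = cproj_chain[OF X e]
    note pi = cproj_cincl[OF X e] and ip = cincl_cproj[OF X e]
    show ?case
    proof (cases "triv_idem ?V")
      case True
      have low: "e i x = 0" if "ob ?V i = zero_mod" for i x
        using gmaps_into_zero[OF dg[OF pr] that] .
      from triv_idem_width[OF alg sgl n VC True, of m] show ?thesis
      proof
        assume "\<forall>i\<le>m. ob ?V i = zero_mod"
        then show ?thesis
          using low chain_zero[OF X X] gmaps_zero_right[OF X X dg[OF e(1)]]
          by (intro bexI[of _ czero]) (simp_all add: zero_comp)
      next
        assume "\<forall>i>m + int n. ob ?V i = zero_mod"
        then show ?thesis
          using low e by (intro bexI[of _ e]) simp_all
      qed
    next
      case False
      then obtain d where d: "d \<in> chain_maps ?V ?V" "d \<odot> d = d" "d \<noteq> czero" "d \<noteq> cid ?V"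
        by (auto simp: triv_idem_def)
      \<comment> \<open>The idempotent \<open>d\<close> of the image, carried back to
        \<open>X\<close>, splits \<open>e\<close> into the orthogonal idempotents \<open>a\<close>
        and \<open>b\<close>, both with a smaller image.\<close>
      define a where "a = cincl e X \<odot> (d \<odot> e)"
      define b where "b = csub X e a"
      have a: "a \<in> chain_maps X X"
        unfolding a_def by (intro chain_comp[OF X V _ X io] chain_comp[OF X V pr V d(1)])
      have b: "b \<in> chain_maps X X"
        unfolding b_def by (rule chain_sub[OF X X e(1) a])
      have pa: "e \<odot> a = d \<odot> e"
      proof -
        have "e \<odot> a = (e \<odot> cincl e X) \<odot> (d \<odot> e)" by (simp only: a_def ccomp_assoc)
        also have "\<dots> = d \<odot> e"
          unfolding pi by (rule gmaps_id_left[OF X V dg[OF chain_comp[OF X V pr V d(1)]]])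
        finally show ?thesis .
      qed
      have "cincl e X \<odot> (e \<odot> a) = a" unfolding pa by (simp only: a_def)
      then have ea: "e \<odot> a = a" by (simp only: ccomp_assoc[symmetric] ip)
      have ae: "a \<odot> e = a" by (simp only: a_def ccomp_assoc e(2))
      have "a \<odot> a = cincl e X \<odot> (d \<odot> (e \<odot> a))" by (simp only: a_def ccomp_assoc)
      also have "\<dots> = cincl e X \<odot> ((d \<odot> d) \<odot> e)" unfolding pa by (simp only: ccomp_assoc)
      finally have aa: "a \<odot> a = a" by (simp only: d(2) a_def)
      have dpi: "d = e \<odot> (a \<odot> cincl e X)"
      proof -
        have "e \<odot> (a \<odot> cincl e X) = d \<odot> (e \<odot> cincl e X)" by (simp only: ccomp_assoc[symmetric] pa)
        also have "\<dots> = d" unfolding pi by (rule gmaps_id_right[OF V V dg[OF d(1)]])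
        finally show ?thesis by simp
      qed
      have a0: "a \<noteq> czero"
        using dpi d(3) gmaps_zero_right[OF X V dg[OF pr]] by (auto simp: zero_comp)
      have a1: "a \<noteq> e"
      proof
        assume "a = e"
        then have "d = (e \<odot> e) \<odot> cincl e X" using dpi by (simp only: ccomp_assoc)
        with d(4) show False by (simp add: e(2) pi)
      qed
      have eb: "e \<odot> b = b"
        unfolding b_def by (simp add: comp_csub[OF X X dg[OF e(1)] dg[OF a] dg[OF e(1)]] e(2) ea)
      have be: "b \<odot> e = b"
        unfolding b_def by (simp add: csub_comp e(2) ae)
      have ab: "a \<odot> b = czero"
        unfolding b_def by (simp add: comp_csub[OF X X dg[OF e(1)] dg[OF a] dg[OF a]] aa ae csub_self[OF X X dg[OF a]])
      have ba: "b \<odot> a = czero"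
        unfolding b_def by (simp add: csub_comp aa ea csub_self[OF X X dg[OF a]])
      have bb: "b \<odot> b = b"
        by (subst (1) b_def) (simp add: csub_comp eb ab csub_zero[OF X X dg[OF b]])
      have b1: "b \<noteq> e"
        using csub_eq_left[OF X X dg[OF e(1)] dg[OF a]] a0 by (auto simp: b_def)
      obtain a' where a': "a' \<in> chain_maps X X" "a' \<odot> a' = a'" "a \<odot> a' = a'" "a' \<odot> a = a'"
        "\<forall>i\<le>m. \<forall>x. a' i x = a i x" "\<forall>i>m + int n. \<forall>x. a' i x = 0"
        using IH[OF L_less[OF a e(1) ea ae aa a1] a aa] by blast
      obtain b' where b': "b' \<in> chain_maps X X" "b' \<odot> b' = b'" "b \<odot> b' = b'" "b' \<odot> b = b'"
        "\<forall>i\<le>m. \<forall>x. b' i x = b i x" "\<forall>i>m + int n. \<forall>x. b' i x = 0"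
        using IH[OF L_less[OF b e(1) eb be bb b1] b bb] by blast
      note g' = dg[OF a'(1)] dg[OF b'(1)]
      have a'b': "a' \<odot> b' = czero"
      proof -
        have "a' \<odot> b' = (a' \<odot> a) \<odot> (b \<odot> b')" by (simp only: a' b')
        also have "\<dots> = a' \<odot> ((a \<odot> b) \<odot> b')" by (simp only: ccomp_assoc)
        finally show ?thesis by (simp add: ab zero_comp gmaps_zero_right[OF X X g'(1)])
      qed
      have b'a': "b' \<odot> a' = czero"
      proof -
        have "b' \<odot> a' = (b' \<odot> b) \<odot> (a \<odot> a')" by (simp only: a' b')
        also have "\<dots> = b' \<odot> ((b \<odot> a) \<odot> a')" by (simp only: ccomp_assoc)
        finally show ?thesis by (simp add: ba zero_comp gmaps_zero_right[OF X X g'(2)])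
      qed
      have ea': "e \<odot> a' = a'" "a' \<odot> e = a'"
        using ccomp_assoc[of e a a'] ccomp_assoc[of a' a e] by (simp_all add: a'(3,4) ea ae)
      have eb': "e \<odot> b' = b'" "b' \<odot> e = b'"
        using ccomp_assoc[of e b b'] ccomp_assoc[of b' b e] by (simp_all add: b'(3,4) eb be)
      \<comment> \<open>\<open>a'\<close> and \<open>b'\<close> lie below the orthogonal
        \<open>a\<close> and \<open>b\<close>, hence are orthogonal, and their sum is again
        idempotent.\<close>
      define c where "c = cadd X a' b'"
      have c: "c \<in> chain_maps X X"
        unfolding c_def by (rule chain_add[OF X X a'(1) b'(1)])
      have "a' \<odot> c = a'" "b' \<odot> c = b'"
        unfolding c_def
        by (simp_all add: comp_cadd[OF X X g' g'(1)] comp_cadd[OF X X g' g'(2)] a'(2) b'(2) a'b' b'a'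
            cadd_zero_left[OF X X g'(2)] cadd_zero_right[OF X X g'(1)])
      then have "c \<odot> c = c"
        by (subst (1) c_def) (simp add: cadd_comp, simp add: c_def)
      moreover have "e \<odot> c = c"
        unfolding c_def by (simp add: comp_cadd[OF X X g' dg[OF e(1)]] ea' eb')
      moreover have "c \<odot> e = c"
        unfolding c_def by (simp add: cadd_comp ea' eb')
      moreover have "c i x = e i x" if "i \<le> m" for i x
      proof -
        have "c i x = cadd X a b i x"
          using that a'(5) b'(5) by (simp add: c_def)
        then show ?thesis
          using cadd_csub[OF X X dg[OF e(1)] dg[OF a]] by (simp only: b_def)
      qed
      moreover have "c i x = 0" if "i > m + int n" for i x
        using that a'(6) b'(6) rmod_simps[OF cpx_mod[OF X]] by (simp add: c_def)
      ultimately show ?thesis using c by blast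
    qed
  qed
  from this[OF chain_id[OF X] gmaps_id_left[OF X X cid_gmaps[OF X]]]
  obtain a where a: "a \<in> chain_maps X X" "a \<odot> a = a" "\<forall>i\<le>m. \<forall>x. a i x = cid X i x" "\<forall>i>m + int n. \<forall>x. a i x = 0"
    by blast
  then show "\<exists>e\<in>chain_maps X X. e \<odot> e = e \<and>
     (\<forall>i\<le>m. e i = id_mod (ob X i)) \<and> (\<forall>i>m + int n. \<forall>x. e i x = 0)"
    by (intro bexI[of _ a]) (auto simp: cid_def fun_eq_iff)
qed

text \<open>Without this the simplifier turns the degree \<open>i + 1 + 1\<close> into \<open>2 + i\<close>, and facts about
  differentials no longer match.\<close>

declare [[simproc del: int_combine_numerals]]

subsection \<open>Truncations and shifts\<close>

text \<open>Brutal truncations. \<open>trunc_ge\<close> is a subcomplex and \<open>trunc_le\<close>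
  a quotient complex; this decides which maps pass to the truncation freely and which meet an
  obstruction at the cut.\<close>

definition trunc_ge :: "int \<Rightarrow> ('a::ring_1, 'm::zero) cpx \<Rightarrow> ('a, 'm) cpx" where
  "trunc_ge p X = \<lparr>ob = (\<lambda>i. if p \<le> i then ob X i else zero_mod),
     diff = (\<lambda>i. if p \<le> i then diff X i else (\<lambda>_. 0))\<rparr>"

definition trunc_le :: "int \<Rightarrow> ('a::ring_1, 'm::zero) cpx \<Rightarrow> ('a, 'm) cpx" where
  "trunc_le p X = \<lparr>ob = (\<lambda>i. if i \<le> p then ob X i else zero_mod),
     diff = (\<lambda>i. if i < p then diff X i else (\<lambda>_. 0))\<rparr>"

text \<open>The shift that enters mapping cones, hence the sign.\<close>

definition shift1 :: "('a::ring_1, 'm::zero) cpx \<Rightarrow> ('a, 'm) cpx" where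
  "shift1 X = \<lparr>ob = (\<lambda>i. ob X (i + 1)),
     diff = (\<lambda>i x. mact (ob X (i + 1 + 1)) (diff X (i + 1) x) (- 1))\<rparr>"

lemma ob_trunc_ge: "ob (trunc_ge p X) i = (if p \<le> i then ob X i else zero_mod)"
  by (simp add: trunc_ge_def)

lemma diff_trunc_ge: "diff (trunc_ge p X) i = (if p \<le> i then diff X i else (\<lambda>_. 0))"
  by (simp add: trunc_ge_def)

lemma ob_trunc_le: "ob (trunc_le p X) i = (if i \<le> p then ob X i else zero_mod)"
  by (simp add: trunc_le_def)

lemma diff_trunc_le: "diff (trunc_le p X) i = (if i < p then diff X i else (\<lambda>_. 0))"
  by (simp add: trunc_le_def)

lemma ob_shift1: "ob (shift1 X) i = ob X (i + 1)"
  by (simp add: shift1_def)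

lemma diff_shift1: "diff (shift1 X) i x = mact (ob X (i + 1 + 1)) (diff X (i + 1) x) (- 1)"
  by (simp add: shift1_def)

lemma proj_complex_trunc_ge: "proj_complex X \<Longrightarrow> proj_complex (trunc_ge p X)"
  by (rule proj_complexI)
    (auto simp: ob_trunc_ge diff_trunc_ge cpx_fg fg_proj_zero_mod cpx_diff zero_hom cpx_mod
      right_module_zero_mod cpx_dd mcarrier_zero_mod hom_0[OF cpx_diff])

lemma proj_complex_trunc_le: "proj_complex X \<Longrightarrow> proj_complex (trunc_le p X)"
  by (rule proj_complexI)
    (auto simp: ob_trunc_le diff_trunc_le cpx_fg fg_proj_zero_mod cpx_diff zero_hom cpx_mod
      right_module_zero_mod cpx_dd)

lemma proj_complex_shift1:
  assumes X: "proj_complex X"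
  shows "proj_complex (shift1 X)"
proof (rule proj_complexI)
  show "fg_proj (ob (shift1 X) i)" for i by (simp add: ob_shift1 cpx_fg[OF X])
  show "diff (shift1 X) i \<in> mod_hom (ob (shift1 X) i) (ob (shift1 X) (i + 1))" for i
    using hom_neg_in[OF cpx_diff[OF X] cpx_mod[OF X]] by (simp add: shift1_def)
  show "diff (shift1 X) (i + 1) (diff (shift1 X) i x) = 0" if "x \<in> mcarrier (ob (shift1 X) i)" for i x
    using that
    by (simp add: shift1_def hom_mact[OF cpx_diff[OF X]] hom_in[OF cpx_diff[OF X]] cpx_dd[OF X]
        mact_0_left[OF cpx_mod[OF X]])
qed

subsection \<open>Twisted direct sums\<close>

context pairing
begin

lemma dsum_zero: "dsum zero_mod zero_mod = (zero_mod :: ('a::ring_1, 'm) rmod)"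
  using zero_mod_iff[OF right_module_dsum[OF right_module_zero_mod right_module_zero_mod]]
  by (simp add: dsum_carrier mcarrier_zero_mod)

text \<open>A degreewise split extension of \<open>B\<close> by \<open>A\<close>, given by its
  connecting map \<open>t\<close> of degree 1. The mapping cone of \<open>f\<close> is the case
  \<open>A = Y\<close>, \<open>B = shift1 X\<close>.\<close>

definition twist :: "('a::ring_1, 'm) cpx \<Rightarrow> ('a, 'm) cpx \<Rightarrow> 'm cmap \<Rightarrow> ('a, 'm) cpx" where
  "twist A B t = \<lparr>ob = (\<lambda>i. dsum (ob A i) (ob B i)),
     diff = (\<lambda>i. dlift (ob A i) (ob B i) (\<lambda>a b. pr (madd (ob A (i + 1)) (diff A i a) (t i b)) (diff B i b)))\<rparr>"

lemma ob_twist: "ob (twist A B t) i = dsum (ob A i) (ob B i)"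
  by (simp add: twist_def)

lemma diff_twist:
  "a \<in> mcarrier (ob A i) \<Longrightarrow> b \<in> mcarrier (ob B i) \<Longrightarrow>
     diff (twist A B t) i (pr a b) = pr (madd (ob A (i + 1)) (diff A i a) (t i b)) (diff B i b)"
  by (simp add: twist_def)

lemma proj_complex_twist:
  fixes A B :: "('a::ring_1, 'm) cpx"
  assumes A: "proj_complex A" and B: "proj_complex B"
    and t: "\<And>i. t i \<in> mod_hom (ob B i) (ob A (i + 1))"
    and c: "\<And>i b. b \<in> mcarrier (ob B i) \<Longrightarrow>
       madd (ob A (i + 1 + 1)) (diff A (i + 1) (t i b)) (t (i + 1) (diff B i b)) = 0"
  shows "proj_complex (twist A B t)"
proof (rule proj_complexI)
  note rA = rmod_simps[OF cpx_mod[OF A]] and rB = rmod_simps[OF cpx_mod[OF B]]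
  note dA = cpx_diff[OF A] and dB = cpx_diff[OF B]
  show "fg_proj (ob (twist A B t) i)" for i
    by (simp add: ob_twist fg_proj_dsum cpx_fg A B)
  show "diff (twist A B t) i \<in> mod_hom (ob (twist A B t) i) (ob (twist A B t) (i + 1))" for i
    unfolding twist_def
    by (simp, rule dlift_hom)
      (simp_all add: cpx_mod A B rA rB hom_in[OF dA] hom_in[OF dB] hom_in[OF t] hom_madd[OF dA] hom_madd[OF dB]
        hom_madd[OF t] hom_mact[OF dA] hom_mact[OF dB] hom_mact[OF t] madd_ac[OF cpx_mod[OF A]])
  show "diff (twist A B t) (i + 1) (diff (twist A B t) i x) = 0" if x: "x \<in> mcarrier (ob (twist A B t) i)" for i x
  proof -
    obtain a b where ab: "x = pr a b" "a \<in> mcarrier (ob A i)" "b \<in> mcarrier (ob B i)"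
      using x unfolding ob_twist by (rule dsum_cases)
    have "madd (ob A (i + 1 + 1)) (diff A (i + 1) (madd (ob A (i + 1)) (diff A i a) (t i b))) (t (i + 1) (diff B i b)) = 0"
      using ab(2,3) c[of b i]
      by (simp add: hom_madd[OF dA] hom_in[OF dA] hom_in[OF t] cpx_dd[OF A] rA)
    with ab show ?thesis
      by (simp add: diff_twist rA hom_in[OF dA] hom_in[OF dB] hom_in[OF t] cpx_dd[OF B])
  qed
qed

text \<open>The complex \<open>W\<close> glues \<open>X\<close> in degrees above \<open>p\<close> to the mapping cone \<open>C\<close> of \<open>f\<close> in degrees from
  \<open>p\<close> on, along the idempotent \<open>e\<close> of \<open>C\<close> followed by the projection of \<open>C\<close> to the shift of \<open>X\<close>.
  Its class is the pullback along \<open>e\<close> of the triangle of \<open>f\<close>, so \<open>f\<close> factors through it; where \<open>e\<close>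
  vanishes, only \<open>f\<close> contributes to the second factor.\<close>

lemma cone_factorization:
  fixes X Y :: "('a::ring_1, 'm) cpx"
  assumes band: "band_splitting TYPE(('a, 'm) cpx) n"
    and XC: "X \<in> CI lo hi" and YC: "Y \<in> CI lo hi" and f: "f \<in> chain_maps X Y"
    and lo: "lo \<le> p" and X0: "\<And>i. i < p \<Longrightarrow> ob X i = zero_mod" and Y0: "\<And>i. i \<le> p \<Longrightarrow> ob Y i = zero_mod"
  shows "\<exists>W\<in>CI lo hi. \<exists>k\<in>chain_maps X W. \<exists>h\<in>chain_maps W Y. f = h \<odot> k \<and>
    (\<forall>i\<ge>p + int n. \<forall>w\<in>mcarrier (ob W i). \<exists>x\<in>mcarrier (ob X i). h i w = f i x) \<and>
    (\<forall>r\<in>mod_hom (ob W p) (ob X p). r \<circ> k p = id_mod (ob X p) \<longrightarrow>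
       (\<exists>e\<in>chain_maps X X. e \<odot> e = e \<and> e p = id_mod (ob X p) \<and> f \<odot> e = czero))"
proof -
  have X: "proj_complex X" and Y: "proj_complex Y"
    using XC YC by (simp_all add: CI_proj_complex)
  note rX = cpx_mod[OF X] and rY = cpx_mod[OF Y]
  note sX = rmod_simps[OF rX] and sY = rmod_simps[OF rY]
  note dX = cpx_diff[OF X] and dY = cpx_diff[OF Y] and fh = chain_hom[OF f]
  note dX0 = hom_0[OF dX rX rX] and dY0 = hom_0[OF dY rY rY] and f0 = hom_0[OF fh rX rY]
  have fp: "f p x = 0" for x
    using gmaps_into_zero[OF chain_gmaps[OF f]] Y0 by simp
  define C where "C = twist Y (shift1 X) (\<lambda>i. f (i + 1))"
  have C: "proj_complex C"
    unfolding C_def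
  proof (rule proj_complex_twist[OF Y proj_complex_shift1[OF X]])
    show "f (i + 1) \<in> mod_hom (ob (shift1 X) i) (ob Y (i + 1))" for i
      by (simp add: ob_shift1 fh)
    show "madd (ob Y (i + 1 + 1)) (diff Y (i + 1) (f (i + 1) b)) (f (i + 1 + 1) (diff (shift1 X) i b)) = 0"
      if "b \<in> mcarrier (ob (shift1 X) i)" for i b
      using that
      by (simp add: ob_shift1 diff_shift1 hom_mact[OF fh] hom_in[OF dX] hom_in[OF fh] chain_comm[OF f] sY)
  qed
  note rC = cpx_mod[OF C]
  note sC = rmod_simps[OF rC] and dC = cpx_diff[OF C]
  note dC0 = hom_0[OF dC rC rC]
  have obC: "ob C i = dsum (ob Y i) (ob X (i + 1))" for i
    by (simp add: C_def ob_twist ob_shift1)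
  have diffC: "diff C i (pr y x) = pr (madd (ob Y (i + 1)) (diff Y i y) (f (i + 1) x))
      (mact (ob X (i + 1 + 1)) (diff X (i + 1) x) (- 1))"
    if "y \<in> mcarrier (ob Y i)" "x \<in> mcarrier (ob X (i + 1))" for i y x
    using that by (simp add: C_def diff_twist ob_shift1 diff_shift1)
  have "C \<in> CI (lo - 1) hi"
    using C CI_zero[OF XC] CI_zero[OF YC] by (auto simp: CI_def obC dsum_zero)
  then have "C \<in> Cb" by (rule CI_Cb)
  \<comment> \<open>The cut at \<open>p - 1\<close> makes \<open>e\<close> vanish from degree
    \<open>p + n\<close> on, not only above it. Degree \<open>p - 1\<close> of the cone consists of
    the lowest term of \<open>X\<close>, and \<open>e\<close> is the identity there.\<close>
  then obtain e where e: "e \<in> chain_maps C C" "\<forall>i\<le>p - 1. e i = id_mod (ob C i)"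
    "\<forall>i>p - 1 + int n. \<forall>x. e i x = 0"
    using band unfolding band_splitting_def by blast
  note eh = chain_hom[OF e(1)]
  note e0 = hom_0[OF eh rC rC]
  \<comment> \<open>So \<open>e\<close> fixes everything that comes from the lowest term of
    \<open>X\<close>; \<open>k\<close> needs this to commute with the differentials in degree
    \<open>p\<close>.\<close>
  have ed: "e p (diff C (p - 1) c) = diff C (p - 1) c" if "c \<in> mcarrier (ob C (p - 1))" for c
    using chain_comm'[OF e(1), of p c] e(2) that by (simp add: id_mod_def)
  define s where "s i = dlift (ob Y i) (ob X (i + 1)) (\<lambda>y x. x)" for i
  define q where "q i = dlift (ob Y i) (ob X (i + 1)) (\<lambda>y x. y)" for i
  have s: "s i \<in> mod_hom (ob C i) (ob X (i + 1))" for i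
    unfolding s_def obC by (rule dlift_hom) (simp_all add: rX rY)
  have q: "q i \<in> mod_hom (ob C i) (ob Y i)" for i
    unfolding q_def obC by (rule dlift_hom) (simp_all add: rX rY)
  have sq: "s i (pr y x) = x" "q i (pr y x) = y" if "y \<in> mcarrier (ob Y i)" "x \<in> mcarrier (ob X (i + 1))" for i y x
    using that by (simp_all add: s_def q_def)
  have sd: "s (i + 1) (diff C i c) = mact (ob X (i + 1 + 1)) (diff X (i + 1) (s i c)) (- 1)"
    and qd: "q (i + 1) (diff C i c) = madd (ob Y (i + 1)) (diff Y i (q i c)) (f (i + 1) (s i c))"
    if "c \<in> mcarrier (ob C i)" for i c
    using that unfolding obC
    by (auto elim!: dsum_cases simp: diffC sq sX sY hom_in[OF dX] hom_in[OF dY] hom_in[OF fh])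
  note sh = hom_in[OF s] and qh = hom_in[OF q] and s0 = hom_0[OF s rC rX] and q0 = hom_0[OF q rC rY]
  \<comment> \<open>Without truncation the extension would contain the lowest term of
    \<open>X\<close> twice, in \<open>C\<close> at degree \<open>p - 1\<close> and in
    \<open>X\<close> at degree \<open>p\<close>, joined by the identity. Dropping this contractible
    pair keeps \<open>W\<close> between \<open>lo\<close> and \<open>hi\<close>.\<close>
  define A where "A = trunc_ge (p + 1) X"
  define B where "B = trunc_ge p C"
  have A: "proj_complex A" and B: "proj_complex B"
    by (simp_all add: A_def B_def proj_complex_trunc_ge X C)
  define t where "t i = (if p \<le> i then s i \<circ> e i else (\<lambda>_. 0))" for i
  define W where "W = twist A B t"
  have th: "t i \<in> mod_hom (ob B i) (ob A (i + 1))" for i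
    using hom_comp[OF eh s rC rX]
    by (simp add: t_def A_def B_def ob_trunc_ge zero_hom[OF right_module_zero_mod])
  have W: "proj_complex W"
    unfolding W_def
  proof (rule proj_complex_twist[OF A B th])
    show "madd (ob A (i + 1 + 1)) (diff A (i + 1) (t i b)) (t (i + 1) (diff B i b)) = 0"
      if b: "b \<in> mcarrier (ob B i)" for i b
    proof (cases "p \<le> i")
      case True
      with b have b': "b \<in> mcarrier (ob C i)" by (simp add: B_def ob_trunc_ge)
      have "s (i + 1) (e (i + 1) (diff C i b)) = mact (ob X (i + 1 + 1)) (diff X (i + 1) (s i (e i b))) (- 1)"
        using b' by (simp add: chain_comm[OF e(1), symmetric] sd hom_in[OF eh])
      with True b' show ?thesis
        by (simp add: A_def B_def ob_trunc_ge diff_trunc_ge t_def sX hom_in[OF dX] sh hom_in[OF eh])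
    next
      case False
      with b have "b = 0" by (simp add: B_def ob_trunc_ge mcarrier_zero_mod)
      then show ?thesis
        using hom_0[OF th cpx_mod[OF B] cpx_mod[OF A]] hom_0[OF cpx_diff[OF A] cpx_mod[OF A] cpx_mod[OF A]]
          hom_0[OF cpx_diff[OF B] cpx_mod[OF B] cpx_mod[OF B]] rmod_simps[OF cpx_mod[OF A]] by simp
    qed
  qed
  have obW: "ob W i = dsum (ob A i) (ob B i)" for i
    by (simp add: W_def ob_twist)
  note rW = cpx_mod[OF W]
  have diffW: "diff W i (pr x c) = pr (madd (ob X (i + 1)) (diff X i x) (s i (e i c))) (diff C i c)"
    if "x \<in> mcarrier (ob A i)" "c \<in> mcarrier (ob B i)" "p \<le> i" for i x c
    using that
    by (cases "i = p") (auto simp: W_def diff_twist A_def B_def ob_trunc_ge diff_trunc_ge t_def mcarrier_zero_mod dX0)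
  have AX: "x \<in> mcarrier (ob X i)" if "x \<in> mcarrier (ob A i)" for i x
    using that sX(1) by (auto simp: A_def ob_trunc_ge mcarrier_zero_mod split: if_splits)
  have BC: "c \<in> mcarrier (ob C i)" if "c \<in> mcarrier (ob B i)" for i c
    using that sC(1) by (auto simp: B_def ob_trunc_ge mcarrier_zero_mod split: if_splits)
  have Wz: "ob W i = zero_mod" if "i < p" for i
    using that by (simp add: obW A_def B_def ob_trunc_ge dsum_zero)
  have WC: "W \<in> CI lo hi"
    unfolding CI_def
  proof (intro CollectI conjI allI impI)
    fix i assume i: "i \<notin> {lo..hi}"
    show "ob W i = zero_mod"
    proof (cases "i < p")
      case False
      with i lo have "i > hi" by simp
      then show ?thesis
        using CI_zero[OF XC] CI_zero[OF YC] by (simp add: obW A_def B_def ob_trunc_ge obC dsum_zero)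
    qed (rule Wz)
  qed (rule W)
  \<comment> \<open>By \<open>qd\<close>, the projection \<open>q\<close> is a homotopy that kills
    \<open>f\<close> after \<open>s\<close>; the second summand uses it to turn \<open>f\<close>
    into a chain map on the extension.\<close>
  define h where "h i = dlift (ob A i) (ob B i)
      (\<lambda>x c. madd (ob Y i) (f i x) (mact (ob Y i) (q i (e i c)) (- 1)))" for i
  have h_pr: "h i (pr x c) = madd (ob Y i) (f i x) (mact (ob Y i) (q i (e i c)) (- 1))"
    if "x \<in> mcarrier (ob A i)" "c \<in> mcarrier (ob B i)" for i x c
    using that by (simp add: h_def)
  have mAX: "madd (ob A i) x y = madd (ob X i) x y" "mact (ob A i) x a = mact (ob X i) x a"
    if "x \<in> mcarrier (ob A i)" "y \<in> mcarrier (ob A i)" for i x y a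
    using that by (auto simp: A_def ob_trunc_ge mcarrier_zero_mod zero_mod_def sX split: if_splits)
  have mBC: "madd (ob B i) x y = madd (ob C i) x y" "mact (ob B i) x a = mact (ob C i) x a"
    if "x \<in> mcarrier (ob B i)" "y \<in> mcarrier (ob B i)" for i x y a
    using that by (auto simp: B_def ob_trunc_ge mcarrier_zero_mod zero_mod_def sC split: if_splits)
  have qeh: "(\<lambda>c. mact (ob Y i) (q i (e i c)) (- 1)) \<in> mod_hom (ob C i) (ob Y i)" for i
    using hom_neg_in[OF hom_comp[OF eh q rC rY] rY] by (simp add: comp_def)
  have hh: "h i \<in> mod_hom (ob W i) (ob Y i)" for i
    unfolding h_def obW
    by (rule dlift_hom)
      (simp_all add: cpx_mod A B mAX mBC AX BC hom_madd[OF fh] hom_mact[OF fh] hom_in[OF fh] sY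
        hom_madd[OF qeh, simplified] hom_mact[OF qeh, simplified] hom_in[OF qeh, simplified] qh hom_in[OF eh]
        madd_ac[OF rY])
  have h: "h \<in> chain_maps W Y"
  proof (rule chain_mapsI[OF W Y hh])
    fix i w assume w: "w \<in> mcarrier (ob W i)"
    show "diff Y i (h i w) = h (i + 1) (diff W i w)"
    proof (cases "p \<le> i")
      case True
      obtain x c where xc: "w = pr x c" "x \<in> mcarrier (ob A i)" "c \<in> mcarrier (ob B i)"
        using w unfolding obW by (rule dsum_cases)
      note x = AX[OF xc(2)] and c = BC[OF xc(3)]
      have ec: "e i c \<in> mcarrier (ob C i)" using hom_in[OF eh c] .
      have 1: "madd (ob X (i + 1)) (diff X i x) (s i (e i c)) \<in> mcarrier (ob A (i + 1))"
        using True x ec by (simp add: A_def ob_trunc_ge sX hom_in[OF dX] sh)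
      have 2: "diff C i c \<in> mcarrier (ob B (i + 1))"
        using True c by (simp add: B_def ob_trunc_ge hom_in[OF dC])
      note m = qh[OF ec] sh[OF ec] hom_in[OF dX x] hom_in[OF fh x] hom_in[OF fh hom_in[OF dX x]]
        hom_in[OF fh sh[OF ec]] hom_in[OF dY qh[OF ec]]
      have "h (i + 1) (diff W i w) = madd (ob Y (i + 1))
          (madd (ob Y (i + 1)) (f (i + 1) (diff X i x)) (f (i + 1) (s i (e i c))))
          (madd (ob Y (i + 1)) (mact (ob Y (i + 1)) (diff Y i (q i (e i c))) (- 1))
             (mact (ob Y (i + 1)) (f (i + 1) (s i (e i c))) (- 1)))"
        using True xc m ec
        by (simp add: diffW h_pr[OF 1 2] chain_comm[OF e(1), symmetric] qd hom_madd[OF fh] sY)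
      also have "\<dots> = madd (ob Y (i + 1)) (f (i + 1) (diff X i x)) (mact (ob Y (i + 1)) (diff Y i (q i (e i c))) (- 1))"
        using m by (simp add: madd_assoc[OF rY] sY madd_left_comm[OF rY, of "f (i + 1) (s i (e i c))"]
            madd_comm[OF rY, of _ _ "mact (ob Y (i + 1)) (f (i + 1) (s i (e i c))) (- 1)"])
      also have "\<dots> = diff Y i (h i w)"
        using xc m by (simp add: h_pr hom_madd[OF dY] hom_mact[OF dY] sY chain_comm[OF f])
      finally show ?thesis by simp
    next
      case False
      with w have "w = 0" using Wz by (simp add: mcarrier_zero_mod)
      then show ?thesis
        using hom_0[OF hh rW rY] dY0 hom_0[OF cpx_diff[OF W] rW rW] by simp
    qed
  qed
  \<comment> \<open>In degree \<open>p\<close>, where the copy of \<open>X\<close> was dropped,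
    \<open>x\<close> is represented modulo the dropped pair by the copy of its differential in the
    cone.\<close>
  define k where "k i = (if i < p then (\<lambda>_. 0)
      else if i = p then ((\<lambda>c. pr 0 c) \<circ> id_mod (ob C p)) \<circ> (((\<lambda>x. pr 0 x) \<circ> id_mod (ob X (p + 1))) \<circ> diff X p)
      else (\<lambda>x. pr x 0) \<circ> id_mod (ob X i))" for i
  have j1: "(\<lambda>x. pr 0 x) \<circ> id_mod (ob X (p + 1)) \<in> mod_hom (ob X (p + 1)) (ob C p)"
    unfolding obC by (rule inj2_hom[OF rY rX])
  have Wp: "ob W p = dsum zero_mod (ob C p)"
    by (simp add: obW A_def B_def ob_trunc_ge)
  have j2: "(\<lambda>c. pr 0 c) \<circ> id_mod (ob C p) \<in> mod_hom (ob C p) (ob W p)"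
    unfolding Wp by (rule inj2_hom[OF right_module_zero_mod rC])
  have kh: "k i \<in> mod_hom (ob X i) (ob W i)" for i
  proof -
    consider "i < p" | "i = p" | "p < i" by linarith
    then show ?thesis
    proof cases
      case 1 then show ?thesis by (simp add: k_def zero_hom rW)
    next
      case 2
      then show ?thesis
        using hom_comp[OF hom_comp[OF dX j1 rX rC] j2 rC rW] by (simp add: k_def)
    next
      case 3
      then show ?thesis
        using inj1_hom[OF rX rC] by (simp add: k_def obW A_def B_def ob_trunc_ge)
    qed
  qed
  have kp: "k p x = pr 0 (pr 0 (diff X p x))" if "x \<in> mcarrier (ob X p)" for x
    using that by (simp add: k_def id_mod_def hom_in[OF dX] obC sY)
  have ki: "k i x = pr x 0" if "x \<in> mcarrier (ob X i)" "p < i" for i x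
    using that by (simp add: k_def id_mod_def)
  have k: "k \<in> chain_maps X W"
  proof (rule chain_mapsI[OF X W kh])
    fix i x assume x: "x \<in> mcarrier (ob X i)"
    consider "i < p" | "i = p" | "p < i" by linarith
    then show "diff W i (k i x) = k (i + 1) (diff X i x)"
    proof cases
      case 1
      with x have "x = 0" using X0 by (simp add: mcarrier_zero_mod)
      then show ?thesis
        using hom_0[OF kh rX rW] dX0 hom_0[OF cpx_diff[OF W] rW rW] by simp
    next
      case 2
      with x have xp: "x \<in> mcarrier (ob X p)" by simp
      let ?x = "mact (ob X p) x (- 1)"
      have dx: "diff X p x \<in> mcarrier (ob X (p + 1))" using hom_in[OF dX xp] .
      have "pr 0 ?x \<in> mcarrier (ob C (p - 1))"
        using xp by (simp add: obC sX sY)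
      from ed[OF this] have "e p (pr 0 (diff X p x)) = pr 0 (diff X p x)"
        using xp dx diffC[of 0 "p - 1" ?x]
        by (simp add: sX sY dY0 fp hom_mact[OF dX])
      moreover have "diff C p (pr 0 (diff X p x)) = 0"
        using diffC[of 0 p "diff X p x"] dx chain_comm[OF f, of p x]
        by (simp add: sX sY dY0 fp cpx_dd[OF X])
      ultimately show ?thesis
        using 2 xp dx
        by (simp add: kp ki diffW A_def B_def ob_trunc_ge mcarrier_zero_mod obC sY dX0 sq sX)
    next
      case 3
      with x show ?thesis
        by (simp add: ki hom_in[OF dX] diffW A_def B_def ob_trunc_ge sC e0 s0 dC0 sX)
    qed
  qed
  have "f = h \<odot> k"
  proof (rule gmaps_ext[OF chain_gmaps[OF f] gmaps_comp[OF X W chain_gmaps[OF k] Y chain_gmaps[OF h]]])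
    fix i x assume x: "x \<in> mcarrier (ob X i)"
    show "f i x = (h \<odot> k) i x"
    proof (cases "p < i")
      case True
      with x show ?thesis
        by (simp add: ki h_pr A_def B_def ob_trunc_ge sC e0 q0 sY hom_in[OF fh])
    next
      case False
      then show ?thesis
        using gmaps_into_zero[OF chain_gmaps[OF f], of i] gmaps_into_zero[OF chain_gmaps[OF h], of i] Y0[of i]
        by simp
    qed
  qed
  \<comment> \<open>In these degrees \<open>e\<close> vanishes, and \<open>h\<close> reduces to
    \<open>f\<close> on the first component.\<close>
  moreover have "\<exists>x\<in>mcarrier (ob X i). h i w = f i x" if iw: "i \<ge> p + int n" "w \<in> mcarrier (ob W i)" for i w
  proof -
    obtain x c where xc: "w = pr x c" "x \<in> mcarrier (ob A i)" "c \<in> mcarrier (ob B i)"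
      using iw(2) unfolding obW by (rule dsum_cases)
    then have "h i w = f i x"
      using e(3) iw(1) AX[OF xc(2)] by (simp add: h_pr q0 sY hom_in[OF fh])
    with AX[OF xc(2)] show ?thesis by blast
  qed
  moreover have "\<exists>e\<in>chain_maps X X. e \<odot> e = e \<and> e p = id_mod (ob X p) \<and> f \<odot> e = czero"
    if r: "r \<in> mod_hom (ob W p) (ob X p)" and rk: "r \<circ> k p = id_mod (ob X p)" for r
  proof -
    \<comment> \<open>\<open>k p\<close> factors through the differential of \<open>X\<close>, so a
      left inverse of \<open>k p\<close> alone splits that differential.\<close>
    let ?mu = "r \<circ> (((\<lambda>c. pr 0 c) \<circ> id_mod (ob C p)) \<circ> ((\<lambda>x. pr 0 x) \<circ> id_mod (ob X (p + 1))))"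
    have mu: "?mu \<in> mod_hom (ob X (p + 1)) (ob X p)"
      by (rule hom_comp[OF hom_comp[OF j1 j2 rC rW] r rW rX])
    have "?mu \<circ> diff X p = id_mod (ob X p)"
      using rk by (simp add: k_def comp_assoc)
    from split_mono_idem[OF X mu this] show ?thesis
      using Y f fp by blast
  qed
  ultimately show ?thesis
    using WC k h by blast
qed

end

subsection \<open>Maps into and out of truncations\<close>

lemma CI_trunc_le: "X \<in> CI lo hi \<Longrightarrow> trunc_le p X \<in> CI lo p"
  using proj_complex_trunc_le[OF CI_proj_complex, of X] by (auto simp: CI_def ob_trunc_le)

lemma CI_trunc_ge: "X \<in> CI lo hi \<Longrightarrow> trunc_ge p X \<in> CI p hi"
  using proj_complex_trunc_ge[OF CI_proj_complex, of X] by (auto simp: CI_def ob_trunc_ge)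

lemma chain_to_trunc_le:
  assumes X: "proj_complex X" and W: "proj_complex W" and g: "g \<in> chain_maps X W"
    and X0: "\<And>i. i > N \<Longrightarrow> ob X i = zero_mod"
  shows "g \<in> chain_maps X (trunc_le N W)"
proof (rule chain_mapsI[OF X proj_complex_trunc_le[OF W]])
  have z: "g i = (\<lambda>_. 0)" if "i > N" for i
    using gmaps_from_zero[OF chain_gmaps[OF g] W X0[OF that]] by blast
  show "g i \<in> mod_hom (ob X i) (ob (trunc_le N W) i)" for i
    using chain_hom[OF g, of i] z[of i] by (simp add: ob_trunc_le zero_hom[OF right_module_zero_mod])
  show "diff (trunc_le N W) i (g i x) = g (i + 1) (diff X i x)" if "x \<in> mcarrier (ob X i)" for i x
    using chain_comm[OF g, of i x] z[of "i + 1"] by (simp add: diff_trunc_le)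
qed

lemma chain_from_trunc_le_iff:
  assumes X: "proj_complex X" and W: "proj_complex W" and X0: "\<And>i. i > N \<Longrightarrow> ob X i = zero_mod"
  shows "r \<in> chain_maps (trunc_le N W) X \<longleftrightarrow> r \<in> chain_maps W X"
proof
  note T = proj_complex_trunc_le[OF W, of N]
  assume r: "r \<in> chain_maps (trunc_le N W) X"
  have z: "r i x = 0" if "i > N" for i x
    using gmaps_into_zero[OF chain_gmaps[OF r] X0[OF that]] .
  show "r \<in> chain_maps W X"
  proof (rule chain_mapsI[OF W X])
    show "r i \<in> mod_hom (ob W i) (ob X i)" for i
    proof (cases "i \<le> N")
      case False
      then have "r i = (\<lambda>_. 0)" using z by auto
      then show ?thesis by (simp add: zero_hom[OF cpx_mod[OF X]])
    qed (use chain_hom[OF r, of i] in \<open>simp add: ob_trunc_le\<close>)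
    show "diff X i (r i x) = r (i + 1) (diff W i x)" if "x \<in> mcarrier (ob W i)" for i x
    proof (cases "i < N")
      case False
      have "diff X i (r i x) = 0"
        using hom_into_zero[of "diff X i" "ob X i"] cpx_diff[OF X, of i] X0[of "i + 1"] False by simp
      with False z show ?thesis by simp
    qed (use chain_comm[OF r, of i x] in \<open>simp add: diff_trunc_le\<close>)
  qed
next
  assume r: "r \<in> chain_maps W X"
  have z: "r i x = 0" if "i > N" for i x
    using gmaps_into_zero[OF chain_gmaps[OF r] X0[OF that]] .
  show "r \<in> chain_maps (trunc_le N W) X"
  proof (rule chain_mapsI[OF proj_complex_trunc_le[OF W] X])
    show "r i \<in> mod_hom (ob (trunc_le N W) i) (ob X i)" for i
    proof (cases "i \<le> N")
      case False
      then have "r i = (\<lambda>_. 0)" using z by auto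
      then show ?thesis by (simp add: zero_hom[OF cpx_mod[OF X]])
    qed (use chain_hom[OF r, of i] in \<open>simp add: ob_trunc_le\<close>)
    show "diff X i (r i x) = r (i + 1) (diff (trunc_le N W) i x)" if "x \<in> mcarrier (ob (trunc_le N W) i)" for i x
      using chain_comm[OF r, of i x] z gmaps_0[OF W X chain_gmaps[OF r]] by (simp add: diff_trunc_le)
  qed
qed

text \<open>The only square that can break is the one at the cut, where \<open>W\<close> still has a
  differential and the truncation has none.\<close>

lemma chain_to_trunc_le_lift:
  assumes X: "proj_complex X" and W: "proj_complex W" and g: "g \<in> chain_maps X (trunc_le N W)"
    and X0: "\<And>i. i > N \<Longrightarrow> ob X i = zero_mod" and d: "\<And>x. diff W N (g N x) = 0"
  shows "g \<in> chain_maps X W"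
proof (rule chain_mapsI[OF X W])
  have z: "g i = (\<lambda>_. 0)" if "i > N" for i
    using gmaps_from_zero[OF chain_gmaps[OF g] proj_complex_trunc_le[OF W] X0[OF that]] by blast
  show "g i \<in> mod_hom (ob X i) (ob W i)" for i
    using chain_hom[OF g, of i] z[of i] by (cases "i \<le> N") (simp_all add: ob_trunc_le zero_hom[OF cpx_mod[OF W]])
  show "diff W i (g i x) = g (i + 1) (diff X i x)" if "x \<in> mcarrier (ob X i)" for i x
  proof -
    consider "i < N" | "i = N" | "i > N" by linarith
    then show ?thesis
    proof cases
      case 1 then show ?thesis using chain_comm[OF g, of i x] by (simp add: diff_trunc_le)
    next
      case 2 then show ?thesis using d z[of "i + 1"] by simp
    next
      case 3
      then show ?thesis
        using z[of i] z[of "i + 1"] hom_0[OF cpx_diff[OF W] cpx_mod[OF W] cpx_mod[OF W]] by simp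
    qed
  qed
qed

lemma chain_to_trunc_ge_iff:
  assumes X: "proj_complex X" and W: "proj_complex W" and X0: "\<And>i. i < a \<Longrightarrow> ob X i = zero_mod"
  shows "g \<in> chain_maps X (trunc_ge a W) \<longleftrightarrow> g \<in> chain_maps X W"
proof
  assume g: "g \<in> chain_maps X (trunc_ge a W)"
  have z: "g i = (\<lambda>_. 0)" if "i < a" for i
    using gmaps_from_zero[OF chain_gmaps[OF g] proj_complex_trunc_ge[OF W] X0[OF that]] by blast
  show "g \<in> chain_maps X W"
  proof (rule chain_mapsI[OF X W])
    show "g i \<in> mod_hom (ob X i) (ob W i)" for i
      using chain_hom[OF g, of i] z[of i] by (cases "a \<le> i") (simp_all add: ob_trunc_ge zero_hom[OF cpx_mod[OF W]])
    show "diff W i (g i x) = g (i + 1) (diff X i x)" if x: "x \<in> mcarrier (ob X i)" for i x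
    proof (cases "a \<le> i")
      case False
      with x X0 have "x = 0" by (simp add: mcarrier_zero_mod)
      then show ?thesis
        using False z hom_0[OF cpx_diff[OF W] cpx_mod[OF W] cpx_mod[OF W]] hom_0[OF cpx_diff[OF X] cpx_mod[OF X] cpx_mod[OF X]]
          gmaps_0[OF X proj_complex_trunc_ge[OF W] chain_gmaps[OF g]] by simp
    qed (use chain_comm[OF g, of i x] in \<open>simp add: diff_trunc_ge\<close>)
  qed
next
  assume g: "g \<in> chain_maps X W"
  have z: "g i = (\<lambda>_. 0)" if "i < a" for i
    using gmaps_from_zero[OF chain_gmaps[OF g] W X0[OF that]] by blast
  show "g \<in> chain_maps X (trunc_ge a W)"
  proof (rule chain_mapsI[OF X proj_complex_trunc_ge[OF W]])
    show "g i \<in> mod_hom (ob X i) (ob (trunc_ge a W) i)" for i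
      using chain_hom[OF g, of i] z[of i]
      by (cases "a \<le> i") (simp_all add: ob_trunc_ge zero_hom[OF right_module_zero_mod])
    show "diff (trunc_ge a W) i (g i x) = g (i + 1) (diff X i x)" if x: "x \<in> mcarrier (ob X i)" for i x
    proof (cases "a \<le> i")
      case False
      with x X0 have "x = 0" by (simp add: mcarrier_zero_mod)
      then show ?thesis
        using False hom_0[OF cpx_diff[OF X] cpx_mod[OF X] cpx_mod[OF X]]
          gmaps_0[OF X W chain_gmaps[OF g]] by (simp add: diff_trunc_ge)
    qed (use chain_comm[OF g, of i x] in \<open>simp add: diff_trunc_ge\<close>)
  qed
qed

lemma chain_from_trunc_ge:
  assumes Y: "proj_complex Y" and W: "proj_complex W" and h: "h \<in> chain_maps W Y"
    and Y0: "\<And>i. i < a \<Longrightarrow> ob Y i = zero_mod"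
  shows "h \<in> chain_maps (trunc_ge a W) Y"
proof (rule chain_mapsI[OF proj_complex_trunc_ge[OF W] Y])
  have z: "h i = (\<lambda>_. 0)" if "i < a" for i
    using gmaps_into_zero[OF chain_gmaps[OF h] Y0[OF that]] by blast
  show "h i \<in> mod_hom (ob (trunc_ge a W) i) (ob Y i)" for i
    using chain_hom[OF h, of i] z[of i] by (cases "a \<le> i") (simp_all add: ob_trunc_ge zero_hom[OF cpx_mod[OF Y]])
  show "diff Y i (h i x) = h (i + 1) (diff (trunc_ge a W) i x)" if x: "x \<in> mcarrier (ob (trunc_ge a W) i)" for i x
    using chain_comm[OF h, of i x] x gmaps_0[OF W Y chain_gmaps[OF h]]
      hom_0[OF cpx_diff[OF Y] cpx_mod[OF Y] cpx_mod[OF Y]]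
    by (cases "a \<le> i") (simp_all add: diff_trunc_ge ob_trunc_ge mcarrier_zero_mod)
qed

lemma chain_from_trunc_ge_lift:
  assumes Y: "proj_complex Y" and W: "proj_complex W" and h: "h \<in> chain_maps (trunc_ge a W) Y"
    and Y0: "\<And>i. i < a \<Longrightarrow> ob Y i = zero_mod" and d: "\<And>x. h a (diff W (a - 1) x) = 0"
  shows "h \<in> chain_maps W Y"
proof (rule chain_mapsI[OF W Y])
  have z: "h i = (\<lambda>_. 0)" if "i < a" for i
    using gmaps_into_zero[OF chain_gmaps[OF h] Y0[OF that]] by blast
  show "h i \<in> mod_hom (ob W i) (ob Y i)" for i
    using chain_hom[OF h, of i] z[of i] by (cases "a \<le> i") (simp_all add: ob_trunc_ge zero_hom[OF cpx_mod[OF Y]])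
  show "diff Y i (h i x) = h (i + 1) (diff W i x)" if "x \<in> mcarrier (ob W i)" for i x
  proof -
    consider "i \<ge> a" | "i = a - 1" | "i + 1 < a" by linarith
    then show ?thesis
    proof cases
      case 1 then show ?thesis using chain_comm[OF h, of i x] by (simp add: diff_trunc_ge)
    next
      case 2
      then show ?thesis
        using d[of x] z[of i] hom_0[OF cpx_diff[OF Y] cpx_mod[OF Y] cpx_mod[OF Y]] by simp
    next
      case 3
      then show ?thesis
        using z[of i] z[of "i + 1"] hom_0[OF cpx_diff[OF Y] cpx_mod[OF Y] cpx_mod[OF Y]] by simp
    qed
  qed
qed

subsection \<open>Consequences of the splitting for complexes of full width\<close>

text \<open>For \<open>Z\<close> vanishing above \<open>N\<close> this says that \<open>Z\<close>
  has no nonzero chain map to a projective placed in degree \<open>N\<close>. The obstruction to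
  lifting a map from \<open>Z\<close> into \<open>trunc_le N W\<close> to a map into
  \<open>W\<close> is such a chain map.\<close>

definition no_map_out :: "('a::ring_1, 'm::zero) cpx \<Rightarrow> int \<Rightarrow> bool" where
  "no_map_out Z N \<longleftrightarrow> (\<forall>P z. fg_proj P \<longrightarrow> z \<in> mod_hom (ob Z N) P \<longrightarrow>
     z \<circ> diff Z (N - 1) = (\<lambda>_. 0) \<longrightarrow> z = (\<lambda>_. 0))"

definition no_map_in :: "('a::ring_1, 'm::zero) cpx \<Rightarrow> int \<Rightarrow> bool" where
  "no_map_in X a \<longleftrightarrow> (\<forall>P x. fg_proj P \<longrightarrow> x \<in> mod_hom P (ob X a) \<longrightarrow>
     diff X a \<circ> x = (\<lambda>_. 0) \<longrightarrow> x = (\<lambda>_. 0))"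

lemma no_map_out_zero: "ob Z N = zero_mod \<Longrightarrow> no_map_out Z N"
  unfolding no_map_out_def using hom_from_zero fg_proj_right_module by metis

lemma no_map_in_zero: "ob X a = zero_mod \<Longrightarrow> no_map_in X a"
  unfolding no_map_in_def using hom_into_zero by metis

text \<open>The obstruction \<open>diff W N \<circ> s N\<close> kills the boundaries of
  \<open>Y\<close> because the differential of \<open>W\<close> squares to zero, so
  \<open>no_map_out\<close> applies to it.\<close>

lemma no_map_out_lift:
  assumes Y: "proj_complex Y" and W: "proj_complex W" and s: "s \<in> chain_maps Y (trunc_le N W)"
    and Y0: "\<And>i. i > N \<Longrightarrow> ob Y i = zero_mod" and out: "no_map_out Y N"
  shows "s \<in> chain_maps Y W"
proof -
  have sN: "s N \<in> mod_hom (ob Y N) (ob W N)"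
    using chain_hom[OF s, of N] by (simp add: ob_trunc_le)
  have "diff W N \<circ> s N \<in> mod_hom (ob Y N) (ob W (N + 1))"
    by (rule hom_comp[OF sN cpx_diff[OF W] cpx_mod[OF W] cpx_mod[OF W]])
  moreover have "(diff W N \<circ> s N) \<circ> diff Y (N - 1) = (\<lambda>_. 0)"
    by (simp add: fun_eq_iff chain_comm'[OF s, symmetric] diff_trunc_le cpx_dd'[OF W])
  ultimately have "diff W N \<circ> s N = (\<lambda>_. 0)"
    using out cpx_fg[OF W] unfolding no_map_out_def by blast
  then show ?thesis
    by (intro chain_to_trunc_le_lift[OF Y W s Y0]) (simp_all add: fun_eq_iff)
qed

lemma no_map_in_lift:
  assumes X: "proj_complex X" and W: "proj_complex W" and r: "r \<in> chain_maps (trunc_ge a W) X"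
    and X0: "\<And>i. i < a \<Longrightarrow> ob X i = zero_mod" and nin: "no_map_in X a"
  shows "r \<in> chain_maps W X"
proof -
  have ra: "r a \<in> mod_hom (ob W a) (ob X a)"
    using chain_hom[OF r, of a] by (simp add: ob_trunc_ge)
  have "r a \<circ> diff W (a - 1) \<in> mod_hom (ob W (a - 1)) (ob X a)"
    by (rule hom_comp[OF cpx_diff'[OF W] ra cpx_mod[OF W] cpx_mod[OF X]])
  moreover have "diff X a \<circ> (r a \<circ> diff W (a - 1)) = (\<lambda>_. 0)"
    using chain_comm[OF r, of a] cpx_dd'[OF W, of a]
      gmaps_0[OF proj_complex_trunc_ge[OF W] X chain_gmaps[OF r]]
    by (simp add: fun_eq_iff diff_trunc_ge)
  ultimately have "r a \<circ> diff W (a - 1) = (\<lambda>_. 0)"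
    using nin cpx_fg[OF W] unfolding no_map_in_def by blast
  then show ?thesis
    by (intro chain_from_trunc_ge_lift[OF X W r X0]) (simp_all add: fun_eq_iff)
qed

text \<open>As functions, the inclusion of the subcomplex and its identity coincide.\<close>

lemma trunc_ge_incl:
  assumes "proj_complex Y"
  shows "cid (trunc_ge p Y) \<in> chain_maps (trunc_ge p Y) Y"
proof -
  note T = proj_complex_trunc_ge[OF assms, of p]
  show ?thesis
    by (rule iffD1[OF chain_to_trunc_ge_iff[OF T assms] chain_id[OF T]]) (simp add: ob_trunc_ge)
qed

section \<open>Attaching a projective at one end of a complex\<close>

definition attach_top :: "('a::ring_1, 'm::zero) cpx \<Rightarrow> int \<Rightarrow> ('a, 'm) rmod \<Rightarrow> ('m \<Rightarrow> 'm) \<Rightarrow> ('a, 'm) cpx" where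
  "attach_top Y N P z = \<lparr>ob = (ob Y)(N + 1 := P), diff = (diff Y)(N := z, N + 1 := (\<lambda>_. 0))\<rparr>"

definition attach_bot :: "('a::ring_1, 'm::zero) cpx \<Rightarrow> int \<Rightarrow> ('a, 'm) rmod \<Rightarrow> ('m \<Rightarrow> 'm) \<Rightarrow> ('a, 'm) cpx" where
  "attach_bot Y a P x = \<lparr>ob = (ob Y)(a - 1 := P), diff = (diff Y)(a - 1 := x, a - 2 := (\<lambda>_. 0))\<rparr>"

lemma splitD:
  assumes "band_splitting TYPE(('a::ring_1, 'm::zero) cpx) n" "(X :: ('a, 'm) cpx) \<in> CI lo hi"
  shows "\<exists>e\<in>chain_maps X X. e \<odot> e = e \<and> (\<forall>i\<le>m. e i = id_mod (ob X i)) \<and> (\<forall>i>m + int n. \<forall>x. e i x = 0)"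
  using assms CI_Cb unfolding band_splitting_def by blast

text \<open>The enlarged complex reaches from \<open>a\<close> to \<open>N + 1\<close>. Band
  splitting at \<open>a\<close> gives an idempotent that is the identity in degree \<open>a\<close>
  and zero on \<open>P\<close>, and commuting with the new differential \<open>z\<close> yields the
  last equation. \<open>Y\<close> may decompose, since the middle term of an almost split sequence
  also takes this role.\<close>

lemma attach_top_idem:
  fixes Y :: "('a::ring_1, 'm::zero) cpx"
  assumes band: "band_splitting TYPE(('a, 'm) cpx) n" and YC: "Y \<in> CI a N" and N: "N = a + int n"
    and P: "fg_proj P" and z: "z \<in> mod_hom (ob Y N) P" and zd: "z \<circ> diff Y (N - 1) = (\<lambda>_. 0)"
  shows "\<exists>e\<in>chain_maps Y Y. e \<odot> e = e \<and> e a = id_mod (ob Y a) \<and> (\<forall>x. z (e N x) = 0)"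
proof -
  have Y: "proj_complex Y" using YC by (rule CI_proj_complex)
  note rP = fg_proj_right_module[OF P]
  have Yt: "ob Y i = zero_mod" if "i > N" for i using CI_zero[OF YC] that by simp
  let ?Y = "attach_top Y N P z"
  have zd': "z (diff Y (N - 1) x) = 0" for x using zd by (metis comp_apply)
  have d0: "diff Y i x = 0" if "i \<ge> N" for i x
    using hom_into_zero[of "diff Y i" "ob Y i"] cpx_diff[OF Y, of i] Yt[of "i + 1"] that by simp
  have A: "proj_complex ?Y"
  proof (rule proj_complexI)
    show "fg_proj (ob ?Y i)" for i by (simp add: attach_top_def P cpx_fg[OF Y])
    show "diff ?Y i \<in> mod_hom (ob ?Y i) (ob ?Y (i + 1))" for i
      using z cpx_diff[OF Y, of i] zero_hom[OF cpx_mod[OF Y]] by (simp add: attach_top_def)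
    show "diff ?Y (i + 1) (diff ?Y i x) = 0" if "x \<in> mcarrier (ob ?Y i)" for i x
    proof -
      consider "i = N - 1" | "i = N" | "i = N + 1" | "i \<noteq> N - 1" "i \<noteq> N" "i \<noteq> N + 1" by blast
      then show ?thesis
        using zd' cpx_dd[OF Y, of i x] d0[of "i + 1"] by cases (simp_all add: attach_top_def)
    qed
  qed
  have "?Y \<in> CI a (N + 1)"
    using A CI_zero[OF YC] N by (auto simp: CI_def attach_top_def)
  then obtain e where e': "e \<in> chain_maps ?Y ?Y" "e \<odot> e = e" "\<forall>i\<le>a. e i = id_mod (ob ?Y i)" "\<forall>i>a + int n. \<forall>x. e i x = 0"
    using splitD[OF band, of ?Y a "N + 1" a] by blast
  note e = e'(1,2) e'(3)[rule_format] e'(4)[rule_format]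
  have e0: "e i = (\<lambda>_. 0)" if "i > N" for i using e(4) that N by blast
  have "e \<in> chain_maps Y Y"
  proof (rule chain_mapsI[OF Y Y])
    show "e i \<in> mod_hom (ob Y i) (ob Y i)" for i
      using chain_hom[OF e(1), of i] e0[of i] zero_hom[OF cpx_mod[OF Y]]
      by (cases "i = N + 1") (simp_all add: attach_top_def)
    show "diff Y i (e i x) = e (i + 1) (diff Y i x)" if "x \<in> mcarrier (ob Y i)" for i x
      using chain_comm[OF e(1), of i x] d0[of i] e0[of "i + 1"]
      by (cases "i < N") (simp_all add: attach_top_def)
  qed
  moreover have "z (e N x) = 0" for x
    using chain_comm[OF e(1), of N x] e0[of "N + 1"] by (simp add: attach_top_def)
  moreover have "e a = id_mod (ob Y a)"
    using e(3)[of a] N by (simp add: attach_top_def)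
  ultimately show ?thesis using e(2) by blast
qed

text \<open>Here the cut is at \<open>a - 1\<close>, the degree of \<open>P\<close>: the idempotent
  is the identity on \<open>P\<close>, hence on the image of \<open>x\<close>, and vanishes from
  degree \<open>N\<close> on.\<close>

lemma attach_bot_idem:
  fixes Y :: "('a::ring_1, 'm::zero) cpx"
  assumes band: "band_splitting TYPE(('a, 'm) cpx) n" and YC: "Y \<in> CI a N" and N: "N = a + int n"
    and P: "fg_proj P" and x: "x \<in> mod_hom P (ob Y a)" and dx: "diff Y a \<circ> x = (\<lambda>_. 0)"
  shows "\<exists>e\<in>chain_maps Y Y. e \<odot> e = e \<and> (\<forall>y. e N y = 0) \<and> e a \<circ> x = x"
proof -
  have Y: "proj_complex Y" using YC by (rule CI_proj_complex)
  note rP = fg_proj_right_module[OF P]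
  note d0 = hom_0[OF cpx_diff[OF Y] cpx_mod[OF Y] cpx_mod[OF Y]]
  have Yt: "ob Y i = zero_mod" if "i < a" for i using CI_zero[OF YC] that by simp
  let ?Y = "attach_bot Y a P x"
  have dx': "diff Y a (x y) = 0" for y using dx by (metis comp_apply)
  have A: "proj_complex ?Y"
  proof (rule proj_complexI)
    show "fg_proj (ob ?Y i)" for i by (simp add: attach_bot_def P cpx_fg[OF Y])
    show "diff ?Y i \<in> mod_hom (ob ?Y i) (ob ?Y (i + 1))" for i
      using x cpx_diff[OF Y, of i] zero_hom[OF rP] by (auto simp: attach_bot_def)
    show "diff ?Y (i + 1) (diff ?Y i y) = 0" if "y \<in> mcarrier (ob ?Y i)" for i y
    proof -
      consider "i = a - 1" | "i = a - 2" | "i = a - 2 - 1" | "i \<noteq> a - 1" "i \<noteq> a - 2" "i \<noteq> a - 2 - 1" by blast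
      then show ?thesis
        using dx' cpx_dd[OF Y, of i y] hom_0[OF x rP cpx_mod[OF Y]] by cases (auto simp: attach_bot_def)
    qed
  qed
  have "?Y \<in> CI (a - 1) N"
    using A CI_zero[OF YC] N by (auto simp: CI_def attach_bot_def)
  then obtain e where e': "e \<in> chain_maps ?Y ?Y" "e \<odot> e = e" "\<forall>i\<le>a - 1. e i = id_mod (ob ?Y i)" "\<forall>i>a - 1 + int n. \<forall>y. e i y = 0"
    using splitD[OF band, of ?Y "a - 1" N "a - 1"] by blast
  note e = e'(1,2) e'(3)[rule_format] e'(4)[rule_format]
  \<comment> \<open>Degree \<open>a - 1\<close> of \<open>Y\<close> itself is zero, so the identity
    of \<open>P\<close> has to be removed.\<close>
  define e' where "e' = e(a - 1 := (\<lambda>_. 0))"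
  have "e' \<in> chain_maps Y Y"
  proof (rule chain_mapsI[OF Y Y])
    show "e' i \<in> mod_hom (ob Y i) (ob Y i)" for i
      using chain_hom[OF e(1), of i] zero_hom[OF cpx_mod[OF Y]]
      by (cases "i = a - 1") (simp_all add: attach_bot_def e'_def)
    show "diff Y i (e' i y) = e' (i + 1) (diff Y i y)" if y: "y \<in> mcarrier (ob Y i)" for i y
    proof (cases "i < a")
      case True
      with y have "y = 0" using Yt by (simp add: mcarrier_zero_mod)
      moreover have "e' j 0 = 0" for j
        using gmaps_0[OF A A chain_gmaps[OF e(1)]] by (simp add: e'_def)
      ultimately show ?thesis by (simp add: d0)
    next
      case False
      then show ?thesis
        using chain_comm[OF e(1), of i y] by (simp add: attach_bot_def e'_def)
    qed
  qed
  moreover have "e' \<odot> e' = e'"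
    using e(2) by (auto simp: fun_eq_iff e'_def)
  moreover have "e' N y = 0" for y
    using e(4)[of N y] N by (simp add: e'_def)
  moreover have "e' a \<circ> x = x"
  proof (rule hom_ext[OF _ x])
    show "e' a \<circ> x \<in> mod_hom P (ob Y a)"
      by (rule hom_comp[OF x chain_hom[OF calculation(1)] cpx_mod[OF Y] cpx_mod[OF Y]])
    show "(e' a \<circ> x) y = x y" if "y \<in> mcarrier P" for y
      using chain_comm[OF e(1), of "a - 1" y] e(3)[of "a - 1"] that
      by (simp add: attach_bot_def e'_def id_mod_def)
  qed
  ultimately show ?thesis by blast
qed

lemma no_map_out_full:
  fixes Y :: "('a::ring_1, 'm::zero) cpx"
  assumes band: "band_splitting TYPE(('a, 'm) cpx) n" and YC: "Y \<in> CI a N" and N: "N = a + int n"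
    and t: "triv_idem Y" and ne: "ob Y a \<noteq> zero_mod"
  shows "no_map_out Y N"
  unfolding no_map_out_def
proof (intro allI impI)
  have Y: "proj_complex Y" using YC by (rule CI_proj_complex)
  fix P :: "('a, 'm) rmod" and z
  assume P: "fg_proj P" and z: "z \<in> mod_hom (ob Y N) P" and "z \<circ> diff Y (N - 1) = (\<lambda>_. 0)"
  then obtain e where e: "e \<in> chain_maps Y Y" "e \<odot> e = e" "e a = id_mod (ob Y a)" "\<forall>x. z (e N x) = 0"
    using attach_top_idem[OF band YC N] by blast
  have "e \<noteq> czero" by (rule cmap_neq_czero[of Y e a, OF Y e(3) ne])
  then have "e = cid Y" using triv_idemD[OF t e(1,2)] by blast
  then have "z x = 0" if "x \<in> mcarrier (ob Y N)" for x using e(4) that by (metis cid_apply)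
  then show "z = (\<lambda>_. 0)"
    by (intro hom_ext[OF z zero_hom[OF fg_proj_right_module[OF P]]])
qed

lemma no_map_in_full:
  fixes X :: "('a::ring_1, 'm::zero) cpx"
  assumes band: "band_splitting TYPE(('a, 'm) cpx) n" and XC: "X \<in> CI a N" and N: "N = a + int n"
    and t: "triv_idem X" and ne: "ob X N \<noteq> zero_mod"
  shows "no_map_in X a"
  unfolding no_map_in_def
proof (intro allI impI)
  have X: "proj_complex X" using XC by (rule CI_proj_complex)
  fix P :: "('a, 'm) rmod" and x
  assume P: "fg_proj P" and x: "x \<in> mod_hom P (ob X a)" and "diff X a \<circ> x = (\<lambda>_. 0)"
  then obtain e where e: "e \<in> chain_maps X X" "e \<odot> e = e" "\<forall>y. e N y = 0" "e a \<circ> x = x"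
    using attach_bot_idem[OF band XC N] by blast
  have "e \<noteq> cid X"
  proof
    assume "e = cid X"
    with e(3) have "id_mod (ob X N) = (\<lambda>_. 0)" by (simp add: cid_def fun_eq_iff)
    with ne id_mod_zero_iff[OF cpx_mod[OF X]] show False by blast
  qed
  then have "e = czero" using triv_idemD[OF t e(1,2)] by blast
  then show "x = (\<lambda>_. 0)" using e(4) by (simp add: comp_def czero_def)
qed

text \<open>Recovers the dichotomy of \<open>triv_idem_width\<close> from the idempotent alone, so
  that the later arguments rest on band splitting and not on \<open>strong_gl_dim\<close>.\<close>

lemma triv_idem_band:
  fixes X :: "('a::ring_1, 'm::zero) cpx"
  assumes band: "band_splitting TYPE(('a, 'm) cpx) n" and XC: "X \<in> CI lo hi" and t: "triv_idem X"
  shows "(\<forall>i\<le>m. ob X i = zero_mod) \<or> (\<forall>i>m + int n. ob X i = zero_mod)"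
proof -
  have X: "proj_complex X" using XC by (rule CI_proj_complex)
  obtain e where e': "e \<in> chain_maps X X" "e \<odot> e = e" "\<forall>i\<le>m. e i = id_mod (ob X i)" "\<forall>i>m + int n. \<forall>x. e i x = 0"
    using splitD[OF band XC] by blast
  note e = e'(1,2) e'(3)[rule_format] e'(4)[rule_format]
  from triv_idemD[OF t e(1,2)] show ?thesis
  proof
    assume "e = czero"
    then have "id_mod (ob X i) = (\<lambda>_. 0)" if "i \<le> m" for i
      using e(3)[OF that] by (simp add: czero_def)
    then show ?thesis using id_mod_zero_iff[OF cpx_mod[OF X]] by blast
  next
    assume "e = cid X"
    then have "id_mod (ob X i) = (\<lambda>_. 0)" if "i > m + int n" for i
      using e(4)[OF that] by (simp add: cid_def fun_eq_iff)
    then show ?thesis using id_mod_zero_iff[OF cpx_mod[OF X]] by blast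
  qed
qed

declare [[simproc add: int_combine_numerals]]

subsection \<open>Irreducible morphisms\<close>

definition irr :: "int \<Rightarrow> int \<Rightarrow> ('a::ring_1, 'm::zero) cpx \<Rightarrow> ('a, 'm) cpx \<Rightarrow> 'm cmap \<Rightarrow> bool" where
  "irr lo hi X Y f \<longleftrightarrow>
     X \<in> CI lo hi \<and> Y \<in> CI lo hi \<and> f \<in> chain_maps X Y \<and>
     \<not> is_section X Y f \<and> \<not> is_retraction X Y f \<and>
     (\<forall>W\<in>CI lo hi. \<forall>g\<in>chain_maps X W. \<forall>h\<in>chain_maps W Y.
        f = h \<odot> g \<longrightarrow> is_retraction W Y h \<or> is_section X W g)"

lemma irr_mono:
  assumes "irr lo hi X Y f" "lo \<le> a" "b \<le> hi" "X \<in> CI a b" "Y \<in> CI a b"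
  shows "irr a b X Y f"
  using assms CI_mono[of _ a b lo hi] unfolding irr_def by blast

definition zero_cpx :: "('a::ring_1, 'm::zero) cpx" where
  "zero_cpx = \<lparr>ob = (\<lambda>_. zero_mod), diff = (\<lambda>_ _. 0)\<rparr>"

lemma zero_cpx_CI: "(zero_cpx :: ('a::ring_1, 'm::zero) cpx) \<in> CI lo hi"
  by (auto simp: CI_def zero_cpx_def proj_complex_def fg_proj_zero_mod fun_eq_iff
      zero_hom[OF right_module_zero_mod])

lemma retraction_onto_zero:
  "proj_complex X \<Longrightarrow> null_object strict Y \<Longrightarrow> proj_complex Y \<Longrightarrow> f \<in> chain_maps X Y \<Longrightarrow> is_retraction X Y f"
  using chain_zero[of Y X] gmaps_zero_right[of X Y f] chain_gmaps[of f X Y]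
  unfolding is_retraction_def null_object_def strict_def by metis

text \<open>A zero map factors through the zero complex, which would make source or target
  zero.\<close>

lemma irr_nonzero:
  fixes X Y :: "('a::ring_1, 'm::zero) cpx"
  assumes "irr lo hi X Y f" "\<not> null_object strict X" "\<not> null_object strict Y"
  shows "f \<noteq> czero"
proof
  assume f: "f = czero"
  let ?Z = "zero_cpx :: ('a, 'm) cpx"
  have X: "proj_complex X" and Y: "proj_complex Y" and Z: "proj_complex ?Z"
    using assms(1) CI_proj_complex CI_proj_complex[OF zero_cpx_CI[of 0 0]] by (auto simp: irr_def)
  have "is_retraction ?Z Y czero \<or> is_section X ?Z czero"
    using assms(1) zero_cpx_CI[of lo hi] chain_zero[OF X Z] chain_zero[OF Z Y] zero_comp[of czero] f
    unfolding irr_def by metis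
  then show False
  proof
    assume "is_retraction ?Z Y czero"
    then show False
      using assms(3) by (auto simp: is_retraction_def zero_comp null_object_def strict_def)
  next
    assume "is_section X ?Z czero"
    then obtain g where g: "g \<in> chain_maps ?Z X" "g \<odot> czero = cid X"
      by (auto simp: is_section_def)
    then show False
      using assms(2) gmaps_zero_right[OF Z X chain_gmaps[OF g(1)]] by (simp add: null_object_def strict_def)
  qed
qed

text \<open>A factorization through \<open>W\<close> is cut down by \<open>trunc_le N\<close>. A
  left inverse found there is already one on \<open>W\<close>; a right inverse is a map into a
  quotient complex, and \<open>no_map_out\<close> allows it to be lifted.\<close>

lemma irr_extend_right:
  assumes f: "irr a N X Y f" and out: "no_map_out Y N" and b: "N \<le> b"
  shows "irr a b X Y f"
proof -
  have XC: "X \<in> CI a N" and YC: "Y \<in> CI a N" using f by (simp_all add: irr_def)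
  note X = CI_proj_complex[OF XC] and Y = CI_proj_complex[OF YC]
  have X0: "ob X i = zero_mod" if "i > N" for i using CI_zero[OF XC] that by blast
  have Y0: "ob Y i = zero_mod" if "i > N" for i using CI_zero[OF YC] that by blast
  have "is_retraction W Y h \<or> is_section X W g"
    if WC: "W \<in> CI a b" and g: "g \<in> chain_maps X W" and h: "h \<in> chain_maps W Y" and fhg: "f = h \<odot> g" for W g h
  proof -
    note W = CI_proj_complex[OF WC]
    let ?W = "trunc_le N W"
    have "is_retraction ?W Y h \<or> is_section X ?W g"
      using f CI_trunc_le[OF WC, of N] chain_to_trunc_le[OF X W g X0] chain_from_trunc_le_iff[OF Y W Y0] h fhg
      unfolding irr_def by blast
    then show ?thesis
    proof
      assume "is_retraction ?W Y h"
      then obtain s where s: "s \<in> chain_maps Y ?W" "h \<odot> s = cid Y"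
        by (auto simp: is_retraction_def)
      have "s \<in> chain_maps Y W" by (rule no_map_out_lift[OF Y W s(1) Y0 out])
      with s(2) show ?thesis by (auto simp: is_retraction_def)
    next
      assume "is_section X ?W g"
      then show ?thesis
        using chain_from_trunc_le_iff[OF X W X0] by (auto simp: is_section_def)
    qed
  qed
  then show ?thesis
    using f CI_mono[OF XC order_refl b] CI_mono[OF YC order_refl b] by (simp add: irr_def)
qed

text \<open>The truncation is now a subcomplex, so the roles change: right inverses pass to
  \<open>W\<close> freely and left inverses have to be extended.\<close>

lemma irr_extend_left:
  assumes f: "irr a N X Y f" and nin: "no_map_in X a" and b: "b \<le> a"
  shows "irr b N X Y f"
proof -
  have XC: "X \<in> CI a N" and YC: "Y \<in> CI a N" using f by (simp_all add: irr_def)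
  note X = CI_proj_complex[OF XC] and Y = CI_proj_complex[OF YC]
  have X0: "ob X i = zero_mod" if "i < a" for i using CI_zero[OF XC] that by blast
  have Y0: "ob Y i = zero_mod" if "i < a" for i using CI_zero[OF YC] that by blast
  have "is_retraction W Y h \<or> is_section X W g"
    if WC: "W \<in> CI b N" and g: "g \<in> chain_maps X W" and h: "h \<in> chain_maps W Y" and fhg: "f = h \<odot> g" for W g h
  proof -
    note W = CI_proj_complex[OF WC]
    let ?W = "trunc_ge a W"
    have "is_retraction ?W Y h \<or> is_section X ?W g"
      using f CI_trunc_ge[OF WC, of a] chain_to_trunc_ge_iff[OF X W X0] chain_from_trunc_ge[OF Y W h Y0] g fhg
      unfolding irr_def by blast
    then show ?thesis
    proof
      assume "is_retraction ?W Y h"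
      then show ?thesis
        using chain_to_trunc_ge_iff[OF Y W Y0] by (auto simp: is_retraction_def)
    next
      assume "is_section X ?W g"
      then obtain r where r: "r \<in> chain_maps ?W X" "r \<odot> g = cid X"
        by (auto simp: is_section_def)
      have "r \<in> chain_maps W X" by (rule no_map_in_lift[OF X W r(1) X0 nin])
      with r(2) show ?thesis by (auto simp: is_section_def)
    qed
  qed
  then show ?thesis
    using f CI_mono[OF XC b order_refl] CI_mono[OF YC b order_refl] by (simp add: irr_def)
qed

lemma hom_zero_mod_carrier:
  assumes "right_module M" "\<And>x. x \<in> mcarrier M \<Longrightarrow> x = 0"
  shows "M = zero_mod"
  using assms zero_mod_iff zero_in_carrier by blast

text \<open>Consider the factorization through the cone. If \<open>h\<close> is a retraction, degree
  \<open>q\<close> of \<open>Y\<close> lies in the image of \<open>f\<close>, which is zero there;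
  if \<open>k\<close> is a section, \<open>X\<close> is a contractible complex that \<open>f\<close>
  kills, against \<open>irr_nonzero\<close>. The bound on \<open>q\<close> includes equality, as
  needed at the two ends of a window.\<close>

lemma (in pairing) irr_lower_source:
  fixes X Y :: "('a::ring_1, 'm) cpx"
  assumes band: "band_splitting TYPE(('a, 'm) cpx) n"
    and f: "irr lo hi X Y f" and t: "triv_idem X"
    and nX: "\<not> null_object strict X" and nY: "\<not> null_object strict Y"
    and lo: "lo \<le> p" and X0: "\<And>i. i < p \<Longrightarrow> ob X i = zero_mod" and Xp: "ob X p \<noteq> zero_mod"
    and Y0: "\<And>i. i \<le> p \<Longrightarrow> ob Y i = zero_mod" and q: "q \<ge> p + int n" and Xq: "ob X q = zero_mod"
  shows "ob Y q = zero_mod"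
proof -
  have XC: "X \<in> CI lo hi" and YC: "Y \<in> CI lo hi" and fc: "f \<in> chain_maps X Y" using f by (simp_all add: irr_def)
  note X = CI_proj_complex[OF XC] and Y = CI_proj_complex[OF YC]
  obtain W k h where W: "W \<in> CI lo hi" and k: "k \<in> chain_maps X W" and h: "h \<in> chain_maps W Y" and fhk: "f = h \<odot> k"
    and im: "\<forall>i\<ge>p + int n. \<forall>w\<in>mcarrier (ob W i). \<exists>x\<in>mcarrier (ob X i). h i w = f i x"
    and sec: "\<forall>r\<in>mod_hom (ob W p) (ob X p). r \<circ> k p = id_mod (ob X p) \<longrightarrow>
       (\<exists>e\<in>chain_maps X X. e \<odot> e = e \<and> e p = id_mod (ob X p) \<and> f \<odot> e = czero)"
    using cone_factorization[OF band XC YC fc lo X0 Y0] by blast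
  have "is_retraction W Y h \<or> is_section X W k"
    using f W k h fhk unfolding irr_def by blast
  then show ?thesis
  proof
    assume "is_retraction W Y h"
    then obtain s where s: "s \<in> chain_maps Y W" "h \<odot> s = cid Y"
      by (auto simp: is_retraction_def)
    show ?thesis
    proof (rule hom_zero_mod_carrier[OF cpx_mod[OF Y]])
      fix y assume y: "y \<in> mcarrier (ob Y q)"
      then obtain x where "x \<in> mcarrier (ob X q)" "h q (s q y) = f q x"
        using im q gmaps_in[OF chain_gmaps[OF s(1)]] by blast
      moreover have "h q (s q y) = y"
        using s(2) y by (metis ccomp_apply cid_apply)
      ultimately show "y = 0"
        using Xq gmaps_0[OF X Y chain_gmaps[OF fc]] by (simp add: mcarrier_zero_mod)
    qed
  next
    assume "is_section X W k"
    then obtain r where r: "r \<in> chain_maps W X" "r \<odot> k = cid X"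
      by (auto simp: is_section_def)
    have "r p \<circ> k p = id_mod (ob X p)"
      using fun_cong[OF r(2), of p] by (simp add: ccomp_def cid_def)
    then obtain e where e: "e \<in> chain_maps X X" "e \<odot> e = e" "e p = id_mod (ob X p)" "f \<odot> e = czero"
      using sec chain_hom[OF r(1)] by blast
    have "e \<noteq> czero" by (rule cmap_neq_czero[of X e p, OF X e(3) Xp])
    then have "e = cid X" using triv_idemD[OF t e(1,2)] by blast
    then have "f = czero"
      using e(4) gmaps_id_right[OF X Y chain_gmaps[OF fc]] by simp
    with irr_nonzero[OF f nX nY] show ?thesis by blast
  qed
qed

text \<open>If both conditions fail, \<open>no_map_out_full\<close> and
  \<open>no_map_in_full\<close> make \<open>Y\<close> zero in degree \<open>a\<close> and
  \<open>X\<close> zero in degree \<open>N\<close>, while \<open>X\<close> is nonzero in degree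
  \<open>a\<close> and \<open>Y\<close> in degree \<open>N\<close>. This is the staggered position
  excluded by \<open>irr_lower_source\<close>.\<close>

lemma (in pairing) irr_no_map:
  fixes X Y :: "('a::ring_1, 'm) cpx"
  assumes band: "band_splitting TYPE(('a, 'm) cpx) n" and N: "N = a + int n"
    and f: "irr a N X Y f" and tX: "triv_idem X" and tY: "triv_idem Y"
    and nX: "\<not> null_object strict X" and nY: "\<not> null_object strict Y"
  shows "no_map_out Y N \<or> no_map_in X a"
proof (rule ccontr)
  have XC: "X \<in> CI a N" and YC: "Y \<in> CI a N" using f by (simp_all add: irr_def)
  assume c: "\<not> (no_map_out Y N \<or> no_map_in X a)"
  then have YN: "ob Y N \<noteq> zero_mod" and Xa: "ob X a \<noteq> zero_mod"
    using no_map_out_zero no_map_in_zero by blast+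
  have Ya: "ob Y a = zero_mod" and XN: "ob X N = zero_mod"
    using c no_map_out_full[OF band YC N tY] no_map_in_full[OF band XC N tX] by blast+
  have "ob Y N = zero_mod"
    by (rule irr_lower_source[OF band f tX nX nY order_refl _ Xa])
      (use CI_zero[OF XC] CI_zero[OF YC] Ya XN N in \<open>auto simp: order_le_less\<close>)
  with YN show False ..
qed

lemma support_bounds:
  assumes fin: "finite I" and ne: "I \<noteq> {}" and I: "I \<subseteq> {lo..hi::int}" and n: "hi - lo \<ge> int n"
    and w: "Max I \<le> Min I + int n"
  obtains a where "lo \<le> a" "a + int n \<le> hi" "\<And>i. i \<notin> {a..a + int n} \<Longrightarrow> i \<notin> I"
proof -
  \<comment> \<open>The window starts at the lowest degree of \<open>I\<close>; the minimum pushes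
    it down when it would reach beyond \<open>hi\<close>.\<close>
  define a where "a = min (Min I) (hi - int n)"
  have "Min I \<in> {lo..hi}" "Max I \<in> {lo..hi}"
    using Min_in[OF fin ne] Max_in[OF fin ne] I by blast+
  then have "lo \<le> a" "a + int n \<le> hi" "a \<le> Min I" "Max I \<le> a + int n"
    using n w by (auto simp: a_def)
  moreover have "i \<notin> I" if "i \<notin> {a..a + int n}" for i
  proof
    assume "i \<in> I"
    then show False
      using that Min_le[OF fin, of i] Max_ge[OF fin, of i] \<open>a \<le> Min I\<close> \<open>Max I \<le> a + int n\<close> by auto
  qed
  ultimately show ?thesis using that[of a] by blast
qed

text \<open>If the joint support is too long, each complex is too narrow to contain both of its
  ends, so one of them contains \<open>p\<close> and the other contains \<open>q\<close>.\<close>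

lemma (in pairing) irr_window:
  fixes X Y :: "('a::ring_1, 'm) cpx"
  assumes band: "band_splitting TYPE(('a, 'm) cpx) n" and hl: "hi - lo \<ge> int n"
    and f: "irr lo hi X Y f" and tX: "triv_idem X" and tY: "triv_idem Y"
    and nX: "\<not> null_object strict X" and nY: "\<not> null_object strict Y"
  obtains a where "lo \<le> a" "a + int n \<le> hi" "X \<in> CI a (a + int n)" "Y \<in> CI a (a + int n)"
proof -
  have XC: "X \<in> CI lo hi" and YC: "Y \<in> CI lo hi" and fc: "f \<in> chain_maps X Y" using f by (simp_all add: irr_def)
  note X = CI_proj_complex[OF XC] and Y = CI_proj_complex[OF YC]
  define I where "I = {i. ob X i \<noteq> zero_mod \<or> ob Y i \<noteq> zero_mod}"
  have I: "I \<subseteq> {lo..hi}" using XC YC by (auto simp: I_def CI_def)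
  then have fin: "finite I" using finite_subset by blast
  have ne: "I \<noteq> {}" using nX null_strict_iff[OF X] by (auto simp: I_def)
  define p where "p = Min I"
  define q where "q = Max I"
  have pI: "p \<in> I" and qI: "q \<in> I"
    using Min_in[OF fin ne] Max_in[OF fin ne] by (simp_all add: p_def q_def)
  have low: "i \<notin> I" if "i < p" for i
    using that Min_le[OF fin, of i] by (auto simp: p_def)
  have "q \<le> p + int n"
  proof (rule ccontr)
    assume "\<not> q \<le> p + int n"
    then have pq: "q > p + int n" by simp
    show False
    proof (cases "ob X p = zero_mod")
      case False
      then have Xq: "ob X q = zero_mod"
        using triv_idem_band[OF band XC tX, of p] pq by auto
      then have Yq: "ob Y q \<noteq> zero_mod" using qI by (simp add: I_def)
      then have Y0: "ob Y i = zero_mod" if "i \<le> p" for i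
        using triv_idem_band[OF band YC tY, of p] pq that by auto
      have "ob Y q = zero_mod"
        by (rule irr_lower_source[OF band f tX nX nY _ _ False Y0])
          (use I pI low pq Xq in \<open>auto simp: I_def\<close>)
      with Yq show False ..
    next
      case True
      then have Yp: "ob Y p \<noteq> zero_mod" using pI by (simp add: I_def)
      then have Yq: "ob Y q = zero_mod"
        using triv_idem_band[OF band YC tY, of p] pq by auto
      then have Xq: "ob X q \<noteq> zero_mod" using qI by (simp add: I_def)
      have X0: "ob X i = zero_mod" if "i < p + 1" for i
        using True low[of i] that by (cases "i = p") (auto simp: I_def)
      \<comment> \<open>The inclusion of this subcomplex is no retraction because \<open>Y\<close>
        is nonzero in degree \<open>p\<close>, and \<open>f\<close> into it is no section because in
        degree \<open>q\<close> the source is nonzero and the target is zero.\<close>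
      let ?W = "trunc_ge (p + 1) Y"
      have "lo \<le> p + 1" using pI I by auto
      then have WC: "?W \<in> CI lo hi"
        using CI_mono[OF CI_trunc_ge[OF YC]] by auto
      note W = CI_proj_complex[OF WC]
      have f': "f \<in> chain_maps X ?W"
        using chain_to_trunc_ge_iff[OF X Y X0] fc by blast
      have i: "cid ?W \<in> chain_maps ?W Y" by (rule trunc_ge_incl[OF Y])
      have "f = cid ?W \<odot> f"
        using gmaps_id_left[OF X W chain_gmaps[OF f']] by simp
      then have "is_retraction ?W Y (cid ?W) \<or> is_section X ?W f"
        using f WC f' i unfolding irr_def by blast
      then show False
      proof
        assume "is_retraction ?W Y (cid ?W)"
        then obtain s where "s \<in> chain_maps Y ?W" "cid ?W \<odot> s = cid Y"
          by (auto simp: is_retraction_def)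
        then have "cid Y p x = 0" for x
          using gmaps_into_zero[of s Y ?W p] gmaps_0[OF W W cid_gmaps[OF W]] chain_gmaps[of s Y ?W]
          by (metis ccomp_apply ob_trunc_ge less_add_one linorder_not_le)
        then have "id_mod (ob Y p) = (\<lambda>_. 0)" by (auto simp: cid_def)
        with Yp id_mod_zero_iff[OF cpx_mod[OF Y]] show False by blast
      next
        assume "is_section X ?W f"
        then obtain r where r: "r \<in> chain_maps ?W X" "r \<odot> f = cid X"
          by (auto simp: is_section_def)
        have "cid X q x = 0" for x
          using gmaps_into_zero[OF chain_gmaps[OF fc] Yq] gmaps_0[OF W X chain_gmaps[OF r(1)]] r(2)
          by (metis ccomp_apply)
        then have "id_mod (ob X q) = (\<lambda>_. 0)" by (auto simp: cid_def)
        with Xq id_mod_zero_iff[OF cpx_mod[OF X]] show False by blast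
      qed
    qed
  qed
  then obtain a where a: "lo \<le> a" "a + int n \<le> hi" "\<And>i. i \<notin> {a..a + int n} \<Longrightarrow> i \<notin> I"
    using support_bounds[OF fin ne I hl] unfolding p_def q_def by blast
  then show ?thesis
    using X Y by (intro that[of a]) (auto simp: CI_def I_def)
qed

subsection \<open>Almost split sequences\<close>

definition lasplit :: "int \<Rightarrow> int \<Rightarrow> ('a::ring_1, 'm::zero) cpx \<Rightarrow> ('a, 'm) cpx \<Rightarrow> 'm cmap \<Rightarrow> bool" where
  "lasplit lo hi X Y f \<longleftrightarrow>
     X \<in> CI lo hi \<and> Y \<in> CI lo hi \<and> f \<in> chain_maps X Y \<and> \<not> is_section X Y f \<and>
     (\<forall>W\<in>CI lo hi. \<forall>w\<in>chain_maps X W.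
        \<not> is_section X W w \<longrightarrow> (\<exists>v\<in>chain_maps Y W. w = v \<odot> f))"

definition rasplit :: "int \<Rightarrow> int \<Rightarrow> ('a::ring_1, 'm::zero) cpx \<Rightarrow> ('a, 'm) cpx \<Rightarrow> 'm cmap \<Rightarrow> bool" where
  "rasplit lo hi Y Z g \<longleftrightarrow>
     Y \<in> CI lo hi \<and> Z \<in> CI lo hi \<and> g \<in> chain_maps Y Z \<and> \<not> is_retraction Y Z g \<and>
     (\<forall>W\<in>CI lo hi. \<forall>w\<in>chain_maps W Z.
        \<not> is_retraction W Z w \<longrightarrow> (\<exists>v\<in>chain_maps W Y. w = g \<odot> v))"

definition ass ::
  "int \<Rightarrow> int \<Rightarrow> ('a::ring_1, 'm::zero) cpx \<Rightarrow> ('a, 'm) cpx \<Rightarrow> ('a, 'm) cpx \<Rightarrow> 'm cmap \<Rightarrow> 'm cmap \<Rightarrow> bool" where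
  "ass lo hi X Y Z f g \<longleftrightarrow>
     (\<forall>i. split_exact (ob X i) (ob Y i) (ob Z i) (f i) (g i)) \<and>
     lasplit lo hi X Y f \<and> left_minimal Y f \<and> rasplit lo hi Y Z g \<and> right_minimal Y g"

lemma ass_mono:
  assumes "ass lo hi X Y Z f g" "lo \<le> a" "b \<le> hi" "X \<in> CI a b" "Y \<in> CI a b" "Z \<in> CI a b"
  shows "ass a b X Y Z f g"
  using assms CI_mono[of _ a b lo hi] unfolding ass_def lasplit_def rasplit_def by blast

text \<open>An idempotent with a left inverse is the identity. So for a nontrivial \<open>e\<close>
  neither \<open>e\<close> nor \<open>1 - e\<close> is a section, both factor through
  \<open>f\<close>, and the sum of the two factorizations makes \<open>f\<close> a section.\<close>

lemma triv_idem_lasplit: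
  assumes "lasplit lo hi X Y f"
  shows "triv_idem X"
  unfolding triv_idem_def
proof (intro ballI impI)
  fix e assume e: "e \<in> chain_maps X X" "e \<odot> e = e"
  have XC: "X \<in> CI lo hi" and YC: "Y \<in> CI lo hi" and f: "f \<in> chain_maps X Y" and ns: "\<not> is_section X Y f"
    and las: "\<And>w. w \<in> chain_maps X X \<Longrightarrow> \<not> is_section X X w \<Longrightarrow> \<exists>v\<in>chain_maps Y X. w = v \<odot> f"
    using assms by (auto simp: lasplit_def)
  note X = CI_proj_complex[OF XC] and Y = CI_proj_complex[OF YC]
  note id = cid_gmaps[OF X] and eg = chain_gmaps[OF e(1)]
  have sec: "w = cid X" if w: "w \<in> chain_maps X X" "w \<odot> w = w" "is_section X X w" for w
  proof -
    obtain g where g: "g \<in> chain_maps X X" "g \<odot> w = cid X" using w(3) by (auto simp: is_section_def)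
    have "w = (g \<odot> w) \<odot> w" by (simp only: g(2) gmaps_id_left[OF X X chain_gmaps[OF w(1)]])
    also have "\<dots> = g \<odot> (w \<odot> w)" by (rule ccomp_assoc)
    finally show ?thesis by (simp only: w(2) g(2))
  qed
  let ?e = "csub X (cid X) e"
  have e': "?e \<in> chain_maps X X" "?e \<odot> ?e = ?e"
    using chain_sub[OF X X chain_id[OF X] e(1)] idem_complement(1)[OF X eg e(2)] by simp_all
  show "e = czero \<or> e = cid X"
  proof (rule ccontr)
    assume c: "\<not> (e = czero \<or> e = cid X)"
    then have "?e \<noteq> cid X" using csub_eq_left[OF X X id eg] by blast
    then obtain v v' where v: "v \<in> chain_maps Y X" "e = v \<odot> f" "v' \<in> chain_maps Y X" "?e = v' \<odot> f"
      using las[OF e(1)] las[OF e'(1)] sec[OF e] sec[OF e'] c by blast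
    have "cadd X v v' \<odot> f = cid X"
      using cadd_csub[OF X X id eg] by (simp only: cadd_comp v(2,4)[symmetric])
    then show False
      using ns chain_add[OF Y X v(1,3)] by (auto simp: is_section_def)
  qed
qed

lemma triv_idem_rasplit:
  assumes "rasplit lo hi Y Z g"
  shows "triv_idem Z"
  unfolding triv_idem_def
proof (intro ballI impI)
  fix e assume e: "e \<in> chain_maps Z Z" "e \<odot> e = e"
  have ZC: "Z \<in> CI lo hi" and YC: "Y \<in> CI lo hi" and g: "g \<in> chain_maps Y Z" and nr: "\<not> is_retraction Y Z g"
    and ras: "\<And>w. w \<in> chain_maps Z Z \<Longrightarrow> \<not> is_retraction Z Z w \<Longrightarrow> \<exists>v\<in>chain_maps Z Y. w = g \<odot> v"
    using assms by (auto simp: rasplit_def)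
  note Z = CI_proj_complex[OF ZC] and Y = CI_proj_complex[OF YC]
  note id = cid_gmaps[OF Z] and eg = chain_gmaps[OF e(1)]
  have ret: "w = cid Z" if w: "w \<in> chain_maps Z Z" "w \<odot> w = w" "is_retraction Z Z w" for w
  proof -
    obtain s where s: "s \<in> chain_maps Z Z" "w \<odot> s = cid Z" using w(3) by (auto simp: is_retraction_def)
    have "w = w \<odot> (w \<odot> s)" by (simp only: s(2) gmaps_id_right[OF Z Z chain_gmaps[OF w(1)]])
    also have "\<dots> = (w \<odot> w) \<odot> s" by (rule ccomp_assoc[symmetric])
    finally show ?thesis by (simp only: w(2) s(2))
  qed
  let ?e = "csub Z (cid Z) e"
  have e': "?e \<in> chain_maps Z Z" "?e \<odot> ?e = ?e"
    using chain_sub[OF Z Z chain_id[OF Z] e(1)] idem_complement(1)[OF Z eg e(2)] by simp_all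
  show "e = czero \<or> e = cid Z"
  proof (rule ccontr)
    assume c: "\<not> (e = czero \<or> e = cid Z)"
    then have "?e \<noteq> cid Z" using csub_eq_left[OF Z Z id eg] by blast
    then obtain v v' where v: "v \<in> chain_maps Z Y" "e = g \<odot> v" "v' \<in> chain_maps Z Y" "?e = g \<odot> v'"
      using ras[OF e(1)] ras[OF e'(1)] ret[OF e] ret[OF e'] c by blast
    have "g \<odot> cadd Y v v' = cid Z"
      using cadd_csub[OF Z Z id eg] comp_cadd[OF Z Y chain_gmaps[OF v(1)] chain_gmaps[OF v(3)] chain_gmaps[OF g]]
      by (simp only: v(2,4)[symmetric])
    then show False
      using nr chain_add[OF Z Y v(1,3)] by (auto simp: is_retraction_def)
  qed
qed

text \<open>For \<open>g\<close> the argument is that of \<open>irr_extend_right\<close>. For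
  \<open>f\<close> the condition is on \<open>Z\<close> rather than on the middle term: the
  obstruction for a map from \<open>Y\<close> vanishes on the image of \<open>f\<close>, hence
  factors through \<open>Z\<close>.\<close>

lemma ass_extend_right:
  assumes s: "ass a N X Y Z f g" and out: "no_map_out Z N" and b: "N \<le> b"
  shows "ass a b X Y Z f g"
proof -
  have las: "lasplit a N X Y f" and ras: "rasplit a N Y Z g"
    and ex: "split_exact (ob X i) (ob Y i) (ob Z i) (f i) (g i)" for i
    using s by (simp_all add: ass_def)
  have XC: "X \<in> CI a N" and YC: "Y \<in> CI a N" and ZC: "Z \<in> CI a N" and f: "f \<in> chain_maps X Y" and g: "g \<in> chain_maps Y Z"
    using las ras by (simp_all add: lasplit_def rasplit_def)
  note X = CI_proj_complex[OF XC] and Y = CI_proj_complex[OF YC] and Z = CI_proj_complex[OF ZC]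
  have X0: "ob X i = zero_mod" if "i > N" for i using CI_zero[OF XC] that by blast
  have Y0: "ob Y i = zero_mod" if "i > N" for i using CI_zero[OF YC] that by blast
  have Z0: "ob Z i = zero_mod" if "i > N" for i using CI_zero[OF ZC] that by blast
  have L: "\<exists>v\<in>chain_maps Y W. w = v \<odot> f"
    if WC: "W \<in> CI a b" and w: "w \<in> chain_maps X W" and ns: "\<not> is_section X W w" for W w
  proof -
    note W = CI_proj_complex[OF WC]
    let ?W = "trunc_le N W"
    have "\<not> is_section X ?W w"
      using ns chain_from_trunc_le_iff[OF X W X0] by (auto simp: is_section_def)
    then obtain v where v: "v \<in> chain_maps Y ?W" "w = v \<odot> f"
      using las CI_trunc_le[OF WC] chain_to_trunc_le[OF X W w X0] unfolding lasplit_def by blast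
    have vN: "v N \<in> mod_hom (ob Y N) (ob W N)"
      using chain_hom[OF v(1), of N] by (simp add: ob_trunc_le)
    \<comment> \<open>The obstruction to lifting \<open>v\<close> from the truncation to
      \<open>W\<close>.\<close>
    define y where "y = diff W N \<circ> v N"
    have y: "y \<in> mod_hom (ob Y N) (ob W (N + 1))"
      unfolding y_def by (rule hom_comp[OF vN cpx_diff[OF W] cpx_mod[OF W] cpx_mod[OF W]])
    have yf: "y (f N x) = 0" for x
    proof -
      have "y (f N x) = w (N + 1) (diff X N x)"
        using chain_comm[OF w, of N x] by (simp add: y_def v(2))
      then show ?thesis using gmaps_from_zero[OF chain_gmaps[OF w] W X0] by simp
    qed
    have yd: "y (diff Y (N - 1) x) = 0" for x
      by (simp add: y_def chain_comm'[OF v(1), symmetric] diff_trunc_le cpx_dd'[OF W])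
    \<comment> \<open>A splitting of \<open>g\<close> in degree \<open>N\<close> lets the
      obstruction descend to \<open>Z\<close> as \<open>y \<circ> t\<close>.\<close>
    obtain t where t: "t \<in> mod_hom (ob Z N) (ob Y N)" "g N \<circ> t = id_mod (ob Z N)"
      using ex[of N] by (auto simp: split_exact_def)
    have ker: "u \<in> f N ` mcarrier (ob X N)" if "u \<in> mcarrier (ob Y N)" "g N u = 0" for u
      using ex[of N] that by (auto simp: split_exact_def)
    have yt: "y u = y (t (g N u))" if u: "u \<in> mcarrier (ob Y N)" for u
    proof -
      note r = rmod_simps[OF cpx_mod[OF Y]] rmod_simps[OF cpx_mod[OF Z]] rmod_simps[OF cpx_mod[OF W]]
      have gu: "g N u \<in> mcarrier (ob Z N)" using u gmaps_in[OF chain_gmaps[OF g]] by blast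
      note tu = hom_in[OF t(1) gu]
      have gt: "g N (t (g N u)) = g N u" using fun_cong[OF t(2), of "g N u"] gu by (simp add: id_mod_def)
      let ?d = "madd (ob Y N) u (mact (ob Y N) (t (g N u)) (- 1))"
      have gd: "g N ?d = 0"
        using u tu gu by (simp add: hom_madd[OF chain_hom[OF g]] hom_mact[OF chain_hom[OF g]] gt r)
      have d: "?d \<in> mcarrier (ob Y N)" using u tu by (simp add: r)
      obtain x where "?d = f N x" using ker[OF d gd] by (rule imageE)
      then have "y ?d = 0" by (simp only: yf)
      then have "madd (ob W (N + 1)) (y u) (mact (ob W (N + 1)) (y (t (g N u))) (- 1)) = 0"
        using u tu by (simp add: hom_madd[OF y] hom_mact[OF y] r)
      then have "mact (ob W (N + 1)) (y (t (g N u))) (- 1) = mact (ob W (N + 1)) (y u) (- 1)"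
        using u tu by (simp add: madd_eq_0_iff[OF cpx_mod[OF W]] r hom_in[OF y])
      then have "mact (ob W (N + 1)) (mact (ob W (N + 1)) (y (t (g N u))) (- 1)) (- 1)
          = mact (ob W (N + 1)) (mact (ob W (N + 1)) (y u) (- 1)) (- 1)" by simp
      then show ?thesis using u tu by (simp add: r hom_in[OF y])
    qed
    have "y \<circ> t = (\<lambda>_. 0)"
    proof -
      have yt_hom: "y \<circ> t \<in> mod_hom (ob Z N) (ob W (N + 1))"
        by (rule hom_comp[OF t(1) y cpx_mod[OF Y] cpx_mod[OF W]])
      moreover have "(y \<circ> t) \<circ> diff Z (N - 1) = (\<lambda>_. 0)"
      proof (rule hom_ext[OF hom_comp[OF cpx_diff'[OF Z] yt_hom cpx_mod[OF Z] cpx_mod[OF W]] zero_hom[OF cpx_mod[OF W]]])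
        fix x assume "x \<in> mcarrier (ob Z (N - 1))"
        moreover have "g (N - 1) ` mcarrier (ob Y (N - 1)) = mcarrier (ob Z (N - 1))"
          using ex[of "N - 1"] by (simp add: split_exact_def)
        ultimately obtain u where u: "u \<in> mcarrier (ob Y (N - 1))" "x = g (N - 1) u"
          by blast
        have "y (t (diff Z (N - 1) x)) = y (t (g N (diff Y (N - 1) u)))"
          using chain_comm'[OF g, of N u] by (simp add: u(2))
        also have "\<dots> = y (diff Y (N - 1) u)"
          using yt[of "diff Y (N - 1) u"] hom_in[OF cpx_diff'[OF Y] u(1)] by simp
        finally show "((y \<circ> t) \<circ> diff Z (N - 1)) x = 0" by (simp add: yd)
      qed
      ultimately show ?thesis
        using out cpx_fg[OF W] unfolding no_map_out_def by blast
    qed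
    then have "y (t z) = 0" for z by (simp add: fun_eq_iff)
    then have "y u = 0" for u
      using yt[of u] hom_outside[OF y, of u] by metis
    then have "v \<in> chain_maps Y W"
      by (intro chain_to_trunc_le_lift[OF Y W v(1) Y0]) (simp_all add: y_def)
    with v(2) show ?thesis by blast
  qed
  have R: "\<exists>v\<in>chain_maps W Y. w = g \<odot> v"
    if WC: "W \<in> CI a b" and w: "w \<in> chain_maps W Z" and nr: "\<not> is_retraction W Z w" for W w
  proof -
    note W = CI_proj_complex[OF WC]
    let ?W = "trunc_le N W"
    have "\<not> is_retraction ?W Z w"
    proof
      assume "is_retraction ?W Z w"
      then obtain t where t: "t \<in> chain_maps Z ?W" "w \<odot> t = cid Z"
        by (auto simp: is_retraction_def)
      have "t \<in> chain_maps Z W" by (rule no_map_out_lift[OF Z W t(1) Z0 out])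
      with t(2) nr show False by (auto simp: is_retraction_def)
    qed
    then obtain v where "v \<in> chain_maps ?W Y" "w = g \<odot> v"
      using ras CI_trunc_le[OF WC] chain_from_trunc_le_iff[OF Z W Z0] w unfolding rasplit_def by blast
    then show ?thesis using chain_from_trunc_le_iff[OF Y W Y0] by blast
  qed
  show ?thesis
    using s L R CI_mono[OF XC order_refl b] CI_mono[OF YC order_refl b] CI_mono[OF ZC order_refl b]
    unfolding ass_def lasplit_def rasplit_def by blast
qed

text \<open>Here \<open>f\<close> is the easier side. The obstruction for a map into
  \<open>Y\<close> is killed by \<open>g\<close>, so it comes from a map into \<open>X\<close>, to
  which \<open>no_map_in\<close> applies.\<close>

lemma ass_extend_left:
  assumes s: "ass a N X Y Z f g" and nin: "no_map_in X a" and b: "b \<le> a"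
  shows "ass b N X Y Z f g"
proof -
  have las: "lasplit a N X Y f" and ras: "rasplit a N Y Z g"
    and ex: "split_exact (ob X i) (ob Y i) (ob Z i) (f i) (g i)" for i
    using s by (simp_all add: ass_def)
  have XC: "X \<in> CI a N" and YC: "Y \<in> CI a N" and ZC: "Z \<in> CI a N" and f: "f \<in> chain_maps X Y" and g: "g \<in> chain_maps Y Z"
    using las ras by (simp_all add: lasplit_def rasplit_def)
  note X = CI_proj_complex[OF XC] and Y = CI_proj_complex[OF YC] and Z = CI_proj_complex[OF ZC]
  have X0: "ob X i = zero_mod" if "i < a" for i using CI_zero[OF XC] that by blast
  have Y0: "ob Y i = zero_mod" if "i < a" for i using CI_zero[OF YC] that by blast
  have Z0: "ob Z i = zero_mod" if "i < a" for i using CI_zero[OF ZC] that by blast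
  have inj: "x = x'" if "f i x = f i x'" "x \<in> mcarrier (ob X i)" "x' \<in> mcarrier (ob X i)" for i x x'
    using ex[of i] that by (auto simp: split_exact_def dest: inj_onD)
  have L: "\<exists>v\<in>chain_maps Y W. w = v \<odot> f"
    if WC: "W \<in> CI b N" and w: "w \<in> chain_maps X W" and ns: "\<not> is_section X W w" for W w
  proof -
    note W = CI_proj_complex[OF WC]
    let ?W = "trunc_ge a W"
    have "\<not> is_section X ?W w"
    proof
      assume "is_section X ?W w"
      then obtain r where r: "r \<in> chain_maps ?W X" "r \<odot> w = cid X"
        by (auto simp: is_section_def)
      have "r \<in> chain_maps W X" by (rule no_map_in_lift[OF X W r(1) X0 nin])
      with r(2) ns show False by (auto simp: is_section_def)
    qed
    then obtain v where "v \<in> chain_maps Y ?W" "w = v \<odot> f"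
      using las CI_trunc_ge[OF WC] chain_to_trunc_ge_iff[OF X W X0] w unfolding lasplit_def by blast
    then show ?thesis using chain_to_trunc_ge_iff[OF Y W Y0] by blast
  qed
  have R: "\<exists>v\<in>chain_maps W Y. w = g \<odot> v"
    if WC: "W \<in> CI b N" and w: "w \<in> chain_maps W Z" and nr: "\<not> is_retraction W Z w" for W w
  proof -
    note W = CI_proj_complex[OF WC]
    let ?W = "trunc_ge a W"
    have "\<not> is_retraction ?W Z w"
      using nr chain_to_trunc_ge_iff[OF Z W Z0] by (auto simp: is_retraction_def)
    then obtain v where v: "v \<in> chain_maps ?W Y" "w = g \<odot> v"
      using ras CI_trunc_ge[OF WC] chain_from_trunc_ge[OF Z W w Z0] unfolding rasplit_def by blast
    have va: "v a \<in> mod_hom (ob W a) (ob Y a)"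
      using chain_hom[OF v(1), of a] by (simp add: ob_trunc_ge)
    define y where "y = v a \<circ> diff W (a - 1)"
    have y: "y \<in> mod_hom (ob W (a - 1)) (ob Y a)"
      unfolding y_def by (rule hom_comp[OF cpx_diff'[OF W] va cpx_mod[OF W] cpx_mod[OF Y]])
    have gy: "g a (y u) = 0" for u
    proof -
      have "g a (y u) = diff Z (a - 1) (w (a - 1) u)"
        using chain_comm'[OF w, of a u] by (simp add: y_def v(2))
      then show ?thesis
        using gmaps_into_zero[OF chain_gmaps[OF w] Z0[of "a - 1"]] hom_0[OF cpx_diff[OF Z] cpx_mod[OF Z] cpx_mod[OF Z]]
        by simp
    qed
    have yd: "diff Y a (y u) = 0" for u
      using chain_comm[OF v(1), of a] cpx_dd'[OF W, of a]
        gmaps_0[OF proj_complex_trunc_ge[OF W] Y chain_gmaps[OF v(1)]]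
      by (simp add: y_def diff_trunc_ge)
    \<comment> \<open>The unique lift of \<open>y\<close> through the injective \<open>f a\<close>,
      with the value \<open>0\<close> outside the module by convention.\<close>
    define x where "x u = (if u \<in> mcarrier (ob W (a - 1)) then inv_into (mcarrier (ob X a)) (f a) (y u) else 0)" for u
    have x: "x u \<in> mcarrier (ob X a)" "f a (x u) = y u" if "u \<in> mcarrier (ob W (a - 1))" for u
    proof -
      have "y u \<in> f a ` mcarrier (ob X a)"
        using ex[of a] gy hom_in[OF y that] by (auto simp: split_exact_def)
      then show "x u \<in> mcarrier (ob X a)" "f a (x u) = y u"
        using that by (simp_all add: x_def inv_into_into f_inv_into_f)
    qed
    note rW = rmod_simps[OF cpx_mod[OF W]] and rX = rmod_simps[OF cpx_mod[OF X]]
    note fh = chain_hom[OF f, of a]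
    have xh: "x \<in> mod_hom (ob W (a - 1)) (ob X a)"
    proof (rule mod_homI)
      show "x (madd (ob W (a - 1)) u u') = madd (ob X a) (x u) (x u')"
        if "u \<in> mcarrier (ob W (a - 1))" "u' \<in> mcarrier (ob W (a - 1))" for u u'
        using that by - (rule inj[of a], simp_all add: x rW rX hom_madd[OF fh] hom_madd[OF y])
      show "x (mact (ob W (a - 1)) u c) = mact (ob X a) (x u) c"
        if "u \<in> mcarrier (ob W (a - 1))" for u c
        using that by - (rule inj[of a], simp_all add: x rW rX hom_mact[OF fh] hom_mact[OF y])
    qed (simp_all add: x, simp add: x_def)
    have "diff X a \<circ> x = (\<lambda>_. 0)"
    proof (rule hom_ext[OF hom_comp[OF xh cpx_diff[OF X] cpx_mod[OF X] cpx_mod[OF X]] zero_hom[OF cpx_mod[OF X]]])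
      fix u assume u: "u \<in> mcarrier (ob W (a - 1))"
      show "(diff X a \<circ> x) u = 0"
      proof (rule inj[of "a + 1"])
        show "f (a + 1) ((diff X a \<circ> x) u) = f (a + 1) 0"
          using chain_comm[OF f, of a "x u"] x(2)[OF u] yd gmaps_0[OF X Y chain_gmaps[OF f]] by simp
      qed (simp_all add: hom_in[OF cpx_diff[OF X] x(1)[OF u]] zero_in_carrier[OF cpx_mod[OF X]])
    qed
    then have "x = (\<lambda>_. 0)"
      using nin xh cpx_fg[OF W] unfolding no_map_in_def by blast
    then have "y u = 0" for u
      using x(2)[of u] hom_outside[OF y, of u] gmaps_0[OF X Y chain_gmaps[OF f]] by metis
    then have "v \<in> chain_maps W Y"
      by (intro chain_from_trunc_ge_lift[OF Y W v(1) Y0]) (simp_all add: y_def)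
    with v(2) show ?thesis by blast
  qed
  show ?thesis
    using s L R CI_mono[OF XC b order_refl] CI_mono[OF YC b order_refl] CI_mono[OF ZC b order_refl]
    unfolding ass_def lasplit_def rasplit_def by blast
qed

text \<open>The endomorphism \<open>v k + (1 - e)\<close> below fixes \<open>g\<close>, so it is invertible and \<open>k\<close> is a split
  monomorphism in degree \<open>p\<close>.\<close>

lemma (in pairing) ass_lower_middle:
  fixes X Y Z :: "('a::ring_1, 'm) cpx"
  assumes band: "band_splitting TYPE(('a, 'm) cpx) n" and s: "ass lo hi X Y Z f g" and lo: "lo \<le> p"
    and Y0: "\<And>i. i < p \<Longrightarrow> ob Y i = zero_mod" and Z0: "\<And>i. i \<le> p \<Longrightarrow> ob Z i = zero_mod"
    and Yp: "ob Y p \<noteq> zero_mod" and e: "e \<in> chain_maps Y Y" and ep: "e p = id_mod (ob Y p)"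
    and q: "q \<ge> p + int n" and z: "\<And>y. z (g q (e q y)) = 0" and z0: "u \<in> mcarrier (ob Z q)" "z u \<noteq> 0"
  shows False
proof -
  have ras: "rasplit lo hi Y Z g" and mn: "right_minimal Y g" using s by (simp_all add: ass_def)
  have YC: "Y \<in> CI lo hi" and ZC: "Z \<in> CI lo hi" and g: "g \<in> chain_maps Y Z"
    using ras by (simp_all add: rasplit_def)
  note Y = CI_proj_complex[OF YC] and Z = CI_proj_complex[OF ZC]
  note gg = chain_gmaps[OF g] and eg = chain_gmaps[OF e] and id = cid_gmaps[OF Y]
  \<comment> \<open>The factorization is taken of \<open>g \<odot> e\<close>: \<open>g\<close> is
    onto in every degree, so a bound by the image of \<open>g\<close> would say nothing, while
    \<open>z\<close> shows that \<open>g \<odot> e\<close> misses \<open>u\<close> in degree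
    \<open>q\<close>.\<close>
  have ge: "g \<odot> e \<in> chain_maps Y Z" by (rule chain_comp[OF Y Y e Z g])
  obtain W k h where W: "W \<in> CI lo hi" and k: "k \<in> chain_maps Y W" and h: "h \<in> chain_maps W Z" and hk: "g \<odot> e = h \<odot> k"
    and im: "\<forall>i\<ge>p + int n. \<forall>w\<in>mcarrier (ob W i). \<exists>x\<in>mcarrier (ob Y i). h i w = (g \<odot> e) i x"
    and sec: "\<forall>r\<in>mod_hom (ob W p) (ob Y p). r \<circ> k p = id_mod (ob Y p) \<longrightarrow>
       (\<exists>d\<in>chain_maps Y Y. d \<odot> d = d \<and> d p = id_mod (ob Y p) \<and> (g \<odot> e) \<odot> d = czero)"
    using cone_factorization[OF band YC ZC ge lo Y0 Z0] by blast
  note W' = CI_proj_complex[OF W]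
  have aut: "x = 0" if d: "d \<in> chain_maps Y Y" "g \<odot> d = g" "x \<in> mcarrier (ob Y i)" "d i x = 0" for d i x
  proof -
    obtain d' where d': "d' \<in> chain_maps Y Y" "d' \<odot> d = cid Y"
      using mn d(1,2) unfolding right_minimal_def is_automorphism_def by blast
    have "x = d' i (d i x)" using d'(2) d(3) by (metis ccomp_apply cid_apply)
    then show ?thesis using d(4) gmaps_0[OF Y Y chain_gmaps[OF d'(1)]] by simp
  qed
  have "\<not> is_retraction W Z h"
  proof
    assume "is_retraction W Z h"
    then obtain t where t: "t \<in> chain_maps Z W" "h \<odot> t = cid Z" by (auto simp: is_retraction_def)
    have "h q (t q u) = u" using t(2) z0(1) by (metis ccomp_apply cid_apply)
    moreover obtain x where "h q (t q u) = (g \<odot> e) q x"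
      using im q gmaps_in[OF chain_gmaps[OF t(1)] z0(1)] by blast
    ultimately show False using z z0(2) by (metis ccomp_apply)
  qed
  then obtain v where v: "v \<in> chain_maps W Y" "h = g \<odot> v"
    using ras W h unfolding rasplit_def by blast
  have vk: "v \<odot> k \<in> chain_maps Y Y" by (rule chain_comp[OF Y W' k Y v(1)])
  let ?w = "cadd Y (v \<odot> k) (csub Y (cid Y) e)"
  have c: "csub Y (cid Y) e \<in> chain_maps Y Y" by (rule chain_sub[OF Y Y chain_id[OF Y] e])
  have w: "?w \<in> chain_maps Y Y" by (rule chain_add[OF Y Y vk c])
  have "g \<odot> ?w = cadd Z (g \<odot> e) (csub Z g (g \<odot> e))"
    by (simp only: comp_cadd[OF Y Y chain_gmaps[OF vk] chain_gmaps[OF c] gg] comp_csub[OF Y Y id eg gg]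
        gmaps_id_right[OF Y Z gg] hk ccomp_assoc[symmetric] v(2))
  also have "\<dots> = g" by (rule cadd_csub[OF Y Z gg chain_gmaps[OF ge]])
  finally have "is_automorphism Y ?w" using mn w by (simp add: right_minimal_def)
  then obtain w' where w': "w' \<in> chain_maps Y Y" "w' \<odot> ?w = cid Y" by (auto simp: is_automorphism_def)
  have "w' p (v p (k p x)) = x" if x: "x \<in> mcarrier (ob Y p)" for x
  proof -
    have "?w p x = v p (k p x)"
      using x gmaps_in[OF chain_gmaps[OF vk] x]
      by (simp add: ep id_mod_def rmod_simps[OF cpx_mod[OF Y]])
    then show ?thesis using w'(2) x by (metis ccomp_apply cid_apply)
  qed
  moreover have up: "w' p \<circ> v p \<in> mod_hom (ob W p) (ob Y p)"
    by (rule hom_comp[OF chain_hom[OF v(1)] chain_hom[OF w'(1)] cpx_mod[OF Y] cpx_mod[OF Y]])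
  ultimately have "(w' p \<circ> v p) \<circ> k p = id_mod (ob Y p)"
    by (intro hom_ext[OF hom_comp[OF chain_hom[OF k] up cpx_mod[OF W'] cpx_mod[OF Y]] id_mod_hom[OF cpx_mod[OF Y]]])
      (simp add: id_mod_def)
  then obtain d where d: "d \<in> chain_maps Y Y" "d p = id_mod (ob Y p)" "(g \<odot> e) \<odot> d = czero"
    using sec up by blast
  have ed: "e \<odot> d \<in> chain_maps Y Y" by (rule chain_comp[OF Y Y d(1) Y e])
  \<comment> \<open>\<open>1 - e d\<close> fixes \<open>g\<close> and vanishes in degree
    \<open>p\<close>, which right minimality forbids unless \<open>Y\<close> is zero there.\<close>
  let ?c = "csub Y (cid Y) (e \<odot> d)"
  have "g \<odot> ?c = csub Z g czero"
    using d(3) by (simp only: comp_csub[OF Y Y id chain_gmaps[OF ed] gg] gmaps_id_right[OF Y Z gg] ccomp_assoc)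
  then have gc: "g \<odot> ?c = g" using csub_zero[OF Y Z gg] by simp
  have "ob Y p = zero_mod"
  proof (rule hom_zero_mod_carrier[OF cpx_mod[OF Y]])
    fix x assume x: "x \<in> mcarrier (ob Y p)"
    have "?c p x = 0"
      using x by (simp add: d(2) ep id_mod_def rmod_simps[OF cpx_mod[OF Y]])
    with aut[OF chain_sub[OF Y Y chain_id[OF Y] ed] gc x] show "x = 0" .
  qed
  with Yp show False ..
qed

text \<open>Hence the support of the middle term is the joint support of the sequence.\<close>

lemma split_exact_middle_zero:
  assumes "split_exact A B C f g" "right_module A" "right_module B" "right_module C"
  shows "B = zero_mod \<longleftrightarrow> A = zero_mod \<and> C = zero_mod"
proof
  have h: "f \<in> mod_hom A B" "g \<in> mod_hom B C" "inj_on f (mcarrier A)" "f ` mcarrier A = {y \<in> mcarrier B. g y = 0}"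
    "g ` mcarrier B = mcarrier C"
    using assms(1) by (auto simp: split_exact_def)
  {
    assume B: "B = zero_mod"
    have "x = 0" if "x \<in> mcarrier A" for x
      using inj_onD[OF h(3), of x 0] hom_in[OF h(1) that] hom_0[OF h(1) assms(2,3)] zero_in_carrier[OF assms(2)] that B
      by (simp add: mcarrier_zero_mod)
    moreover have "mcarrier C = {0}"
      using h(5) B hom_0[OF h(2) assms(3,4)] by (simp add: mcarrier_zero_mod)
    ultimately show "A = zero_mod \<and> C = zero_mod"
      using hom_zero_mod_carrier[OF assms(2)] zero_mod_iff[OF assms(4)] by blast
  }
  {
    assume AC: "A = zero_mod \<and> C = zero_mod"
    show "B = zero_mod"
    proof (rule hom_zero_mod_carrier[OF assms(3)])
      fix y assume y: "y \<in> mcarrier B"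
      then have "g y = 0" using hom_in[OF h(2) y] AC by (simp add: mcarrier_zero_mod)
      with y h(4) obtain x where "x \<in> mcarrier A" "y = f x" by blast
      then show "y = 0" using AC hom_0[OF h(1) assms(2,3)] by (simp add: mcarrier_zero_mod)
    qed
  }
qed

text \<open>If both conditions fail, \<open>X\<close> is nonzero in degree \<open>a\<close>,
  \<open>Z\<close> is zero there, and some nonzero \<open>z\<close> on \<open>Z\<close> kills
  boundaries. Attaching its target to \<open>Y\<close> along \<open>z \<circ> g N\<close> produces
  the idempotent that \<open>ass_lower_middle\<close> asks for.\<close>

lemma (in pairing) ass_no_map:
  fixes X Y Z :: "('a::ring_1, 'm) cpx"
  assumes band: "band_splitting TYPE(('a, 'm) cpx) n" and N: "N = a + int n" and s: "ass a N X Y Z f g"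
  shows "no_map_out Z N \<or> no_map_in X a"
proof (rule ccontr)
  have las: "lasplit a N X Y f" and ras: "rasplit a N Y Z g"
    and ex: "split_exact (ob X i) (ob Y i) (ob Z i) (f i) (g i)" for i
    using s by (simp_all add: ass_def)
  have XC: "X \<in> CI a N" and YC: "Y \<in> CI a N" and ZC: "Z \<in> CI a N" and g: "g \<in> chain_maps Y Z"
    using las ras by (simp_all add: lasplit_def rasplit_def)
  note X = CI_proj_complex[OF XC] and Y = CI_proj_complex[OF YC] and Z = CI_proj_complex[OF ZC]
  assume c: "\<not> (no_map_out Z N \<or> no_map_in X a)"
  then have Xa: "ob X a \<noteq> zero_mod" using no_map_in_zero by blast
  have Za: "ob Z a = zero_mod"
    using c no_map_out_full[OF band ZC N triv_idem_rasplit[OF ras]] by blast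
  obtain P z where P: "fg_proj P" and z: "z \<in> mod_hom (ob Z N) P" "z \<circ> diff Z (N - 1) = (\<lambda>_. 0)" "z \<noteq> (\<lambda>_. 0)"
    using c unfolding no_map_out_def by blast
  have zg: "z \<circ> g N \<in> mod_hom (ob Y N) P"
    by (rule hom_comp[OF chain_hom[OF g] z(1) cpx_mod[OF Z] fg_proj_right_module[OF P]])
  have "(z \<circ> g N) \<circ> diff Y (N - 1) = (\<lambda>_. 0)"
    using chain_comm'[OF g, of N] z(2) by (simp add: fun_eq_iff flip: chain_comm'[OF g, of N])
  from attach_top_idem[OF band YC N P zg this]
  obtain e where e: "e \<in> chain_maps Y Y" "e a = id_mod (ob Y a)" "\<forall>x. (z \<circ> g N) (e N x) = 0" by blast
  have "\<exists>z0\<in>mcarrier (ob Z N). z z0 \<noteq> 0"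
    using hom_ext[OF z(1) zero_hom[OF fg_proj_right_module[OF P]]] z(3) by blast
  then obtain z0 where z0: "z0 \<in> mcarrier (ob Z N)" "z z0 \<noteq> 0" by blast
  have Ya: "ob Y a \<noteq> zero_mod"
    using split_exact_middle_zero[OF ex cpx_mod[OF X] cpx_mod[OF Y] cpx_mod[OF Z], of a] Xa by blast
  show False
    by (rule ass_lower_middle[OF band s, where p = a and e = e and q = N and z = z and u = z0])
      (use CI_zero[OF YC] CI_zero[OF ZC] Za N Ya e z0 in \<open>auto simp: order_le_less\<close>)
qed

text \<open>As for irreducible maps, the outer terms are narrow, so one contains degree
  \<open>p\<close> and the other \<open>q\<close>. The middle term may be wide: when
  \<open>Z\<close> starts lower, truncating \<open>Y\<close> gives a left inverse of
  \<open>f\<close> only on the truncation, and band splitting with Fitting's lemma turns it into one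
  on \<open>Y\<close>.\<close>

lemma (in pairing) ass_window:
  fixes scale :: "'k::field \<Rightarrow> 'a::ring_1 \<Rightarrow> 'a" and X Y Z :: "('a, 'm) cpx"
  assumes alg: "fin_dim_algebra scale"
    and band: "band_splitting TYPE(('a, 'm) cpx) n" and hl: "hi - lo \<ge> int n" and s: "ass lo hi X Y Z f g"
  obtains a where "lo \<le> a" "a + int n \<le> hi"
    "X \<in> CI a (a + int n)" "Y \<in> CI a (a + int n)" "Z \<in> CI a (a + int n)"
proof -
  have las: "lasplit lo hi X Y f" and ras: "rasplit lo hi Y Z g" and lm: "left_minimal Y f"
    and ex: "split_exact (ob X i) (ob Y i) (ob Z i) (f i) (g i)" for i
    using s by (simp_all add: ass_def)
  have XC: "X \<in> CI lo hi" and YC: "Y \<in> CI lo hi" and ZC: "Z \<in> CI lo hi" and f: "f \<in> chain_maps X Y" and g: "g \<in> chain_maps Y Z"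
    and ns: "\<not> is_section X Y f" and nr: "\<not> is_retraction Y Z g"
    using las ras by (simp_all add: lasplit_def rasplit_def)
  note X = CI_proj_complex[OF XC] and Y = CI_proj_complex[OF YC] and Z = CI_proj_complex[OF ZC]
  note tX = triv_idem_lasplit[OF las] and tZ = triv_idem_rasplit[OF ras]
  note yz = split_exact_middle_zero[OF ex cpx_mod[OF X] cpx_mod[OF Y] cpx_mod[OF Z]]
  define I where "I = {i. ob Y i \<noteq> zero_mod}"
  have I: "I \<subseteq> {lo..hi}" using YC by (auto simp: I_def CI_def)
  then have fin: "finite I" using finite_subset by blast
  have "\<not> null_object strict Z"
    using nr retraction_onto_zero[OF Y _ Z g] by blast
  then have ne: "I \<noteq> {}" using null_strict_iff[OF Z] yz by (auto simp: I_def)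
  define p where "p = Min I"
  define q where "q = Max I"
  have Yp: "ob Y p \<noteq> zero_mod" and Yq: "ob Y q \<noteq> zero_mod"
    using Min_in[OF fin ne] Max_in[OF fin ne] by (simp_all add: p_def q_def I_def)
  have low: "ob Y i = zero_mod" if "i < p" for i
    using that Min_le[OF fin, of i] by (auto simp: p_def I_def)
  have lop: "lo \<le> p" using Yp CI_zero[OF YC, of p] by force
  have "q \<le> p + int n"
  proof (rule ccontr)
    assume "\<not> q \<le> p + int n"
    then have pq: "q > p + int n" by simp
    obtain e where e: "e \<in> chain_maps Y Y" "\<forall>i\<le>p. e i = id_mod (ob Y i)" "\<forall>i>p + int n. \<forall>x. e i x = 0"
      using splitD[OF band YC, of p] by blast
    show False
    proof (cases "ob Z p = zero_mod")
      case True
      then have "ob X p \<noteq> zero_mod" using yz Yp by blast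
      then have "ob X q = zero_mod" using triv_idem_band[OF band XC tX, of p] pq by auto
      then have Zq: "ob Z q \<noteq> zero_mod" using yz Yq by blast
      then have Z0: "ob Z i = zero_mod" if "i \<le> p" for i
        using triv_idem_band[OF band ZC tZ, of p] pq that by auto
      obtain z0 where z0: "z0 \<in> mcarrier (ob Z q)" "z0 \<noteq> 0"
        using Zq hom_zero_mod_carrier[OF cpx_mod[OF Z]] by blast
      show False
        by (rule ass_lower_middle[OF band s lop low Z0 Yp e(1), where q = q and z = "\<lambda>x. x" and u = z0])
          (use pq e(2,3) z0 gmaps_0[OF Y Z chain_gmaps[OF g]] in auto)
    next
      case False
      then have "ob Z q = zero_mod" using triv_idem_band[OF band ZC tZ, of p] pq by auto
      then have Xq: "ob X q \<noteq> zero_mod" using yz Yq by blast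
      then have X0: "ob X i = zero_mod" if "i < p + 1" for i
        using triv_idem_band[OF band XC tX, of p] pq that by auto
      let ?W = "trunc_ge (p + 1) Y"
      have "lo \<le> p + 1" using lop by simp
      then have WC: "?W \<in> CI lo hi"
        using CI_mono[OF CI_trunc_ge[OF YC]] by auto
      note W = CI_proj_complex[OF WC]
      have toW: "d \<in> chain_maps X ?W \<longleftrightarrow> d \<in> chain_maps X Y" for d
        by (rule chain_to_trunc_ge_iff[OF X Y X0])
      \<comment> \<open>Otherwise \<open>f = v \<odot> f\<close> with \<open>v\<close> landing in
        the truncation, and left minimality makes \<open>v\<close> invertible although it kills
        degree \<open>p\<close>.\<close>
      have "is_section X ?W f"
      proof (rule ccontr)
        assume "\<not> is_section X ?W f"
        then obtain v where v: "v \<in> chain_maps Y ?W" "f = v \<odot> f"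
          using las WC f toW unfolding lasplit_def by blast
        have i: "cid ?W \<in> chain_maps ?W Y" by (rule trunc_ge_incl[OF Y])
        have vY: "v \<in> chain_maps Y Y"
          using chain_comp[OF Y W v(1) Y i] gmaps_id_left[OF Y W chain_gmaps[OF v(1)]] by simp
        then obtain v' where v': "v' \<in> chain_maps Y Y" "v' \<odot> v = cid Y"
          using lm v(2)[symmetric] unfolding left_minimal_def is_automorphism_def by blast
        have "ob Y p = zero_mod"
        proof (rule hom_zero_mod_carrier[OF cpx_mod[OF Y]])
          fix x assume "x \<in> mcarrier (ob Y p)"
          then have "x = v' p (v p x)" using v'(2) by (metis ccomp_apply cid_apply)
          then show "x = 0"
            using gmaps_into_zero[OF chain_gmaps[OF v(1)], of p] gmaps_0[OF Y Y chain_gmaps[OF v'(1)]]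
            by (simp add: ob_trunc_ge)
        qed
        with Yp show False ..
      qed
      then obtain r where r: "r \<in> chain_maps ?W X" "r \<odot> f = cid X" by (auto simp: is_section_def)
      \<comment> \<open>\<open>1 - e\<close> vanishes up to degree \<open>p\<close>, so it maps
        \<open>Y\<close> into the truncation, where \<open>r\<close> is defined.\<close>
      let ?e = "csub Y (cid Y) e"
      have e': "?e \<in> chain_maps Y Y" by (rule chain_sub[OF Y Y chain_id[OF Y] e(1)])
      have e'0: "?e i x = 0" if "i \<le> p" "x \<in> mcarrier (ob Y i)" for i x
        using that e(2) by (simp add: id_mod_def rmod_simps[OF cpx_mod[OF Y]])
      have e'z: "?e i = (\<lambda>_. 0)" if "i \<le> p" for i
        by (rule hom_ext[OF chain_hom[OF e'] zero_hom[OF cpx_mod[OF Y]] e'0[OF that]])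
      have e'W: "?e \<in> chain_maps Y ?W"
      proof (rule chain_mapsI[OF Y W])
        show "?e i \<in> mod_hom (ob Y i) (ob ?W i)" for i
          using chain_hom[OF e', of i] e'z[of i] zero_hom[OF right_module_zero_mod]
          by (cases "p + 1 \<le> i") (simp_all add: ob_trunc_ge zero_hom[OF right_module_zero_mod])
        show "diff ?W i (?e i x) = ?e (i + 1) (diff Y i x)" if "x \<in> mcarrier (ob Y i)" for i x
        proof (cases "p + 1 \<le> i")
          case True
          then show ?thesis using chain_comm[OF e', of i x] by (simp add: diff_trunc_ge)
        next
          case False
          then show ?thesis
            using chain_comm[OF e', of i x] e'z[of i] hom_0[OF cpx_diff[OF Y] cpx_mod[OF Y] cpx_mod[OF Y]]
            by (simp add: diff_trunc_ge)
        qed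
      qed
      have re: "r \<odot> ?e \<in> chain_maps Y X" by (rule chain_comp[OF Y W e'W X r(1)])
      let ?c = "(r \<odot> ?e) \<odot> f"
      have c: "?c \<in> chain_maps X X" by (rule chain_comp[OF X Y f X re])
      have cq: "?c q x = x" if "x \<in> mcarrier (ob X q)" for x
      proof -
        have "?e q (f q x) = f q x"
          using that e(3) pq gmaps_in[OF chain_gmaps[OF f] that] by (simp add: rmod_simps[OF cpx_mod[OF Y]])
        then show ?thesis using r(2) that by (metis ccomp_apply cid_apply)
      qed
      have pow: "cpow X ?c m q x = x" if "x \<in> mcarrier (ob X q)" for m x
      proof (induction m)
        case 0 then show ?case using that by simp
      next
        case (Suc m)
        have "cpow X ?c (Suc m) q x = ?c q (cpow X ?c m q x)"
          by (simp only: cpow.simps ccomp_apply)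
        then show ?case using Suc cq[OF that] by simp
      qed
      \<comment> \<open>Being the identity in the single degree \<open>q\<close> excludes
        nilpotency, and Fitting's lemma leaves invertibility.\<close>
      have "cpow X ?c m \<noteq> czero" for m
        using pow[of _ m] Xq hom_zero_mod_carrier[OF cpx_mod[OF X], of q] by (metis czero_apply)
      then have "is_automorphism X ?c"
        using fitting[OF alg XC tX c] by blast
      then obtain c' where c': "c' \<in> chain_maps X X" "c' \<odot> ?c = cid X" by (auto simp: is_automorphism_def)
      have "c' \<odot> (r \<odot> ?e) \<in> chain_maps Y X" by (rule chain_comp[OF Y X re X c'(1)])
      moreover have "(c' \<odot> (r \<odot> ?e)) \<odot> f = cid X" using c'(2) by (simp only: ccomp_assoc)
      ultimately show False using ns unfolding is_section_def by blast
    qed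
  qed
  then obtain a where a: "lo \<le> a" "a + int n \<le> hi" "\<And>i. i \<notin> {a..a + int n} \<Longrightarrow> i \<notin> I"
    using support_bounds[OF fin ne I hl] unfolding p_def q_def by blast
  then have "ob Y i = zero_mod" if "i \<notin> {a..a + int n}" for i using that by (auto simp: I_def)
  then show ?thesis
    using a(1,2) X Y Z yz by (intro that[of a]) (auto simp: CI_def)
qed

subsection \<open>Shifts by several degrees and translations\<close>

text \<open>No sign in the differential, unlike \<open>shift1\<close>: this shift has to agree with
  the translation functors on the nose.\<close>

definition sh :: "int \<Rightarrow> ('a::ring_1, 'm::zero) cpx \<Rightarrow> ('a, 'm) cpx" where
  "sh a X = \<lparr>ob = (\<lambda>i. ob X (i - a)), diff = (\<lambda>i. diff X (i - a))\<rparr>"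

definition shm :: "int \<Rightarrow> 'm cmap \<Rightarrow> 'm cmap" where
  "shm a f = (\<lambda>i. f (i - a))"

lemma ob_sh [simp]: "ob (sh a X) i = ob X (i - a)"
  by (simp add: sh_def)

lemma diff_sh [simp]: "diff (sh a X) i = diff X (i - a)"
  by (simp add: sh_def)

lemma sh_sh [simp]: "sh a (sh b X) = sh (a + b) X"
  by (simp add: sh_def algebra_simps)

lemma sh_0 [simp]: "sh 0 X = X"
  by (simp add: sh_def)

lemma shm_shm [simp]: "shm a (shm b f) = shm (a + b) f"
  by (simp add: shm_def algebra_simps)

lemma shm_0 [simp]: "shm 0 f = f"
  by (simp add: shm_def)

lemma shm_comp: "shm a (g \<odot> f) = shm a g \<odot> shm a f"
  unfolding shm_def ccomp_def ..

lemma shm_cid: "shm a (cid X) = cid (sh a X)"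
  by (simp add: shm_def cid_def)

lemma shm_eq_iff [simp]: "shm a f = shm a g \<longleftrightarrow> f = g"
proof
  assume "shm a f = shm a g"
  then have "shm (- a) (shm a f) = shm (- a) (shm a g)" by simp
  then show "f = g" by simp
qed simp

lemma sh_CI:
  assumes "X \<in> CI lo hi"
  shows "sh a X \<in> CI (lo + a) (hi + a)"
proof -
  note X = CI_proj_complex[OF assms]
  have e: "i + 1 - a = (i - a) + 1" for i by simp
  have "proj_complex (sh a X)"
    using X unfolding proj_complex_def ob_sh diff_sh e by blast
  then show ?thesis using CI_zero[OF assms] by (auto simp: CI_def)
qed

lemma sh_chain:
  assumes "f \<in> chain_maps X Y"
  shows "shm a f \<in> chain_maps (sh a X) (sh a Y)"
proof -
  have e: "i + 1 - a = (i - a) + 1" for i by simp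
  show ?thesis
    unfolding chain_maps_def
  proof (intro CollectI allI)
    fix i
    have "f (i - a) \<in> mod_hom (ob X (i - a)) (ob Y (i - a)) \<and>
        diff Y (i - a) \<circ> f (i - a) = f (i - a + 1) \<circ> diff X (i - a)"
      using assms by (simp add: chain_maps_def)
    then show "shm a f i \<in> mod_hom (ob (sh a X) i) (ob (sh a Y) i) \<and>
        diff (sh a Y) i \<circ> shm a f i = shm a f (i + 1) \<circ> diff (sh a X) i"
      unfolding ob_sh diff_sh shm_def e .
  qed
qed

lemma sh_chain_iff: "shm a f \<in> chain_maps (sh a X) (sh a Y) \<longleftrightarrow> f \<in> chain_maps X Y"
  using sh_chain[of f X Y a] sh_chain[of "shm a f" "sh a X" "sh a Y" "- a"] by auto

lemma unshift:
  obtains X' where "(X :: ('a::ring_1, 'm::zero) cpx) = sh a X'"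
proof
  show "X = sh a (sh (- a) X)" by simp
qed

lemma unshift_map:
  obtains f' where "(f :: 'm cmap) = shm a f'"
proof
  show "f = shm a (shm (- a) f)" by simp
qed

lemma sh_CI_iff: "sh a X \<in> CI (lo + a) (hi + a) \<longleftrightarrow> X \<in> CI lo hi"
  using sh_CI[of X lo hi a] sh_CI[of "sh a X" "lo + a" "hi + a" "- a"] by auto

text \<open>Quantifiers over shifted windows and shifted maps are reindexed, so that every notion
  built from them transfers by rewriting alone.\<close>

lemma all_sh: "(\<forall>W\<in>CI (lo + a) (hi + a). P W) \<longleftrightarrow> (\<forall>W\<in>CI lo hi. P (sh a W))"
  by (metis sh_CI_iff unshift)

lemma all_shm: "(\<forall>f\<in>chain_maps (sh a X) (sh a Y). P f) \<longleftrightarrow> (\<forall>f\<in>chain_maps X Y. P (shm a f))"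
  by (metis sh_chain_iff unshift_map)

lemma ex_shm: "(\<exists>f\<in>chain_maps (sh a X) (sh a Y). P f) \<longleftrightarrow> (\<exists>f\<in>chain_maps X Y. P (shm a f))"
  by (metis sh_chain_iff unshift_map)

lemmas shift_simps = sh_CI_iff sh_chain_iff all_sh all_shm ex_shm shm_comp[symmetric] shm_cid[symmetric] shm_eq_iff

lemma is_section_sh: "is_section (sh a X) (sh a Y) (shm a f) \<longleftrightarrow> is_section X Y f"
  unfolding is_section_def by (simp only: shift_simps)

lemma is_retraction_sh: "is_retraction (sh a X) (sh a Y) (shm a f) \<longleftrightarrow> is_retraction X Y f"
  unfolding is_retraction_def by (simp only: shift_simps)

lemma is_automorphism_sh: "is_automorphism (sh a X) (shm a f) \<longleftrightarrow> is_automorphism X f"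
  unfolding is_automorphism_def by (simp only: shift_simps)

lemma irr_sh: "irr (lo + a) (hi + a) (sh a X) (sh a Y) (shm a f) \<longleftrightarrow> irr lo hi X Y f"
  unfolding irr_def by (simp only: shift_simps is_section_sh is_retraction_sh)

lemma ass_sh: "ass (lo + a) (hi + a) (sh a X) (sh a Y) (sh a Z) (shm a f) (shm a g) \<longleftrightarrow> ass lo hi X Y Z f g"
proof -
  have "(\<forall>i. split_exact (ob X (i - a)) (ob Y (i - a)) (ob Z (i - a)) (f (i - a)) (g (i - a))) \<longleftrightarrow>
      (\<forall>i. split_exact (ob X i) (ob Y i) (ob Z i) (f i) (g i))"
    by (metis add_diff_cancel_right')
  then have "(\<forall>i. split_exact (ob (sh a X) i) (ob (sh a Y) i) (ob (sh a Z) i) (shm a f i) (shm a g i)) \<longleftrightarrow>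
      (\<forall>i. split_exact (ob X i) (ob Y i) (ob Z i) (f i) (g i))"
    by (simp add: shm_def)
  then show ?thesis
    unfolding ass_def lasplit_def rasplit_def left_minimal_def right_minimal_def
    by (simp only: shift_simps is_section_sh is_retraction_sh is_automorphism_sh)
qed

lemma null_strict_sh:
  assumes "proj_complex X" "proj_complex (sh a X)"
  shows "null_object strict (sh a X) \<longleftrightarrow> null_object strict X"
  using shm_eq_iff[of a "cid X" czero] unfolding null_object_def strict_def
  by (simp add: shm_cid) (simp add: shm_def czero_def)

lemma triv_idem_sh:
  fixes X :: "('a::ring_1, 'm::zero) cpx"
  shows "triv_idem (sh a X) \<longleftrightarrow> triv_idem X"
proof -
  have "shm a czero = czero" by (simp add: shm_def czero_def)
  then have z: "shm a e = czero \<longleftrightarrow> e = czero" for e :: "'m cmap"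
    by (metis shm_eq_iff)
  show ?thesis
    unfolding triv_idem_def by (simp only: shift_simps z)
qed

section \<open>Translation functors as shifts\<close>

lemma diff_zero:
  assumes "X \<in> CI lo hi" "i < lo \<or> hi \<le> i"
  shows "diff X i = (\<lambda>_. 0)"
proof -
  have X: "proj_complex X" using assms(1) by (rule CI_proj_complex)
  show ?thesis
  proof (cases "i < lo")
    case True
    then show ?thesis
      using hom_from_zero[of "diff X i" "ob X (i + 1)"] cpx_diff[OF X, of i] CI_zero[OF assms(1)] cpx_mod[OF X] by simp
  next
    case False
    then show ?thesis
      using hom_into_zero[of "diff X i" "ob X i"] cpx_diff[OF X, of i] CI_zero[OF assms(1), of "i + 1"] assms(2) by simp
  qed
qed

text \<open>The case distinctions of the functor only touch degrees in which the objects and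
  differentials of a complex in \<open>Cn n\<close> are zero anyway.\<close>

lemma i_minus_ob: "X \<in> Cn n \<Longrightarrow> on_ob (i_minus n) X = sh 1 X"
  unfolding i_minus_def sh_def Cn_eq_CI
  by (auto simp: fun_eq_iff CI_zero diff_zero)

lemma i_zero_ob: "X \<in> Cn n \<Longrightarrow> on_ob (i_zero n) X = X"
  unfolding i_zero_def Cn_eq_CI
  by (rule cpx.equality) (auto simp: fun_eq_iff CI_zero diff_zero)

lemma chain_zero_outside:
  assumes "X \<in> CI lo hi" "Y \<in> CI lo hi" "f \<in> chain_maps X Y" "i < lo \<or> hi < i"
  shows "f i = (\<lambda>_. 0)"
  using gmaps_into_zero[OF chain_gmaps[OF assms(3)] CI_zero[OF assms(2,4)]] by blast

lemma i_minus_mor: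
  assumes "X \<in> Cn n" "Y \<in> Cn n" "f \<in> chain_maps X Y"
  shows "on_mor (i_minus n) f = shm 1 f"
  using chain_zero_outside[OF assms[unfolded Cn_eq_CI]] by (auto simp: i_minus_def shm_def fun_eq_iff)

lemma i_zero_mor:
  assumes "X \<in> Cn n" "Y \<in> Cn n" "f \<in> chain_maps X Y"
  shows "on_mor (i_zero n) f = f"
  using chain_zero_outside[OF assms[unfolded Cn_eq_CI]] by (auto simp: i_zero_def fun_eq_iff)

lemma sh_Cn:
  assumes "X \<in> Cn m" "a \<le> s"
  shows "sh (int a) X \<in> Cn (m + s)"
  using CI_mono[OF sh_CI[OF assms(1)[unfolded Cn_eq_CI], of "int a"]] assms(2) by (simp add: Cn_eq_CI)

text \<open>The witness applies \<open>i_minus\<close> in the first \<open>a\<close> steps and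
  \<open>i_zero\<close> in the remaining \<open>s - a\<close>.\<close>

lemma translation_by:
  assumes "a \<le> s"
  obtains F :: "('a::ring_1, 'm::zero) cfunctor" where "translation m (m + s) F"
    "\<And>X. X \<in> Cn m \<Longrightarrow> on_ob F X = sh (int a) X"
    "\<And>(X :: ('a, 'm) cpx) Y f. X \<in> Cn m \<Longrightarrow> Y \<in> Cn m \<Longrightarrow> f \<in> chain_maps X Y \<Longrightarrow> on_mor F f = shm (int a) f"
proof -
  have "\<exists>F :: ('a, 'm) cfunctor. translation m (m + s) F \<and> (\<forall>X\<in>Cn m. on_ob F X = sh (int a) X) \<and>
      (\<forall>X\<in>(Cn m :: ('a, 'm) cpx set). \<forall>Y\<in>Cn m. \<forall>f\<in>chain_maps X Y. on_mor F f = shm (int a) f)"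
    using assms
  proof (induction s arbitrary: a)
    case 0
    then show ?case
      by (intro exI[of _ functor_id]) (auto simp: functor_id_def intro: translation.refl[unfolded functor_id_def])
  next
    case (Suc s)
    show ?case
    proof (cases "a \<le> s")
      case True
      then obtain F :: "('a, 'm) cfunctor" where F: "translation m (m + s) F" "\<forall>X\<in>Cn m. on_ob F X = sh (int a) X"
        "\<forall>X\<in>(Cn m :: ('a, 'm) cpx set). \<forall>Y\<in>Cn m. \<forall>f\<in>chain_maps X Y. on_mor F f = shm (int a) f"
        using Suc.IH[OF True] by (elim exE conjE) (rule that)
      have "translation m (m + Suc s) (functor_comp (i_zero (m + s)) F)"
        using translation.zero[OF F(1)] by simp
      moreover have "on_ob (functor_comp (i_zero (m + s)) F) X = sh (int a) X" if "X \<in> Cn m" for X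
        using F(2) i_zero_ob[OF sh_Cn[OF that True]] that by (simp add: functor_comp_def)
      moreover have "on_mor (functor_comp (i_zero (m + s)) F) f = shm (int a) f"
        if "X \<in> Cn m" "Y \<in> Cn m" "f \<in> chain_maps X Y" for X Y :: "('a, 'm) cpx" and f
        using F(3) i_zero_mor[OF sh_Cn[OF that(1) True] sh_Cn[OF that(2) True] sh_chain[OF that(3)]] that
        by (auto simp: functor_comp_def)
      ultimately show ?thesis by blast
    next
      case False
      then have a: "a = Suc s" using Suc.prems by simp
      obtain F :: "('a, 'm) cfunctor" where F: "translation m (m + s) F" "\<forall>X\<in>Cn m. on_ob F X = sh (int s) X"
        "\<forall>X\<in>(Cn m :: ('a, 'm) cpx set). \<forall>Y\<in>Cn m. \<forall>f\<in>chain_maps X Y. on_mor F f = shm (int s) f"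
        using Suc.IH[OF order_refl] by (elim exE conjE) (rule that)
      have "translation m (m + Suc s) (functor_comp (i_minus (m + s)) F)"
        using translation.minus[OF F(1)] by simp
      moreover have "on_ob (functor_comp (i_minus (m + s)) F) X = sh (int a) X" if "X \<in> Cn m" for X
        using F(2) i_minus_ob[OF sh_Cn[OF that order_refl]] that by (simp add: functor_comp_def a)
      moreover have "on_mor (functor_comp (i_minus (m + s)) F) f = shm (int a) f"
        if "X \<in> Cn m" "Y \<in> Cn m" "f \<in> chain_maps X Y" for X Y :: "('a, 'm) cpx" and f
        using F(3) i_minus_mor[OF sh_Cn[OF that(1) order_refl] sh_Cn[OF that(2) order_refl] sh_chain[OF that(3)]] that
        by (auto simp: functor_comp_def a)
      ultimately show ?thesis by blast
    qed
  qed
  then show ?thesis using that by blast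
qed

section \<open>The statements for the categories \<open>Cn\<close>\<close>

lemma irreducible_mor_iff: "irreducible_mor n X Y f \<longleftrightarrow> irr 1 (int n) X Y f"
  by (simp add: irreducible_mor_def irr_def Cn_eq_CI)

lemma almost_split_seq_iff: "almost_split_seq n X Y Z f g \<longleftrightarrow> ass 1 (int n) X Y Z f g"
  unfolding almost_split_seq_def E_pair_def left_almost_split_def right_almost_split_def ass_def
    lasplit_def rasplit_def Cn_eq_CI by blast

lemma indecomposable_Cn_iff:
  "indecomposable strict (Cn n) X \<longleftrightarrow> X \<in> CI 1 (int n) \<and> \<not> null_object strict X \<and> triv_idem X"
  by (simp add: Cn_eq_CI indecomposable_strict_iff)

theorem theorem3p21:
  fixes scale :: "'k::alg_closed_field \<Rightarrow> 'a::ring_1 \<Rightarrow> 'a"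
    and \<eta> r :: nat
  assumes algebra: "fin_dim_algebra scale"
    and universe: "\<exists>e :: 'a list \<Rightarrow> 'm::zero. inj e"
    and sgldim: "strong_gl_dim TYPE('a) TYPE('m) = enat \<eta>"
    and eta: "\<eta> \<ge> 1"
    and r: "r \<ge> 2"
  shows
    "(\<forall>(X :: ('a, 'm) cpx) Y f.
        irreducible_mor (\<eta> + r) X Y f \<and>
        indecomposable strict (Cn (\<eta> + r)) X \<and> indecomposable strict (Cn (\<eta> + r)) Y \<longrightarrow>
        (\<exists>F X' Y' g. translation (\<eta> + 1) (\<eta> + r) F \<and>
           irreducible_mor (\<eta> + 1) X' Y' g \<and>
           indecomposable strict (Cn (\<eta> + 1)) X' \<and> indecomposable strict (Cn (\<eta> + 1)) Y' \<and>
           on_ob F X' = X \<and> on_ob F Y' = Y \<and> on_mor F g = f)) \<and>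
     (\<forall>(X :: ('a, 'm) cpx) Y g.
        irreducible_mor (\<eta> + 1) X Y g \<and>
        indecomposable strict (Cn (\<eta> + 1)) X \<and> indecomposable strict (Cn (\<eta> + 1)) Y \<longrightarrow>
        (\<exists>F. translation (\<eta> + 1) (\<eta> + r) F \<and>
           irreducible_mor (\<eta> + r) (on_ob F X) (on_ob F Y) (on_mor F g))) \<and>
     (\<forall>(X :: ('a, 'm) cpx) Y Z f g.
        almost_split_seq (\<eta> + r) X Y Z f g \<longrightarrow>
        (\<exists>F X' Y' Z' f' g'. translation (\<eta> + 1) (\<eta> + r) F \<and>
           almost_split_seq (\<eta> + 1) X' Y' Z' f' g' \<and>
           on_ob F X' = X \<and> on_ob F Y' = Y \<and> on_ob F Z' = Z \<and> on_mor F f' = f \<and> on_mor F g' = g)) \<and>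
     (\<forall>(X :: ('a, 'm) cpx) Y Z f g.
        almost_split_seq (\<eta> + 1) X Y Z f g \<longrightarrow>
        (\<exists>F. translation (\<eta> + 1) (\<eta> + r) F \<and>
           almost_split_seq (\<eta> + r) (on_ob F X) (on_ob F Y) (on_ob F Z) (on_mor F f) (on_mor F g)))"
proof -
  have band: "band_splitting TYPE(('a, 'm) cpx) \<eta>"
    by (rule band_splitting[OF algebra sgldim eta])
  \<comment> \<open>Lists form an infinite type, so \<open>'m\<close> is infinite and carries a
    pairing for direct sums.\<close>
  obtain e :: "'a list \<Rightarrow> 'm" where "inj e" using universe by blast
  then have "infinite (UNIV :: 'm set)"
    using infinite_UNIV_listI finite_imageD[of e UNIV] finite_subset[of "range e" UNIV] by blast
  then obtain pr :: "'m \<Rightarrow> 'm \<Rightarrow> 'm" and p1 p2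
    where "\<And>x y. p1 (pr x y) = x" "\<And>x y. p2 (pr x y) = y" "pr 0 0 = 0"
    by (rule pairing_exists) blast
  then interpret pairing pr p1 p2
    by unfold_locales
  have N: "int (\<eta> + 1) = 1 + int \<eta>" by simp
  have mr: "(\<eta> + 1) + (r - 1) = \<eta> + r" using r by simp
  have un: "sh (- (a - 1)) X \<in> Cn (\<eta> + 1)" if "X \<in> CI a (a + int \<eta>)" for a and X :: "('a, 'm) cpx"
    using sh_CI[OF that, of "- (a - 1)"] by (simp add: Cn_eq_CI add.commute)
  \<comment> \<open>A window starting in degree \<open>a\<close> is the standard one shifted by
    \<open>a - 1\<close>; the bounds on \<open>a\<close> say that this shift lies between
    \<open>0\<close> and \<open>r - 1\<close>.\<close>
  have trans: "\<exists>F :: ('a, 'm) cfunctor. translation (\<eta> + 1) (\<eta> + r) F \<and> (\<forall>X\<in>Cn (\<eta> + 1). on_ob F X = sh (a - 1) X) \<and>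
      (\<forall>X\<in>(Cn (\<eta> + 1) :: ('a, 'm) cpx set). \<forall>Y\<in>Cn (\<eta> + 1). \<forall>f\<in>chain_maps X Y. on_mor F f = shm (a - 1) f)"
    if "1 \<le> a" "a + int \<eta> \<le> int (\<eta> + r)" for a
  proof -
    have "nat (a - 1) \<le> r - 1" "int (nat (a - 1)) = a - 1" using that by simp_all
    then show ?thesis
      using translation_by[of "nat (a - 1)" "r - 1" "\<eta> + 1"] unfolding mr by (metis (no_types, lifting))
  qed
  show ?thesis
  proof (intro conjI allI impI)
    fix X Y :: "('a, 'm) cpx" and f
    assume "irreducible_mor (\<eta> + r) X Y f \<and>
        indecomposable strict (Cn (\<eta> + r)) X \<and> indecomposable strict (Cn (\<eta> + r)) Y"
    then have f: "irr 1 (int (\<eta> + r)) X Y f" and nX: "\<not> null_object strict X" "triv_idem X"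
      and nY: "\<not> null_object strict Y" "triv_idem Y"
      by (simp_all add: irreducible_mor_iff indecomposable_Cn_iff)
    obtain a where a: "1 \<le> a" "a + int \<eta> \<le> int (\<eta> + r)" and XC: "X \<in> CI a (a + int \<eta>)" and YC: "Y \<in> CI a (a + int \<eta>)"
      using irr_window[OF band _ f nX(2) nY(2) nX(1) nY(1)] r by auto
    obtain F :: "('a, 'm) cfunctor" where F: "translation (\<eta> + 1) (\<eta> + r) F" "\<forall>X\<in>Cn (\<eta> + 1). on_ob F X = sh (a - 1) X"
      "\<forall>X\<in>(Cn (\<eta> + 1) :: ('a, 'm) cpx set). \<forall>Y\<in>Cn (\<eta> + 1). \<forall>f\<in>chain_maps X Y. on_mor F f = shm (a - 1) f"
      using trans[OF a] by blast
    let ?b = "- (a - 1)"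
    have fa: "irr a (a + int \<eta>) X Y f" by (rule irr_mono[OF f a XC YC])
    then have "irr (a + ?b) (a + int \<eta> + ?b) (sh ?b X) (sh ?b Y) (shm ?b f)" by (simp only: irr_sh)
    then have g: "irreducible_mor (\<eta> + 1) (sh ?b X) (sh ?b Y) (shm ?b f)"
      by (simp add: irreducible_mor_iff add.commute)
    have i: "indecomposable strict (Cn (\<eta> + 1)) (sh ?b W)"
      if W: "W \<in> CI a (a + int \<eta>)" "\<not> null_object strict W" "triv_idem W" for W :: "('a, 'm) cpx"
    proof -
      have C: "sh ?b W \<in> Cn (\<eta> + 1)" by (rule un[OF W(1)])
      then show ?thesis
        using null_strict_sh[of W ?b] W CI_proj_complex triv_idem_sh[of ?b W]
        by (metis Cn_eq_CI indecomposable_Cn_iff)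
    qed
    have "f \<in> chain_maps X Y" using f by (simp add: irr_def)
    then have "on_mor F (shm ?b f) = f"
      using bspec[OF bspec[OF bspec[OF F(3) un[OF XC]] un[OF YC]] sh_chain, of f] by simp
    moreover have "on_ob F (sh ?b X) = X" "on_ob F (sh ?b Y) = Y"
      using F(2)[rule_format, OF un[OF XC]] F(2)[rule_format, OF un[OF YC]] by simp_all
    ultimately show "\<exists>F X' Y' g. translation (\<eta> + 1) (\<eta> + r) F \<and>
           irreducible_mor (\<eta> + 1) X' Y' g \<and>
           indecomposable strict (Cn (\<eta> + 1)) X' \<and> indecomposable strict (Cn (\<eta> + 1)) Y' \<and>
           on_ob F X' = X \<and> on_ob F Y' = Y \<and> on_mor F g = f"
      using F(1) g i[OF XC nX] i[OF YC nY] by blast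
  next
    fix X Y :: "('a, 'm) cpx" and g
    assume A: "irreducible_mor (\<eta> + 1) X Y g \<and>
        indecomposable strict (Cn (\<eta> + 1)) X \<and> indecomposable strict (Cn (\<eta> + 1)) Y"
    then have g: "irr 1 (1 + int \<eta>) X Y g" and nX: "\<not> null_object strict X" "triv_idem X"
      and nY: "\<not> null_object strict Y" "triv_idem Y"
      by (simp_all add: irreducible_mor_iff indecomposable_Cn_iff)
    have C: "X \<in> Cn (\<eta> + 1)" "Y \<in> Cn (\<eta> + 1)" "g \<in> chain_maps X Y"
      using A by (auto simp: irreducible_mor_def)
    \<comment> \<open>Only the two extreme translations occur: \<open>a = 1\<close> adds degrees at
      the top, \<open>a = r\<close> at the bottom.\<close>
    from irr_no_map[OF band HOL.refl g nX(2) nY(2) nX(1) nY(1)]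
    have "\<exists>a. 1 \<le> a \<and> a + int \<eta> \<le> int (\<eta> + r) \<and> irreducible_mor (\<eta> + r) (sh (a - 1) X) (sh (a - 1) Y) (shm (a - 1) g)"
    proof
      assume "no_map_out Y (1 + int \<eta>)"
      from irr_extend_right[OF g this, of "int (\<eta> + r)"] r show ?thesis
        by (intro exI[of _ 1]) (simp add: irreducible_mor_iff)
    next
      assume "no_map_in X 1"
      \<comment> \<open>The window is extended downwards by \<open>r - 1\<close> degrees, and the
        shift by \<open>r - 1\<close> brings the interval back to start in degree 1.\<close>
      from irr_extend_left[OF g this, of "1 - int (r - 1)"]
      have "irr (1 - int (r - 1)) (1 + int \<eta>) X Y g" by simp
      then have "irr (1 - int (r - 1) + int (r - 1)) (1 + int \<eta> + int (r - 1))
          (sh (int (r - 1)) X) (sh (int (r - 1)) Y) (shm (int (r - 1)) g)" by (simp only: irr_sh)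
      with r show ?thesis
        by (intro exI[of _ "int r"]) (simp add: irreducible_mor_iff of_nat_diff add.commute)
    qed
    then obtain a where a: "1 \<le> a" "a + int \<eta> \<le> int (\<eta> + r)"
      "irreducible_mor (\<eta> + r) (sh (a - 1) X) (sh (a - 1) Y) (shm (a - 1) g)" by blast
    then show "\<exists>F. translation (\<eta> + 1) (\<eta> + r) F \<and>
           irreducible_mor (\<eta> + r) (on_ob F X) (on_ob F Y) (on_mor F g)"
      using trans[OF a(1,2)] C by metis
  next
    fix X Y Z :: "('a, 'm) cpx" and f g
    assume "almost_split_seq (\<eta> + r) X Y Z f g"
    then have s: "ass 1 (int (\<eta> + r)) X Y Z f g" by (simp add: almost_split_seq_iff)
    obtain a where a: "1 \<le> a" "a + int \<eta> \<le> int (\<eta> + r)" and XC: "X \<in> CI a (a + int \<eta>)" and YC: "Y \<in> CI a (a + int \<eta>)"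
      and ZC: "Z \<in> CI a (a + int \<eta>)"
      using ass_window[OF algebra band _ s] r by auto
    obtain F :: "('a, 'm) cfunctor" where F: "translation (\<eta> + 1) (\<eta> + r) F" "\<forall>X\<in>Cn (\<eta> + 1). on_ob F X = sh (a - 1) X"
      "\<forall>X\<in>(Cn (\<eta> + 1) :: ('a, 'm) cpx set). \<forall>Y\<in>Cn (\<eta> + 1). \<forall>f\<in>chain_maps X Y. on_mor F f = shm (a - 1) f"
      using trans[OF a] by blast
    let ?b = "- (a - 1)"
    have "ass a (a + int \<eta>) X Y Z f g" by (rule ass_mono[OF s a XC YC ZC])
    then have "ass (a + ?b) (a + int \<eta> + ?b) (sh ?b X) (sh ?b Y) (sh ?b Z) (shm ?b f) (shm ?b g)"
      by (simp only: ass_sh)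
    then have s': "almost_split_seq (\<eta> + 1) (sh ?b X) (sh ?b Y) (sh ?b Z) (shm ?b f) (shm ?b g)"
      by (simp add: almost_split_seq_iff add.commute)
    have "f \<in> chain_maps X Y" "g \<in> chain_maps Y Z" using s by (simp_all add: ass_def lasplit_def rasplit_def)
    then have "on_mor F (shm ?b f) = f" "on_mor F (shm ?b g) = g"
      using bspec[OF bspec[OF bspec[OF F(3) un[OF XC]] un[OF YC]] sh_chain, of f]
        bspec[OF bspec[OF bspec[OF F(3) un[OF YC]] un[OF ZC]] sh_chain, of g]
      by simp_all
    moreover have "on_ob F (sh ?b X) = X" "on_ob F (sh ?b Y) = Y" "on_ob F (sh ?b Z) = Z"
      using F(2)[rule_format, OF un[OF XC]] F(2)[rule_format, OF un[OF YC]] F(2)[rule_format, OF un[OF ZC]]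
      by simp_all
    ultimately show "\<exists>F X' Y' Z' f' g'. translation (\<eta> + 1) (\<eta> + r) F \<and>
           almost_split_seq (\<eta> + 1) X' Y' Z' f' g' \<and>
           on_ob F X' = X \<and> on_ob F Y' = Y \<and> on_ob F Z' = Z \<and> on_mor F f' = f \<and> on_mor F g' = g"
      using F(1) s' by blast
  next
    fix X Y Z :: "('a, 'm) cpx" and f g
    assume A: "almost_split_seq (\<eta> + 1) X Y Z f g"
    then have s: "ass 1 (1 + int \<eta>) X Y Z f g" by (simp add: almost_split_seq_iff)
    have C: "X \<in> Cn (\<eta> + 1)" "Y \<in> Cn (\<eta> + 1)" "Z \<in> Cn (\<eta> + 1)" "f \<in> chain_maps X Y" "g \<in> chain_maps Y Z"
      using A by (auto simp: almost_split_seq_def E_pair_def)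
    from ass_no_map[OF band HOL.refl s]
    have "\<exists>a. 1 \<le> a \<and> a + int \<eta> \<le> int (\<eta> + r) \<and>
      almost_split_seq (\<eta> + r) (sh (a - 1) X) (sh (a - 1) Y) (sh (a - 1) Z) (shm (a - 1) f) (shm (a - 1) g)"
    proof
      assume "no_map_out Z (1 + int \<eta>)"
      from ass_extend_right[OF s this, of "int (\<eta> + r)"] r show ?thesis
        by (intro exI[of _ 1]) (simp add: almost_split_seq_iff)
    next
      assume "no_map_in X 1"
      from ass_extend_left[OF s this, of "1 - int (r - 1)"]
      have "ass (1 - int (r - 1)) (1 + int \<eta>) X Y Z f g" by simp
      then have "ass (1 - int (r - 1) + int (r - 1)) (1 + int \<eta> + int (r - 1))
          (sh (int (r - 1)) X) (sh (int (r - 1)) Y) (sh (int (r - 1)) Z) (shm (int (r - 1)) f) (shm (int (r - 1)) g)"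
        by (simp only: ass_sh)
      with r show ?thesis
        by (intro exI[of _ "int r"]) (simp add: almost_split_seq_iff of_nat_diff add.commute)
    qed
    then obtain a where a: "1 \<le> a" "a + int \<eta> \<le> int (\<eta> + r)"
      "almost_split_seq (\<eta> + r) (sh (a - 1) X) (sh (a - 1) Y) (sh (a - 1) Z) (shm (a - 1) f) (shm (a - 1) g)" by blast
    then show "\<exists>F. translation (\<eta> + 1) (\<eta> + r) F \<and>
           almost_split_seq (\<eta> + r) (on_ob F X) (on_ob F Y) (on_ob F Z) (on_mor F f) (on_mor F g)"
      using trans[OF a(1,2)] C by metis
  qed
qed

end
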